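(* Let $\mathbb{k}$ be any field of characteristic two, let $\mu$ be any $(d-1)$-dimensional simplicial cycle over $\mathbb{k}$ with support $|\mu|$, and let $\mathbb{k}[|\mu|]$ be the associated graded commutative face ring. Then, for some field extension $\mathbb{k}'$ of $\mathbb{k}$, there is an Artinian reduction $\mathcal{A}(\mu)$ (of the face ring of $|\mu|$ over $\mathbb{k}'$) that is anisotropic, i.e. for every $k\le\frac{d}{2}$ and every nonzero element $u\in\mathcal{B}^k(\mu)$ we have \[u^2\ \neq\ 0,\] where $\mathcal{B}^\ast(\mu)$ is the Gorensteinification of $\mathcal{A}^\ast(\mu)$ with respect to $\mu$.
   Context: All of the following is taken over the field under consideration (here $\mathbb{k}'$, with $\mu$ viewed as a cycle over $\mathbb{k}'$ by extension of scalars); write $K$ for that field. Face ring: for a (finite) simplicial complex $\Delta$ of dimension $d-1$ with vertex set $\Delta^{(0)}$, $K[\Delta]=K[x_v\mid v\in\Delta^{(0)}]/I_\Delta$, where $I_\Delta$ is generated by the monomials $x_{v_1}\cdots x_{v_j}$ with $\{v_1,\dots,v_j\}\notin\Delta$; it is graded with $\deg x_v=1$. Artinian reduction: $\mathcal{A}^\ast(\Delta)=K[\Delta]/\Theta\,K[\Delta]$, where $\Theta=(\theta_1,\dots,\theta_d)$ is a linear system of parameters (degree one elements with finite-dimensional quotient). The coefficients of $\Theta$ form a $d\times|\Delta^{(0)}|$ matrix $\mathbf{V}$. Simplicial cycle: a $(d-1)$-dimensional simplicial cycle in a $(d-1)$-dimensional complex $\Delta$ is a nonzero element $\mu\in H_{d-1}(\Delta;K)$.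 Its support $|\mu|$ is the minimal simplicial complex containing $\mu$, i.e. the complex generated by the $(d-1)$-faces with nonzero coefficient in $\mu$. Write $\mathcal{A}^\ast(\mu)$ for an Artinian reduction $\mathcal{A}^\ast(|\mu|)$. Degree map and Gorensteinification: fix an order on the vertices. There is a canonical isomorphism $\mathcal{A}^d(\Delta)\cong H^{d-1}(\Delta;K)$, and composing it with evaluation at $\mu$ gives a surjective linear map $\mu^\vee:\mathcal{A}^d(\Delta)\to K$, characterized by $\mu^\vee(\mathbf{x}_F)=\mu_F/|\mathbf{V}_{|F}|$ for each face $F$ of cardinality $d$, where $\mathbf{x}_F=\prod_{v\in F}x_v$, $\mu_F$ is the oriented coefficient of $\mu$ at $F$, and $|\mathbf{V}_{|F}|$ is the determinant of the minor of $\mathbf{V}$ with columns indexed by $F$. Let $L^k\subseteq\mathcal{A}^k(\Delta)$ be the set of elements $a$ with $\mu^\vee(ab)=0$ for all $b\in\mathcal{A}^{d-k}(\Delta)$, and $L^\ast=\bigoplus_kL^k$, a homogeneous ideal. Then $\mathcal{B}^\ast_\mu(\Delta)=\mathcal{A}^\ast(\Delta)/L^\ast$, and $\mathcal{B}^\ast(\mu):=\mathcal{B}^\ast_\mu(|\mu|)$. *)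

theory Defs
  imports
    "HOL-Algebra.Algebraic_Closure_Type"
    "HOL-Algebra.Indexed_Polynomials"
    "HOL-Algebra.Embedded_Algebras"
    "HOL-Computational_Algebra.Fraction_Field"
    "HOL-Combinatorics.Permutations"
    "HOL-Library.FuncSet"
    "HOL-Library.Poly_Mapping"
begin

section \<open>Simplicial complexes and cycles\<close>

definition simplicial_complex :: "'v set set \<Rightarrow> bool" where
  "simplicial_complex \<Delta> \<longleftrightarrow>
     finite \<Delta> \<and> {} \<in> \<Delta> \<and> (\<forall>F\<in>\<Delta>. finite F \<and> (\<forall>G. G \<subseteq> F \<longrightarrow> G \<in> \<Delta>))"

text \<open>A complex of dimension \<open>d - 1\<close> is one with \<open>max_face_card \<Delta> = d\<close>; this avoids subtraction
  on the natural numbers.\<close>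

definition max_face_card :: "'v set set \<Rightarrow> nat" where
  "max_face_card \<Delta> = Max (card ` \<Delta>)"

definition vertices :: "'v set set \<Rightarrow> 'v set" where
  "vertices \<Delta> = {v. {v} \<in> \<Delta>}"

text \<open>Chains of dimension \<open>d - 1\<close>: every face of cardinality \<open>d\<close> carries the orientation given by
  the order on the vertices.\<close>

definition chains :: "('k, 'm) ring_scheme \<Rightarrow> 'v set set \<Rightarrow> nat \<Rightarrow> ('v set \<Rightarrow> 'k) set" where
  "chains K \<Delta> d =
     {\<mu>. \<forall>F. if F \<in> \<Delta> \<and> card F = d then \<mu> F \<in> carrier K else \<mu> F = \<zero>\<^bsub>K\<^esub>}"

text \<open>The coefficient of the simplicial boundary of \<open>\<mu>\<close> at \<open>G\<close>. The vertex \<open>v\<close> of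
  \<open>insert v G\<close> stands at position \<open>card {w \<in> G. w < v}\<close>.\<close>

definition boundary ::
  "('k, 'm) ring_scheme \<Rightarrow> 'v::linorder set set \<Rightarrow> ('v set \<Rightarrow> 'k) \<Rightarrow> 'v set \<Rightarrow> 'k" where
  "boundary K \<Delta> \<mu> G =
     (\<Oplus>\<^bsub>K\<^esub> v \<in> {v. v \<notin> G \<and> insert v G \<in> \<Delta>}.
        (\<ominus>\<^bsub>K\<^esub> \<one>\<^bsub>K\<^esub>) [^]\<^bsub>K\<^esub> card {w \<in> G. w < v} \<otimes>\<^bsub>K\<^esub> \<mu> (insert v G))"

text \<open>Nonzero elements of the homology in degree \<open>d - 1\<close> of a complex of dimension \<open>d - 1\<close>: there
  are no chains of dimension \<open>d\<close>, so homology classes are the same as cycles. The homology is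
  reduced: for \<open>d = 1\<close> the condition at \<open>G = {}\<close> says that the coefficients sum to zero.\<close>

definition simplicial_cycle ::
  "('k, 'm) ring_scheme \<Rightarrow> 'v::linorder set set \<Rightarrow> nat \<Rightarrow> ('v set \<Rightarrow> 'k) \<Rightarrow> bool" where
  "simplicial_cycle K \<Delta> d \<mu> \<longleftrightarrow>
     \<mu> \<in> chains K \<Delta> d \<and> (\<exists>F. \<mu> F \<noteq> \<zero>\<^bsub>K\<^esub>) \<and>
     (\<forall>G\<in>\<Delta>. card G + 1 = d \<longrightarrow> boundary K \<Delta> \<mu> G = \<zero>\<^bsub>K\<^esub>)"

definition cycle_support :: "('k, 'm) ring_scheme \<Rightarrow> ('v set \<Rightarrow> 'k) \<Rightarrow> 'v set set" where
  "cycle_support K \<mu> = {G. \<exists>F. \<mu> F \<noteq> \<zero>\<^bsub>K\<^esub> \<and> G \<subseteq> F}"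


section \<open>Face rings\<close>

text \<open>The polynomial ring over \<open>K\<close> in variables indexed by \<open>S\<close>. The library provides its
  elements, its additive structure, constants and variables; the general product is
  added here. Monomials are multisets of variables.\<close>

definition mpoly_ring :: "('k, 'm) ring_scheme \<Rightarrow> 'v set \<Rightarrow> ('v multiset \<Rightarrow> 'k) ring" where
  "mpoly_ring K S =
     \<lparr>carrier = ring.indexed_pset K S (carrier K),
      monoid.mult = (\<lambda>P Q m. \<Oplus>\<^bsub>K\<^esub> a \<in> {a. a \<subseteq># m}. P a \<otimes>\<^bsub>K\<^esub> Q (m - a)),
      one = ring.indexed_const K \<one>\<^bsub>K\<^esub>,
      ring.zero = ring.indexed_const K \<zero>\<^bsub>K\<^esub>,
      add = ring.indexed_padd K\<rparr>"

definition homogeneous_polys ::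
  "('k, 'm) ring_scheme \<Rightarrow> 'v set \<Rightarrow> nat \<Rightarrow> ('v multiset \<Rightarrow> 'k) set" where
  "homogeneous_polys K S n =
     {P \<in> carrier (mpoly_ring K S). \<forall>m. P m \<noteq> \<zero>\<^bsub>K\<^esub> \<longrightarrow> size m = n}"

definition squarefree_monomial ::
  "('k, 'm) ring_scheme \<Rightarrow> 'v set \<Rightarrow> 'v set \<Rightarrow> ('v multiset \<Rightarrow> 'k)" where
  "squarefree_monomial K S F = (\<Otimes>\<^bsub>mpoly_ring K S\<^esub> v \<in> F. ring.indexed_var K v)"

definition face_ideal ::
  "('k, 'm) ring_scheme \<Rightarrow> 'v set set \<Rightarrow> ('v multiset \<Rightarrow> 'k) set" where
  "face_ideal K \<Delta> =
     genideal (mpoly_ring K (vertices \<Delta>))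
       {squarefree_monomial K (vertices \<Delta>) F | F. F \<subseteq> vertices \<Delta> \<and> F \<notin> \<Delta>}"

definition face_ring ::
  "('k, 'm) ring_scheme \<Rightarrow> 'v set set \<Rightarrow> ('v multiset \<Rightarrow> 'k) set ring" where
  "face_ring K \<Delta> = mpoly_ring K (vertices \<Delta>) Quot face_ideal K \<Delta>"

definition face_class ::
  "('k, 'm) ring_scheme \<Rightarrow> 'v set set \<Rightarrow> ('v multiset \<Rightarrow> 'k) \<Rightarrow> ('v multiset \<Rightarrow> 'k) set" where
  "face_class K \<Delta> P = face_ideal K \<Delta> +>\<^bsub>mpoly_ring K (vertices \<Delta>)\<^esub> P"


section \<open>Artinian reductions\<close>

text \<open>A sequence of \<open>d\<close> elements of degree one is given by its coefficient matrix \<open>V\<close>, with rows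
  \<open>i < d\<close> and columns indexed by the vertices.\<close>

definition linear_form ::
  "('k, 'm) ring_scheme \<Rightarrow> 'v set set \<Rightarrow> ('v \<Rightarrow> 'k) \<Rightarrow> ('v multiset \<Rightarrow> 'k) set" where
  "linear_form K \<Delta> c =
     (\<Oplus>\<^bsub>face_ring K \<Delta>\<^esub> v \<in> vertices \<Delta>.
        face_class K \<Delta> (ring.indexed_const K (c v))
          \<otimes>\<^bsub>face_ring K \<Delta>\<^esub> face_class K \<Delta> (ring.indexed_var K v))"

definition parameter_ideal ::
  "('k, 'm) ring_scheme \<Rightarrow> 'v set set \<Rightarrow> nat \<Rightarrow> (nat \<Rightarrow> 'v \<Rightarrow> 'k) \<Rightarrow> ('v multiset \<Rightarrow> 'k) set set" where
  "parameter_ideal K \<Delta> d V = genideal (face_ring K \<Delta>) {linear_form K \<Delta> (V i) | i. i < d}"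

definition art_ring ::
  "('k, 'm) ring_scheme \<Rightarrow> 'v set set \<Rightarrow> nat \<Rightarrow> (nat \<Rightarrow> 'v \<Rightarrow> 'k) \<Rightarrow> ('v multiset \<Rightarrow> 'k) set set ring" where
  "art_ring K \<Delta> d V = face_ring K \<Delta> Quot parameter_ideal K \<Delta> d V"

definition art_class ::
  "('k, 'm) ring_scheme \<Rightarrow> 'v set set \<Rightarrow> nat \<Rightarrow> (nat \<Rightarrow> 'v \<Rightarrow> 'k) \<Rightarrow> ('v multiset \<Rightarrow> 'k)
     \<Rightarrow> ('v multiset \<Rightarrow> 'k) set set" where
  "art_class K \<Delta> d V P = parameter_ideal K \<Delta> d V +>\<^bsub>face_ring K \<Delta>\<^esub> face_class K \<Delta> P"

definition art_const ::
  "('k, 'm) ring_scheme \<Rightarrow> 'v set set \<Rightarrow> nat \<Rightarrow> (nat \<Rightarrow> 'v \<Rightarrow> 'k) \<Rightarrow> 'k \<Rightarrow> ('v multiset \<Rightarrow> 'k) set set" where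
  "art_const K \<Delta> d V c = art_class K \<Delta> d V (ring.indexed_const K c)"

definition art_piece ::
  "('k, 'm) ring_scheme \<Rightarrow> 'v set set \<Rightarrow> nat \<Rightarrow> (nat \<Rightarrow> 'v \<Rightarrow> 'k) \<Rightarrow> nat
     \<Rightarrow> ('v multiset \<Rightarrow> 'k) set set set" where
  "art_piece K \<Delta> d V n = art_class K \<Delta> d V ` homogeneous_polys K (vertices \<Delta>) n"

definition linear_sop ::
  "('k, 'm) ring_scheme \<Rightarrow> 'v set set \<Rightarrow> nat \<Rightarrow> (nat \<Rightarrow> 'v \<Rightarrow> 'k) \<Rightarrow> bool" where
  "linear_sop K \<Delta> d V \<longleftrightarrow>
     (\<forall>i<d. \<forall>v\<in>vertices \<Delta>. V i v \<in> carrier K) \<and>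
     ring.finite_dimension (art_ring K \<Delta> d V)
       (art_const K \<Delta> d V ` carrier K) (carrier (art_ring K \<Delta> d V))"


section \<open>Degree map and Gorensteinification\<close>

text \<open>The determinant of the square matrix formed by the columns of \<open>V\<close> indexed by \<open>F\<close>, taken in
  increasing order.\<close>

definition minor_det ::
  "('k, 'm) ring_scheme \<Rightarrow> (nat \<Rightarrow> 'v::linorder \<Rightarrow> 'k) \<Rightarrow> 'v set \<Rightarrow> 'k" where
  "minor_det K V F =
     (\<Oplus>\<^bsub>K\<^esub> \<sigma> \<in> {\<sigma>. \<sigma> permutes {..<card F}}.
        (if evenperm \<sigma> then \<one>\<^bsub>K\<^esub> else \<ominus>\<^bsub>K\<^esub> \<one>\<^bsub>K\<^esub>) \<otimes>\<^bsub>K\<^esub>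
        (\<Otimes>\<^bsub>K\<^esub> i \<in> {..<card F}. V i (sorted_list_of_set F ! \<sigma> i)))"

definition is_degree_map ::
  "('k, 'm) ring_scheme \<Rightarrow> 'v::linorder set set \<Rightarrow> nat \<Rightarrow> (nat \<Rightarrow> 'v \<Rightarrow> 'k) \<Rightarrow> ('v set \<Rightarrow> 'k)
     \<Rightarrow> (('v multiset \<Rightarrow> 'k) set set \<Rightarrow> 'k) \<Rightarrow> bool" where
  "is_degree_map K \<Delta> d V \<mu> f \<longleftrightarrow>
     f \<in> art_piece K \<Delta> d V d \<rightarrow>\<^sub>E carrier K \<and>
     (\<forall>a\<in>art_piece K \<Delta> d V d. \<forall>b\<in>art_piece K \<Delta> d V d.
        f (a \<oplus>\<^bsub>art_ring K \<Delta> d V\<^esub> b) = f a \<oplus>\<^bsub>K\<^esub> f b) \<and>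
     (\<forall>c\<in>carrier K. \<forall>a\<in>art_piece K \<Delta> d V d.
        f (art_const K \<Delta> d V c \<otimes>\<^bsub>art_ring K \<Delta> d V\<^esub> a) = c \<otimes>\<^bsub>K\<^esub> f a) \<and>
     (\<forall>F\<in>\<Delta>. card F = d \<longrightarrow>
        f (art_class K \<Delta> d V (squarefree_monomial K (vertices \<Delta>) F))
          = \<mu> F \<otimes>\<^bsub>K\<^esub> inv\<^bsub>K\<^esub> (minor_det K V F))"

text \<open>When \<open>V\<close> is a linear system of parameters and \<open>\<mu>\<close> a cycle, the minors in question are
  nonzero and these conditions determine exactly one map: the classes of the monomials of faces
  of cardinality \<open>d\<close> span the piece of degree \<open>d\<close>, and the cycle condition gives existence.\<close>

definition degree_map ::
  "('k, 'm) ring_scheme \<Rightarrow> 'v::linorder set set \<Rightarrow> nat \<Rightarrow> (nat \<Rightarrow> 'v \<Rightarrow> 'k) \<Rightarrow> ('v set \<Rightarrow> 'k)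
     \<Rightarrow> ('v multiset \<Rightarrow> 'k) set set \<Rightarrow> 'k" where
  "degree_map K \<Delta> d V \<mu> = (THE f. is_degree_map K \<Delta> d V \<mu> f)"

text \<open>The condition \<open>n + j = d\<close> renders a product with an element of degree \<open>d - n\<close>; for \<open>n > d\<close>
  there is no such degree and the whole piece (which is zero) is taken.\<close>

definition radical_piece ::
  "('k, 'm) ring_scheme \<Rightarrow> 'v::linorder set set \<Rightarrow> nat \<Rightarrow> (nat \<Rightarrow> 'v \<Rightarrow> 'k) \<Rightarrow> ('v set \<Rightarrow> 'k) \<Rightarrow> nat
     \<Rightarrow> ('v multiset \<Rightarrow> 'k) set set set" where
  "radical_piece K \<Delta> d V \<mu> n =
     {a \<in> art_piece K \<Delta> d V n. \<forall>j. n + j = d \<longrightarrow>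
        (\<forall>b\<in>art_piece K \<Delta> d V j.
           degree_map K \<Delta> d V \<mu> (a \<otimes>\<^bsub>art_ring K \<Delta> d V\<^esub> b) = \<zero>\<^bsub>K\<^esub>)}"

definition radical_ideal ::
  "('k, 'm) ring_scheme \<Rightarrow> 'v::linorder set set \<Rightarrow> nat \<Rightarrow> (nat \<Rightarrow> 'v \<Rightarrow> 'k) \<Rightarrow> ('v set \<Rightarrow> 'k)
     \<Rightarrow> ('v multiset \<Rightarrow> 'k) set set set" where
  "radical_ideal K \<Delta> d V \<mu> =
     {\<Oplus>\<^bsub>art_ring K \<Delta> d V\<^esub> n \<in> {..N}. a n | a N. \<forall>n. a n \<in> radical_piece K \<Delta> d V \<mu> n}"

definition gorenstein_ring ::
  "('k, 'm) ring_scheme \<Rightarrow> 'v::linorder set set \<Rightarrow> nat \<Rightarrow> (nat \<Rightarrow> 'v \<Rightarrow> 'k) \<Rightarrow> ('v set \<Rightarrow> 'k)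
     \<Rightarrow> ('v multiset \<Rightarrow> 'k) set set set ring" where
  "gorenstein_ring K \<Delta> d V \<mu> = art_ring K \<Delta> d V Quot radical_ideal K \<Delta> d V \<mu>"

definition gorenstein_piece ::
  "('k, 'm) ring_scheme \<Rightarrow> 'v::linorder set set \<Rightarrow> nat \<Rightarrow> (nat \<Rightarrow> 'v \<Rightarrow> 'k) \<Rightarrow> ('v set \<Rightarrow> 'k) \<Rightarrow> nat
     \<Rightarrow> ('v multiset \<Rightarrow> 'k) set set set set" where
  "gorenstein_piece K \<Delta> d V \<mu> n =
     (\<lambda>a. radical_ideal K \<Delta> d V \<mu> +>\<^bsub>art_ring K \<Delta> d V\<^esub> a) ` art_piece K \<Delta> d V n"

definition anisotropic ::
  "('k, 'm) ring_scheme \<Rightarrow> 'v::linorder set set \<Rightarrow> nat \<Rightarrow> (nat \<Rightarrow> 'v \<Rightarrow> 'k) \<Rightarrow> ('v set \<Rightarrow> 'k) \<Rightarrow> bool" where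
  "anisotropic K \<Delta> d V \<mu> \<longleftrightarrow>
     (\<forall>n. 2 * n \<le> d \<longrightarrow>
        (\<forall>u\<in>gorenstein_piece K \<Delta> d V \<mu> n.
           u \<noteq> \<zero>\<^bsub>gorenstein_ring K \<Delta> d V \<mu>\<^esub> \<longrightarrow>
           u [^]\<^bsub>gorenstein_ring K \<Delta> d V \<mu>\<^esub> (2::nat) \<noteq> \<zero>\<^bsub>gorenstein_ring K \<Delta> d V \<mu>\<^esub>))"


section \<open>Carriers for field extensions\<close>

text \<open>HOL cannot quantify existentially over types, so the carrier of an extension field has to be
  a subset of some type fixed in advance. Up to isomorphism over the base field, every finitely
  generated extension of a field \<open>'a\<close> has its carrier in this type, because the type is infinite
  and at least as large as \<open>'a\<close>. Only its cardinality matters: the operations of an extension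
  field need not be those of this type.\<close>

type_synonym 'a ext_carrier = "((nat \<Rightarrow>\<^sub>0 nat) \<Rightarrow>\<^sub>0 'a) fract"

end

theory Submission
  imports Defs
begin

text \<open>Let \<open>K\<close> be the field of rational functions over \<open>k\<close> in the entries of the matrix \<open>V\<close>, which
  are taken to be independent variables \<open>a\<^sub>i\<^sub>v\<close>. For a cycle \<open>\<mu>\<close> write \<open>deg\<^sub>\<mu>\<close> for its degree map and
  \<open>L\<^sub>\<mu>\<close> for the radical, so that \<open>B(\<mu>) = A(|\<mu>|) / L\<^sub>\<mu>\<close>. Let \<open>\<nu>\<close> be the cycle whose coefficients are
  the squares of those of \<open>\<mu>\<close>.

  The degree map has an explicit formula. A cycle is the boundary of the cone, with a vertex as apex,
  over its facets that avoid the apex, so \<open>deg\<^sub>\<mu>\<close> is a linear combination of degree maps of boundaries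
  of simplices. In the Artinian reduction of such a boundary all variables are multiples of one
  variable, and the factors are minors of \<open>V\<close> (\<open>simplex_degree\<close>, \<open>mdeg\<close>). In characteristic two the
  formula satisfies, for each monomial \<open>m\<close> of degree \<open>d\<close>,

    \<open>deg\<^sub>\<nu>(m) = \<Sum>I. a\<^sub>I (deg\<^sub>\<mu>(\<surd>(m x\<^sub>I)))\<^sup>2\<close>,

  where \<open>I\<close> runs through the choices of one vertex for each row with \<open>m x\<^sub>I\<close> a square, and \<open>a\<^sub>I\<close> is
  the product of the chosen entries of \<open>V\<close> (\<open>mdeg_square\<close>). This is an integrated form of the
  differential identity of Papadakis and Petrotou. For \<open>u\<close> of degree \<open>n\<close> and a monomial \<open>P\<close> of degree
  \<open>d - 2 n\<close>, additivity of squaring turns it into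

    \<open>deg\<^sub>\<nu>(u\<^sup>2 P) = \<Sum>I. a\<^sub>I (deg\<^sub>\<mu>(u \<surd>(P x\<^sub>I)))\<^sup>2\<close>.

  The products \<open>a\<^sub>I\<close> are linearly independent over the squares of \<open>K\<close>
  (\<open>generic_matrix_independent\<close>). Hence \<open>u\<^sup>2 = 0\<close> in \<open>B(\<nu>)\<close> forces all the degrees on the right to
  vanish. For a suitable \<open>P\<close>, any given monomial of degree \<open>d - n\<close> occurs there as a square root, so
  \<open>u\<close> lies in \<open>L\<^sub>\<mu>\<close>
  (\<open>square_zero_imp_orthogonal\<close>).

  If the coefficients of \<open>\<mu>\<close> lie in the field with two elements, then \<open>\<nu> = \<mu>\<close> and the proof is
  complete. In general there are two more ideas. First, \<open>k\<close> is embedded into \<open>K\<close> by the Frobenius map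
  \<open>c \<mapsto> c\<^sup>2\<close>. This is an extension of fields in which the given cycle becomes \<open>\<nu>\<close>, so it remains to
  show that \<open>L\<^sub>\<mu>\<close> is contained in \<open>L\<^sub>\<nu>\<close> in degrees \<open>n\<close> with \<open>2 n \<le> d\<close>. Second, these two spaces are
  equal (\<open>orthogonal_square\<close>). As \<open>L\<^sub>\<nu>\<close> is an ideal, an element \<open>u\<close> of it satisfies \<open>u\<^sup>2 = 0\<close> in
  \<open>B(\<nu>)\<close>, and so \<open>L\<^sub>\<nu>\<close> is contained in \<open>L\<^sub>\<mu>\<close>. Conversely, the endomorphism of \<open>K\<close> that squares the
  elements of \<open>k\<close> and fixes the variables maps \<open>L\<^sub>\<mu>\<close> into \<open>L\<^sub>\<nu>\<close>, hence into itself; a subspace with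
  this property is spanned by vectors that the endomorphism fixes, and these lie in \<open>L\<^sub>\<nu>\<close>.

  The remaining work identifies the iterated quotient rings with these computations on
  polynomials. Both the vanishing of large degrees and the uniqueness of the degree map come from
  one reduction of monomials to squarefree ones (\<open>spread_support\<close>), and the explicit formula shows
  that a degree map exists (\<open>cls_zero_imp_deg\<close>, \<open>degree_map_cls\<close>).\<close>

abbreviation "coef \<equiv> Poly_Mapping.lookup"
abbreviation "monomial \<equiv> Poly_Mapping.single"
abbreviation "monomials \<equiv> Poly_Mapping.keys"

section \<open>Determinants in characteristic two\<close>

lemma sum_involution_char_two:
  fixes f :: "'b \<Rightarrow> 'k::comm_ring_1"
  assumes two: "(1::'k) + 1 = 0"
    and "finite A"
    and inv: "\<And>x. x \<in> A \<Longrightarrow> h x \<in> A \<and> h (h x) = x \<and> h x \<noteq> x \<and> f (h x) = f x"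
  shows "sum f A = 0"
  using assms(2) inv
proof (induction A rule: finite_psubset_induct)
  case (psubset A)
  show ?case
  proof (cases "A = {}")
    case False
    then obtain x where x: "x \<in> A"
      by auto
    define B where "B = A - {x, h x}"
    have B: "B \<subset> A"
      using x by (auto simp: B_def)
    have hB: "h y \<in> B \<and> h (h y) = y \<and> h y \<noteq> y \<and> f (h y) = f y" if "y \<in> B" for y
    proof -
      have "y \<in> A" "y \<noteq> x" "y \<noteq> h x"
        using that by (auto simp: B_def)
      moreover from this have "h y \<noteq> x" "h y \<noteq> h x"
        using psubset.prems x by metis+
      ultimately show ?thesis
        using psubset.prems by (auto simp: B_def)
    qed
    have A: "A = insert x (insert (h x) B)" and "x \<noteq> h x" "x \<notin> B" "h x \<notin> B" "finite B"
      using x psubset.prems[OF x] psubset.hyps by (auto simp: B_def)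
    hence "sum f A = f x + (f (h x) + sum f B)"
      by (subst A) simp
    also have "sum f B = 0"
      using psubset.IH[OF B hB] by blast
    also have "f x + (f (h x) + 0) = (1 + 1) * f x"
      using psubset.prems[OF x] by (simp add: distrib_right)
    finally show ?thesis
      using two by simp
  qed auto
qed

lemma char_two_double:
  fixes x :: "'k::comm_ring_1"
  assumes "(1::'k) + 1 = 0"
  shows "x + x = 0"
proof -
  have "x + x = (1 + 1) * x"
    by (simp only: distrib_right mult_1_left)
  thus ?thesis
    by (simp only: assms mult_zero_left)
qed

lemma char_two_minus:
  fixes x :: "'k::comm_ring_1"
  assumes "(1::'k) + 1 = 0"
  shows "- x = x"
  by (rule minus_unique[OF char_two_double[OF assms]])

lemma square_sum_char_two:
  fixes f :: "'b \<Rightarrow> 'k::comm_ring_1"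
  assumes two: "(1::'k) + 1 = 0"
  shows "(\<Sum>a\<in>A. f a)\<^sup>2 = (\<Sum>a\<in>A. (f a)\<^sup>2)"
proof (induction A rule: infinite_finite_induct)
  case (insert a A)
  have "(f a + sum f A)\<^sup>2 = (f a)\<^sup>2 + (sum f A)\<^sup>2 + (f a * sum f A + f a * sum f A)"
    by (simp only: power2_eq_square distrib_left distrib_right ac_simps)
  thus ?case
    using insert by (simp add: char_two_double[OF two])
qed auto

definition bijections :: "nat \<Rightarrow> 'v set \<Rightarrow> (nat \<Rightarrow> 'v) set" where
  "bijections n F = {I \<in> {..<n} \<rightarrow>\<^sub>E F. bij_betw I {..<n} F}"

text \<open>In characteristic two the permanent is the determinant. It is preferred because it does not
  depend on an order of the columns.\<close>

definition permanent :: "(nat \<Rightarrow> 'v \<Rightarrow> 'k::comm_ring_1) \<Rightarrow> nat \<Rightarrow> 'v set \<Rightarrow> 'k" where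
  "permanent V n F = (\<Sum>I\<in>bijections n F. \<Prod>i<n. V i (I i))"

lemma finite_bijections [simp]: "finite (bijections n F)"
proof (cases "finite F")
  case True
  thus ?thesis
    unfolding bijections_def by (intro finite_subset[OF _ finite_PiE[of "{..<n}" "\<lambda>_. F"]]) auto
next
  case False
  hence "bijections n F = {}"
    by (auto simp: bijections_def dest: bij_betw_finite)
  thus ?thesis
    by simp
qed

lemma bijections_card: "I \<in> bijections n F \<Longrightarrow> card F = n"
  using bij_betw_same_card[of I "{..<n}" F] by (simp add: bijections_def)

lemma bijections_mem: "I \<in> bijections n F \<Longrightarrow> i < n \<Longrightarrow> I i \<in> F"
  by (auto simp: bijections_def)

lemma bijections_inj: "I \<in> bijections n F \<Longrightarrow> i < n \<Longrightarrow> j < n \<Longrightarrow> I i = I j \<Longrightarrow> i = j"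
  by (rule inj_onD[of I "{..<n}"]) (simp_all add: bijections_def bij_betw_def)

lemma bijections_surj: "I \<in> bijections n F \<Longrightarrow> v \<in> F \<Longrightarrow> \<exists>i<n. I i = v"
proof -
  assume "I \<in> bijections n F" and v: "v \<in> F"
  hence "F = I ` {..<n}"
    by (simp add: bijections_def bij_betw_def)
  thus ?thesis
    using v by blast
qed

lemma bijectionsI:
  assumes "I \<in> extensional {..<n}" "\<And>i. i < n \<Longrightarrow> I i \<in> F"
    "\<And>i j. i < n \<Longrightarrow> j < n \<Longrightarrow> I i = I j \<Longrightarrow> i = j" "\<And>v. v \<in> F \<Longrightarrow> \<exists>i<n. I i = v"
  shows "I \<in> bijections n F"
proof -
  have "I ` {..<n} = F"
    using assms(2,4) by blast
  moreover have "inj_on I {..<n}"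
    using assms(3) by (auto intro: inj_onI)
  ultimately show ?thesis
    using assms(1,2) by (auto simp: bijections_def bij_betw_def PiE_def)
qed

lemma bijections_update:
  assumes I: "I \<in> bijections n (G - {v})" and v: "v \<in> G" and i: "i < n"
  shows "I(i := v) \<in> bijections n (G - {I i})"
proof (rule bijectionsI)
  show "I(i := v) \<in> extensional {..<n}"
    using I i by (auto simp: bijections_def PiE_def extensional_def)
  show "(I(i := v)) j \<in> G - {I i}" if j: "j < n" for j
  proof (cases "j = i")
    case True
    thus ?thesis
      using v bijections_mem[OF I i] by auto
  next
    case False
    thus ?thesis
      using bijections_mem[OF I j] bijections_inj[OF I i j] by auto
  qed
  have avoid: "I j \<noteq> v" if "j < n" for j
    using bijections_mem[OF I that] by auto
  show "j = k" if j: "j < n" and k: "k < n" and eq: "(I(i := v)) j = (I(i := v)) k" for j k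
    using eq avoid[OF j] avoid[OF k] bijections_inj[OF I j k] by (auto split: if_splits)
  show "\<exists>j<n. (I(i := v)) j = w" if "w \<in> G - {I i}" for w
  proof (cases "w = v")
    case False
    thus ?thesis
      using bijections_surj[OF I, of w] that by (metis DiffE DiffI fun_upd_apply singleton_iff)
  qed (use i in auto)
qed

text \<open>Cramer's rule: the expansion of the determinant whose top row repeats row \<open>i\<close>. Exchanging
  the entries chosen in the two equal rows pairs off equal terms.\<close>

lemma permanent_repeated_row:
  fixes V :: "nat \<Rightarrow> 'v \<Rightarrow> 'k::comm_ring_1"
  assumes two: "(1::'k) + 1 = 0" and G: "finite G" and i: "i < n"
  shows "(\<Sum>v\<in>G. V i v * permanent V n (G - {v})) = 0"
proof -
  define f where "f = (\<lambda>(v, I). V i v * (\<Prod>j<n. V j (I j)))"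
  define A where "A = (SIGMA v:G. bijections n (G - {v}))"
  have "(\<Sum>v\<in>G. V i v * permanent V n (G - {v})) = sum f A"
    unfolding A_def f_def permanent_def using G by (simp add: sum_distrib_left sum.Sigma)
  also have "\<dots> = 0"
  proof (rule sum_involution_char_two[OF two, where h = "\<lambda>(v, I). (I i, I(i := v))"])
    show "finite A"
      using G by (simp add: A_def)
    fix x assume "x \<in> A"
    then obtain v I where x: "x = (v, I)" "v \<in> G" "I \<in> bijections n (G - {v})"
      by (auto simp: A_def)
    have mem: "I i \<in> G" "I i \<noteq> v"
      using bijections_mem[OF x(3) i] by auto
    have "f (I i, I(i := v)) = f x"
    proof -
      have "(\<Prod>j<n. V j ((I(i := v)) j)) = V i v * (\<Prod>j\<in>{..<n} - {i}. V j (I j))"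
        using i by (subst prod.remove[of _ i]) (auto intro!: prod.cong)
      moreover have "(\<Prod>j<n. V j (I j)) = V i (I i) * (\<Prod>j\<in>{..<n} - {i}. V j (I j))"
        using i by (subst prod.remove[of _ i]) auto
      ultimately show ?thesis
        by (simp add: f_def x mult_ac)
    qed
    thus "(case x of (v, I) \<Rightarrow> (I i, I(i := v))) \<in> A \<and>
          (case case x of (v, I) \<Rightarrow> (I i, I(i := v)) of (v, I) \<Rightarrow> (I i, I(i := v))) = x \<and>
          (case x of (v, I) \<Rightarrow> (I i, I(i := v))) \<noteq> x \<and>
          f (case x of (v, I) \<Rightarrow> (I i, I(i := v))) = f x"
      using mem bijections_update[OF x(3,2) i] by (simp add: x A_def)
  qed
  finally show ?thesis .
qed

text \<open>The columns in \<open>F\<close> are a basis as soon as their determinant does not vanish. The coefficients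
  of the dual basis vector are cofactors.\<close>

lemma dual_vector_exists:
  fixes V :: "nat \<Rightarrow> 'v \<Rightarrow> 'k::field"
  assumes two: "(1::'k) + 1 = 0" and v: "v \<in> F" and nz: "permanent V n F \<noteq> 0"
  obtains c where "\<And>w. w \<in> F \<Longrightarrow> (\<Sum>i<n. c i * V i w) = (if w = v then 1 else 0)"
proof -
  define c where "c i = (\<Sum>I\<in>{I \<in> bijections n F. I i = v}. \<Prod>j\<in>{..<n} - {i}. V j (I j))" for i
  have expand: "(\<Sum>i<n. c i * V i w) = (\<Sum>I\<in>bijections n F. \<Prod>j<n. V j (if I j = v then w else I j))"
    for w
  proof -
    have "(\<Sum>i<n. c i * V i w) = (\<Sum>i<n. \<Sum>I\<in>bijections n F.
        if I i = v then (\<Prod>j\<in>{..<n} - {i}. V j (I j)) * V i w else 0)"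
      unfolding c_def sum_distrib_right
      by (intro sum.cong refl sum.inter_filter) auto
    also have "\<dots> = (\<Sum>I\<in>bijections n F. \<Sum>i<n.
        if I i = v then (\<Prod>j\<in>{..<n} - {i}. V j (I j)) * V i w else 0)"
      by (rule sum.swap)
    also have "\<dots> = (\<Sum>I\<in>bijections n F. \<Prod>j<n. V j (if I j = v then w else I j))"
    proof (rule sum.cong[OF refl])
      fix I assume I: "I \<in> bijections n F"
      obtain i where i: "i < n" "I i = v"
        using bijections_surj[OF I v] by auto
      have uniq: "I j = v \<longleftrightarrow> j = i" if "j < n" for j
        using bijections_inj[OF I] i that by metis
      have "(\<Sum>j<n. if I j = v then (\<Prod>k\<in>{..<n} - {j}. V k (I k)) * V j w else 0)
          = (\<Sum>j<n. if j = i then (\<Prod>k\<in>{..<n} - {j}. V k (I k)) * V j w else 0)"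
        using uniq by (intro sum.cong) auto
      also have "\<dots> = V i w * (\<Prod>k\<in>{..<n} - {i}. V k (I k))"
        using i by (simp add: mult.commute)
      also have "(\<Prod>k\<in>{..<n} - {i}. V k (I k))
          = (\<Prod>k\<in>{..<n} - {i}. V k (if I k = v then w else I k))"
        using uniq by (intro prod.cong) auto
      also have "V i w * \<dots> = (\<Prod>j<n. V j (if I j = v then w else I j))"
        using i by (subst prod.remove[of "{..<n}" i]) auto
      finally show "(\<Sum>j<n. if I j = v then (\<Prod>k\<in>{..<n} - {j}. V k (I k)) * V j w else 0)
          = (\<Prod>j<n. V j (if I j = v then w else I j))" .
    qed
    finally show ?thesis .
  qed
  have one: "(\<Sum>i<n. c i * V i v) = permanent V n F"
    unfolding expand permanent_def by (intro sum.cong prod.cong) auto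
  have zero: "(\<Sum>i<n. c i * V i w) = 0" if w: "w \<in> F" "w \<noteq> v" for w
    unfolding expand
  proof (rule sum_involution_char_two[OF two,
        where h = "\<lambda>I. restrict (Transposition.transpose v w \<circ> I) {..<n}"])
    fix I assume I: "I \<in> bijections n F"
    let ?J = "restrict (Transposition.transpose v w \<circ> I) {..<n}"
    obtain i where i: "i < n" "I i = v"
      using bijections_surj[OF I v] by auto
    have "?J \<in> bijections n F"
    proof (rule bijectionsI)
      show "?J k \<in> F" if "k < n" for k
        using bijections_mem[OF I that] that v w by (auto simp: Transposition.transpose_def)
      show "j = k" if "j < n" "k < n" "?J j = ?J k" for j k
        using that bijections_inj[OF I that(1,2)] by (auto dest!: injD[OF inj_transpose])
      show "\<exists>j<n. ?J j = u" if "u \<in> F" for u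
      proof -
        have "Transposition.transpose v w u \<in> F"
          using that v w by (auto simp: Transposition.transpose_def)
        from bijections_surj[OF I this] obtain j where "j < n" "I j = Transposition.transpose v w u"
          by auto
        thus ?thesis
          by (intro exI[of _ j]) auto
      qed
    qed auto
    moreover have "restrict (Transposition.transpose v w \<circ> ?J) {..<n} = I"
      using I by (auto simp: bijections_def PiE_def extensional_def fun_eq_iff)
    moreover have "?J \<noteq> I"
      using i w by (auto simp: fun_eq_iff restrict_def intro!: exI[of _ i])
    moreover have "(\<Prod>j<n. V j (if ?J j = v then w else ?J j))
        = (\<Prod>j<n. V j (if I j = v then w else I j))"
      by (intro prod.cong) (auto simp: Transposition.transpose_def)
    ultimately show "?J \<in> bijections n F \<and> restrict (Transposition.transpose v w \<circ> ?J) {..<n} = I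
        \<and> ?J \<noteq> I \<and> (\<Prod>j<n. V j (if ?J j = v then w else ?J j))
        = (\<Prod>j<n. V j (if I j = v then w else I j))"
      by blast
  qed auto
  show thesis
  proof (rule that[of "\<lambda>i. c i / permanent V n F"])
    fix w assume "w \<in> F"
    have "(\<Sum>i<n. c i / permanent V n F * V i w) = (\<Sum>i<n. c i * V i w) / permanent V n F"
      by (simp add: sum_divide_distrib)
    also have "\<dots> = (if w = v then 1 else 0)"
      using one zero[OF \<open>w \<in> F\<close>] nz by auto
    finally show "(\<Sum>i<n. c i / permanent V n F * V i w) = (if w = v then 1 else 0)" .
  qed
qed

definition odd_values :: "nat \<Rightarrow> (nat \<Rightarrow> 'v) \<Rightarrow> 'v set" where
  "odd_values n I = {v. odd (card {i. i < n \<and> I i = v})}"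

definition parity_sum ::
  "(nat \<Rightarrow> 'v \<Rightarrow> 'k::comm_ring_1) \<Rightarrow> 'v set \<Rightarrow> nat \<Rightarrow> 'v set \<Rightarrow> 'k" where
  "parity_sum b G n S = (\<Sum>I\<in>{I \<in> {..<n} \<rightarrow>\<^sub>E G. odd_values n I = S}. \<Prod>i<n. b i (I i))"

lemma odd_values_0: "odd_values 0 I = {}"
  by (simp add: odd_values_def)

lemma odd_values_Suc: "odd_values (Suc n) (I(n := v)) = sym_diff (odd_values n I) {v}"
proof -
  have "{i. i < Suc n \<and> (I(n := v)) i = w} = (if w = v then insert n {i. i < n \<and> I i = w} else {i. i < n \<and> I i = w})"
    for w by (auto simp: less_Suc_eq)
  hence "card {i. i < Suc n \<and> (I(n := v)) i = w} = (if w = v then 1 else 0) + card {i. i < n \<and> I i = w}"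
    for w by simp
  hence "w \<in> odd_values (Suc n) (I(n := v)) \<longleftrightarrow> w \<in> sym_diff (odd_values n I) {v}" for w
    unfolding odd_values_def mem_Collect_eq by (cases "w = v") simp_all
  thus ?thesis
    by blast
qed

lemma parity_sum_Suc:
  assumes "finite G"
  shows "parity_sum b G (Suc n) S = (\<Sum>v\<in>G. b n v * parity_sum b G n (sym_diff S {v}))"
proof -
  have "(\<Sum>v\<in>G. b n v * parity_sum b G n (sym_diff S {v}))
      = (\<Sum>(v, I)\<in>(SIGMA v:G. {I \<in> {..<n} \<rightarrow>\<^sub>E G. odd_values n I = sym_diff S {v}}).
          b n v * (\<Prod>i<n. b i (I i)))"
    unfolding parity_sum_def using assms by (simp add: sum_distrib_left sum.Sigma finite_PiE)
  also have "\<dots> = parity_sum b G (Suc n) S"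
    unfolding parity_sum_def
  proof (rule sum.reindex_bij_witness[where i = "\<lambda>I. (I n, restrict I {..<n})" and j = "\<lambda>(v, I). I(n := v)"])
    fix a assume a: "a \<in> (SIGMA v:G. {I \<in> {..<n} \<rightarrow>\<^sub>E G. odd_values n I = sym_diff S {v}})"
    then obtain v I where vI: "a = (v, I)" "v \<in> G" "I \<in> {..<n} \<rightarrow>\<^sub>E G" "odd_values n I = sym_diff S {v}"
      by auto
    show "(((\<lambda>(v, I). I(n := v)) a) n, restrict ((\<lambda>(v, I). I(n := v)) a) {..<n}) = a"
      using vI by (auto simp: fun_eq_iff PiE_def extensional_def)
    show "(\<lambda>(v, I). I(n := v)) a \<in> {I \<in> {..<Suc n} \<rightarrow>\<^sub>E G. odd_values (Suc n) I = S}"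
      using vI by (auto simp: odd_values_Suc PiE_def extensional_def less_Suc_eq)
    show "(\<Prod>i<Suc n. b i ((\<lambda>(v, I). I(n := v)) a i)) = (case a of (v, I) \<Rightarrow> b n v * (\<Prod>i<n. b i (I i)))"
      using vI by (simp add: mult.commute)
  next
    fix I assume I: "I \<in> {I \<in> {..<Suc n} \<rightarrow>\<^sub>E G. odd_values (Suc n) I = S}"
    hence eq: "(restrict I {..<n})(n := I n) = I"
      by (auto simp: fun_eq_iff PiE_def extensional_def less_Suc_eq)
    thus "(\<lambda>(v, I). I(n := v)) (I n, restrict I {..<n}) = I"
      by simp
    have "sym_diff (odd_values n (restrict I {..<n})) {I n} = S"
      using I odd_values_Suc[of n "restrict I {..<n}" "I n"] unfolding eq by simp
    moreover have "I n \<in> G" "restrict I {..<n} \<in> {..<n} \<rightarrow>\<^sub>E G"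
      using I by (auto simp: PiE_def)
    ultimately show "(I n, restrict I {..<n}) \<in> (SIGMA v:G. {I \<in> {..<n} \<rightarrow>\<^sub>E G. odd_values n I = sym_diff S {v}})"
      by auto
  qed
  finally show ?thesis ..
qed

lemma permanent_Suc:
  assumes "finite T"
  shows "permanent b (Suc n) T = (\<Sum>v\<in>T. b n v * permanent b n (T - {v}))"
proof -
  have "(\<Sum>v\<in>T. b n v * permanent b n (T - {v}))
      = (\<Sum>(v, I)\<in>(SIGMA v:T. bijections n (T - {v})). b n v * (\<Prod>i<n. b i (I i)))"
    unfolding permanent_def using assms by (simp add: sum_distrib_left sum.Sigma)
  also have "\<dots> = permanent b (Suc n) T"
    unfolding permanent_def
  proof (rule sum.reindex_bij_witness[where i = "\<lambda>I. (I n, restrict I {..<n})" and j = "\<lambda>(v, I). I(n := v)"])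
    fix a assume a: "a \<in> (SIGMA v:T. bijections n (T - {v}))"
    then obtain v I where vI: "a = (v, I)" "v \<in> T" "I \<in> bijections n (T - {v})"
      by auto
    have ext: "I \<in> extensional {..<n}"
      using vI(3) by (simp add: bijections_def PiE_def)
    show "(((\<lambda>(v, I). I(n := v)) a) n, restrict ((\<lambda>(v, I). I(n := v)) a) {..<n}) = a"
      using vI ext by (auto simp: fun_eq_iff extensional_def)
    have avoid: "I i \<noteq> v" "I i \<in> T" if "i < n" for i
      using bijections_mem[OF vI(3) that] by auto
    have "I(n := v) \<in> bijections (Suc n) T"
    proof (rule bijectionsI)
      show "I(n := v) \<in> extensional {..<Suc n}"
        using ext by (auto simp: extensional_def)
      show "(I(n := v)) i \<in> T" if "i < Suc n" for i
        using that avoid vI(2) by (auto simp: less_Suc_eq)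
      show "i = j" if "i < Suc n" "j < Suc n" "(I(n := v)) i = (I(n := v)) j" for i j
        using that avoid[of i] avoid[of j] bijections_inj[OF vI(3), of i j]
        by (auto simp: less_Suc_eq split: if_splits)
      show "\<exists>i<Suc n. (I(n := v)) i = w" if "w \<in> T" for w
      proof (cases "w = v")
        case False
        hence "w \<in> T - {v}"
          using that by simp
        from bijections_surj[OF vI(3) this] obtain i where "i < n" "I i = w"
          by blast
        thus ?thesis
          by (intro exI[of _ i]) auto
      qed auto
    qed
    thus "(\<lambda>(v, I). I(n := v)) a \<in> bijections (Suc n) T"
      using vI by simp
    show "(\<Prod>i<Suc n. b i ((\<lambda>(v, I). I(n := v)) a i)) = (case a of (v, I) \<Rightarrow> b n v * (\<Prod>i<n. b i (I i)))"
      using vI by (simp add: mult.commute)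
  next
    fix I assume I: "I \<in> bijections (Suc n) T"
    hence "(restrict I {..<n})(n := I n) = I"
      by (auto simp: fun_eq_iff bijections_def PiE_def extensional_def less_Suc_eq)
    thus "(\<lambda>(v, I). I(n := v)) (I n, restrict I {..<n}) = I"
      by simp
    have "restrict I {..<n} \<in> bijections n (T - {I n})"
    proof (rule bijectionsI)
      show "restrict I {..<n} i \<in> T - {I n}" if "i < n" for i
        using that bijections_mem[OF I, of i] bijections_inj[OF I, of i n] by auto
      show "i = j" if "i < n" "j < n" "restrict I {..<n} i = restrict I {..<n} j" for i j
        using that bijections_inj[OF I, of i j] by auto
      show "\<exists>i<n. restrict I {..<n} i = w" if "w \<in> T - {I n}" for w
      proof -
        from that have "w \<in> T" "w \<noteq> I n"
          by auto
        from bijections_surj[OF I this(1)] obtain i where "i < Suc n" "I i = w"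
          by auto
        moreover from this have "i < n"
          using \<open>w \<noteq> I n\<close> by (metis less_SucE)
        ultimately show ?thesis
          by auto
      qed
    qed auto
    moreover have "I n \<in> T"
      using bijections_mem[OF I] by simp
    ultimately show "(I n, restrict I {..<n}) \<in> (SIGMA v:T. bijections n (T - {v}))"
      by auto
  qed
  finally show ?thesis ..
qed

text \<open>In the group algebra of the group of subsets of \<open>G\<close>, let \<open>[S]\<close> be the basis element of \<open>S\<close>,
  and \<open>[v]\<close> that of \<open>{v}\<close>. For the elements \<open>y\<^sub>v = 1 + [v]\<close>, which square to zero, the product of the sums
  \<open>\<Sum>v. b i v [v] = \<Sum>v. b i v y\<^sub>v\<close> over all rows is the sum of the permanents times squarefree
  monomials in the \<open>y\<^sub>v\<close>. The lemma compares the coefficients of \<open>[S]\<close>.\<close>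

lemma parity_sum_eq_permanents:
  fixes b :: "nat \<Rightarrow> 'v \<Rightarrow> 'k::comm_ring_1"
  assumes two: "(1::'k) + 1 = 0" and G: "finite G"
    and "\<And>i. i < n \<Longrightarrow> (\<Sum>v\<in>G. b i v) = 0" and "S \<subseteq> G"
  shows "parity_sum b G n S = (\<Sum>T\<in>{T. S \<subseteq> T \<and> T \<subseteq> G}. permanent b n T)"
  using assms(3,4)
proof (induction n arbitrary: S)
  case 0
  have "{T. S \<subseteq> T \<and> T \<subseteq> G} \<inter> {T. T = {}} = (if S = {} then {{}} else {})"
    using 0 by auto
  moreover have "bijections 0 T = (if T = {} then {\<lambda>_. undefined} else {})" for T :: "'v set"
    by (auto simp: bijections_def bij_betw_def)
  hence "permanent b 0 T = (if T = {} then 1 else 0)" for T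
    by (simp add: permanent_def)
  moreover have "parity_sum b G 0 S = (if S = {} then 1 else 0)"
    by (auto simp: parity_sum_def odd_values_0)
  ultimately show ?case
    using G by (auto simp: sum.If_cases)
next
  case (Suc n)
  have row: "(\<Sum>v\<in>G. b n v) = 0"
    using Suc.prems by simp
  have "parity_sum b G (Suc n) S
      = (\<Sum>v\<in>G. b n v * (\<Sum>T\<in>{T. sym_diff S {v} \<subseteq> T \<and> T \<subseteq> G}. permanent b n T))"
    unfolding parity_sum_Suc[OF G] using Suc.prems
    by (intro sum.cong refl arg_cong2[of _ _ _ _ "(*)"] Suc.IH) auto
  also have "\<dots> = (\<Sum>v\<in>G. \<Sum>T\<in>Pow G. if sym_diff S {v} \<subseteq> T then permanent b n T * b n v else 0)"
    unfolding sum_distrib_left using G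
    by (intro sum.cong[OF refl]) (simp add: sum.inter_filter[symmetric] mult.commute Pow_def conj_commute)
  also have "\<dots> = (\<Sum>T\<in>Pow G. \<Sum>v\<in>G. if sym_diff S {v} \<subseteq> T then permanent b n T * b n v else 0)"
    by (rule sum.swap)
  also have "\<dots> = (\<Sum>T\<in>Pow G. permanent b n T * (\<Sum>v\<in>{v \<in> G. sym_diff S {v} \<subseteq> T}. b n v))"
    unfolding sum_distrib_left using G by (intro sum.cong[OF refl] sum.inter_filter[symmetric])
  also have "\<dots> = (\<Sum>T\<in>Pow G. permanent b n T * (\<Sum>v\<in>{v \<in> G - T. S \<subseteq> insert v T}. b n v))"
  proof (rule sum.cong[OF refl])
    fix T assume T: "T \<in> Pow G"
    have "(\<Sum>v\<in>{v \<in> G. sym_diff S {v} \<subseteq> T}. b n v) = (\<Sum>v\<in>{v \<in> G - T. S \<subseteq> insert v T}. b n v)"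
    proof (cases "S \<subseteq> T")
      case True
      hence "{v \<in> G. sym_diff S {v} \<subseteq> T} = T" "{v \<in> G - T. S \<subseteq> insert v T} = G - T"
        using T by auto
      moreover have "sum (b n) T + sum (b n) (G - T) = 0"
        using row T G by (metis PowD sum.subset_diff add.commute)
      ultimately show ?thesis
        using char_two_minus[OF two, of "sum (b n) (G - T)"] by (simp add: add_eq_0_iff)
    next
      case False
      hence "{v \<in> G. sym_diff S {v} \<subseteq> T} = {v \<in> G - T. S \<subseteq> insert v T}"
        using Suc.prems by auto
      thus ?thesis
        by simp
    qed
    thus "permanent b n T * (\<Sum>v\<in>{v \<in> G. sym_diff S {v} \<subseteq> T}. b n v)
        = permanent b n T * (\<Sum>v\<in>{v \<in> G - T. S \<subseteq> insert v T}. b n v)"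
      by simp
  qed
  also have "\<dots> = (\<Sum>T\<in>Pow G. \<Sum>v\<in>{v \<in> G - T. S \<subseteq> insert v T}. b n v * permanent b n T)"
    by (simp add: sum_distrib_left mult.commute)
  also have "\<dots> = (\<Sum>(T, v)\<in>(SIGMA T:Pow G. {v \<in> G - T. S \<subseteq> insert v T}). b n v * permanent b n T)"
    using G by (simp add: sum.Sigma)
  also have "\<dots> = (\<Sum>(T, v)\<in>(SIGMA T:{T. S \<subseteq> T \<and> T \<subseteq> G}. T). b n v * permanent b n (T - {v}))"
    by (rule sum.reindex_bij_witness[where j = "\<lambda>(T, v). (insert v T, v)" and i = "\<lambda>(T, v). (T - {v}, v)"])
      auto
  also have "\<dots> = (\<Sum>T\<in>{T. S \<subseteq> T \<and> T \<subseteq> G}. permanent b (Suc n) T)"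
    using G by (subst sum.Sigma[symmetric]) (auto intro!: sum.cong finite_subset[of _ "Pow G"]
        dest: finite_subset simp: permanent_Suc)
  finally show ?case .
qed

text \<open>The entries of each column are multiplied by the maximal minor that omits this column. By Cramer's
  rule the rows of the new matrix sum to zero, and all its maximal minors are equal to the product of
  the factors. An odd number of them contributes to the sum.\<close>

lemma parity_sum_eq_prod:
  fixes V :: "nat \<Rightarrow> 'v \<Rightarrow> 'k::comm_ring_1"
  assumes two: "(1::'k) + 1 = 0" and G: "finite G" "card G = Suc n"
    and S: "S \<subseteq> G" "odd (card (G - S))"
  defines "r \<equiv> \<lambda>v. permanent V n (G - {v})"
  shows "parity_sum (\<lambda>i v. V i v * r v) G n S = (\<Prod>v\<in>G. r v)"
proof -
  let ?b = "\<lambda>i v. V i v * r v"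
  have perm: "permanent ?b n (G - {w}) = (\<Prod>v\<in>G. r v)" if w: "w \<in> G" for w
  proof -
    have "permanent ?b n (G - {w}) = (\<Sum>I\<in>bijections n (G - {w}). (\<Prod>i<n. V i (I i)) * (\<Prod>v\<in>G - {w}. r v))"
      unfolding permanent_def
    proof (rule sum.cong[OF refl])
      fix I assume "I \<in> bijections n (G - {w})"
      hence "(\<Prod>i<n. r (I i)) = (\<Prod>v\<in>G - {w}. r v)"
        by (intro prod.reindex_bij_betw) (simp add: bijections_def)
      thus "(\<Prod>i<n. V i (I i) * r (I i)) = (\<Prod>i<n. V i (I i)) * (\<Prod>v\<in>G - {w}. r v)"
        by (simp add: prod.distrib)
    qed
    also have "\<dots> = r w * (\<Prod>v\<in>G - {w}. r v)"
      unfolding r_def permanent_def by (simp add: sum_distrib_right)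
    also have "\<dots> = (\<Prod>v\<in>G. r v)"
      using G w by (simp add: prod.remove)
    finally show ?thesis .
  qed
  have "parity_sum ?b G n S = (\<Sum>T\<in>{T. S \<subseteq> T \<and> T \<subseteq> G}. permanent ?b n T)"
  proof (rule parity_sum_eq_permanents[OF two G(1) _ S(1)])
    fix i assume "i < n"
    thus "(\<Sum>v\<in>G. V i v * r v) = 0"
      unfolding r_def by (rule permanent_repeated_row[OF two G(1)])
  qed
  also have "\<dots> = (\<Sum>T\<in>(\<lambda>w. G - {w}) ` (G - S). permanent ?b n T)"
  proof (rule sum.mono_neutral_right)
    show "finite {T. S \<subseteq> T \<and> T \<subseteq> G}"
      using G by simp
    show "\<forall>T\<in>{T. S \<subseteq> T \<and> T \<subseteq> G} - (\<lambda>w. G - {w}) ` (G - S). permanent ?b n T = 0"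
    proof
      fix T assume T: "T \<in> {T. S \<subseteq> T \<and> T \<subseteq> G} - (\<lambda>w. G - {w}) ` (G - S)"
      have "card T \<noteq> n"
      proof
        assume n: "card T = n"
        have "card (G - T) = 1"
          using T G n by (subst card_Diff_subset) (auto dest: finite_subset)
        then obtain w where w: "G - T = {w}"
          by (auto simp: card_1_singleton_iff)
        hence "T = G - {w}" "w \<in> G - S"
          using T by auto
        thus False
          using T by auto
      qed
      hence "bijections n T = {}"
        using bijections_card by blast
      thus "permanent ?b n T = 0"
        by (simp add: permanent_def)
    qed
  qed (use S in auto)
  also have "\<dots> = (\<Sum>w\<in>G - S. permanent ?b n (G - {w}))"
    by (subst sum.reindex) (auto simp: inj_on_def)
  also have "\<dots> = (\<Sum>w\<in>G - S. \<Prod>v\<in>G. r v)"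
    using perm by (intro sum.cong) auto
  also have "\<dots> = of_nat (card (G - S)) * (\<Prod>v\<in>G. r v)"
    by simp
  also have "of_nat (card (G - S)) = (1::'k)"
  proof -
    obtain m where m: "card (G - S) = 2 * m + 1"
      using S(2) by (rule oddE)
    have "of_nat (card (G - S)) = (of_nat m + of_nat m) + (1::'k)"
      by (simp only: m of_nat_add of_nat_1 mult_2)
    thus ?thesis
      by (simp only: char_two_double[OF two] add_0_left)
  qed
  finally show ?thesis
    by simp
qed

section \<open>The degree of a monomial\<close>

text \<open>The square root of a monomial, meaningful if all exponents are even.\<close>

definition half :: "'v multiset \<Rightarrow> 'v multiset" where
  "half M = (THE h. M = h + h)"

definition even_mset :: "'v multiset \<Rightarrow> bool" where
  "even_mset M \<longleftrightarrow> (\<exists>h. M = h + h)"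

lemma double_inj: "(h::'v multiset) + h = g + g \<Longrightarrow> h = g"
proof (rule multiset_eqI)
  fix v assume "h + h = g + g"
  hence "count (h + h) v = count (g + g) v"
    by simp
  thus "count h v = count g v"
    by simp
qed

lemma half_double [simp]: "half (h + h) = h"
  unfolding half_def by (rule the_equality) (auto dest: double_inj)

lemma half_add: "even_mset M \<Longrightarrow> half M + half M = M"
  by (auto simp: even_mset_def)

lemma even_mset_iff: "even_mset M \<longleftrightarrow> (\<forall>v. even (count M v))"
proof
  assume *: "\<forall>v. even (count M v)"
  define h where "h = Abs_multiset (\<lambda>v. count M v div 2)"
  have "{v. 0 < count M v div 2} \<subseteq> set_mset M"
    by (auto simp: count_greater_zero_iff[symmetric] simp del: count_greater_zero_iff)
  hence "finite {v. 0 < count M v div 2}"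
    by (rule finite_subset) simp
  hence "count h v = count M v div 2" for v
    by (simp add: h_def)
  hence "M = h + h"
    using * by (intro multiset_eqI) (simp, metis dvd_mult_div_cancel mult_2)
  thus "even_mset M"
    by (auto simp: even_mset_def)
qed (auto simp: even_mset_def)

lemma even_mset_double_add: "even_mset (n + n + M) \<longleftrightarrow> even_mset M"
  by (auto simp: even_mset_iff)

lemma half_double_add:
  assumes "even_mset M"
  shows "half (n + n + M) = n + half M"
proof -
  have "n + n + M = (n + half M) + (n + half M)"
    using half_add[OF assms] by (metis add.assoc add.commute)
  thus ?thesis
    by (metis half_double)
qed

text \<open>The monomial of the vertices that \<open>I\<close> chooses in the rows.\<close>

definition word :: "nat \<Rightarrow> (nat \<Rightarrow> 'v) \<Rightarrow> 'v multiset" where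
  "word n I = image_mset I (mset_set {..<n})"

lemma size_word [simp]: "size (word n I) = n"
  by (simp add: word_def)

lemma count_word: "count (word n I) v = card {i. i < n \<and> I i = v}"
proof -
  have "count (word n I) v = card (I -` {v} \<inter> {..<n})"
    by (simp add: word_def count_image_mset)
  also have "I -` {v} \<inter> {..<n} = {i. i < n \<and> I i = v}"
    by auto
  finally show ?thesis .
qed

lemma even_mset_word_iff:
  "even_mset (M + word n I) \<longleftrightarrow> odd_values n I = {v. odd (count M v)}"
  unfolding even_mset_iff odd_values_def by (auto simp: count_word set_eq_iff)

lemma word_exists:
  assumes "size M = n"
  obtains I where "word n I = M" "I \<in> {..<n} \<rightarrow>\<^sub>E set_mset M"
proof -
  obtain xs where xs: "mset xs = M"
    using ex_mset by blast
  hence len: "length xs = n"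
    using assms by auto
  define I where "I = restrict (\<lambda>i. xs ! i) {..<n}"
  have "word n I = image_mset (\<lambda>i. xs ! i) (mset_set {..<n})"
    unfolding word_def I_def by (intro image_mset_cong) auto
  also have "\<dots> = mset (map (\<lambda>i. xs ! i) [0..<length xs])"
    unfolding len mset_map by (simp add: lessThan_atLeast0)
  finally have "word n I = M"
    by (simp add: map_nth xs)
  moreover have "I \<in> {..<n} \<rightarrow>\<^sub>E set_mset M"
    unfolding I_def using xs len by auto
  ultimately show thesis
    using that by blast
qed

text \<open>Columns in general position. The apex is a vertex if there is one; for \<open>d = 0\<close> the set \<open>S\<close> may be
  empty and the apex is arbitrary.\<close>

locale column_configuration =
  fixes V :: "nat \<Rightarrow> 'v \<Rightarrow> 'k::field" and d :: nat and S :: "'v set" and apex :: 'v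
  assumes two: "(1::'k) + 1 = 0"
    and finite_S: "finite S"
    and card_S: "d \<le> card S"
    and apex: "d > 0 \<Longrightarrow> apex \<in> S"
    and nondegenerate: "F \<subseteq> insert apex S \<Longrightarrow> card F = d \<Longrightarrow> permanent V d F \<noteq> 0"
begin

lemma add_self [simp]: "x + x = (0::'k)"
  by (rule char_two_double[OF two])

text \<open>The \<open>d + 1\<close> columns of the vertices of \<open>insert apex F\<close> satisfy one linear relation up to scaling,
  whose coefficients are the maximal minors. In the Artinian reduction of the boundary of this simplex the
  variables are therefore proportional to these coefficients, and the class of a homogeneous
  polynomial is determined by its value at them.\<close>

definition dependency :: "'v set \<Rightarrow> 'v \<Rightarrow> 'k" where
  "dependency F v = (if v \<in> insert apex F then permanent V d (insert apex F - {v}) else 0)"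

text \<open>The denominator makes the monomial of a facet have as degree the inverse of its minor.\<close>

definition simplex_degree :: "'v set \<Rightarrow> 'v multiset \<Rightarrow> 'k" where
  "simplex_degree F m =
     (\<Prod>v\<in>#m. dependency F v) / (\<Prod>v\<in>insert apex F. dependency F v)"

definition opposite_faces :: "'v set set" where
  "opposite_faces = {F. F \<subseteq> S \<and> card F = d \<and> apex \<notin> F}"

text \<open>The degree of a monomial with respect to \<open>\<mu>\<close>, as the boundary of the cone over the facets that
  avoid the apex.\<close>

definition mdeg :: "('v set \<Rightarrow> 'k) \<Rightarrow> 'v multiset \<Rightarrow> 'k" where
  "mdeg \<mu> m = (\<Sum>F\<in>opposite_faces. \<mu> F * simplex_degree F m)"

lemma finite_opposite_faces: "finite opposite_faces"
  unfolding opposite_faces_def using finite_S by (auto intro: finite_subset[of _ "Pow S"])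

lemma finite_face: "F \<in> opposite_faces \<Longrightarrow> finite F"
  using finite_S by (auto simp: opposite_faces_def intro: finite_subset)

lemma card_face: "F \<in> opposite_faces \<Longrightarrow> card (insert apex F) = Suc d"
  using finite_face[of F] by (simp add: opposite_faces_def)

lemma dependency_nonzero:
  assumes "F \<in> opposite_faces" "v \<in> insert apex F"
  shows "dependency F v \<noteq> 0"
proof -
  have "card (insert apex F - {v}) = d"
    using card_face[OF assms(1)] finite_face[OF assms(1)] assms(2) by (simp add: card_Diff_singleton)
  moreover have "insert apex F - {v} \<subseteq> insert apex S"
    using assms(1) by (auto simp: opposite_faces_def)
  ultimately show ?thesis
    using nondegenerate assms(2) by (simp add: dependency_def)
qed

lemma dependency_relation:
  assumes F: "F \<in> opposite_faces" and i: "i < d"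
  shows "(\<Sum>v\<in>S. V i v * dependency F v) = 0"
proof -
  have "apex \<in> S" "F \<subseteq> S"
    using apex i F by (auto simp: opposite_faces_def)
  hence "(\<Sum>v\<in>S. V i v * dependency F v) = (\<Sum>v\<in>insert apex F. V i v * dependency F v)"
    using finite_S by (intro sum.mono_neutral_right) (auto simp: dependency_def)
  also have "\<dots> = (\<Sum>v\<in>insert apex F. V i v * permanent V d (insert apex F - {v}))"
    by (intro sum.cong refl) (simp add: dependency_def)
  also have "\<dots> = 0"
    using finite_face[OF F] i by (intro permanent_repeated_row[OF two]) auto
  finally show ?thesis .
qed

abbreviation square_choices :: "'v multiset \<Rightarrow> (nat \<Rightarrow> 'v) set" where
  "square_choices m \<equiv> {I \<in> {..<d} \<rightarrow>\<^sub>E insert apex S. even_mset (m + word d I)}"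

lemma mdeg_linear_form:
  assumes i: "i < d"
  shows "(\<Sum>v\<in>S. V i v * mdeg \<mu> (add_mset v m)) = 0"
proof -
  have "(\<Sum>v\<in>S. V i v * mdeg \<mu> (add_mset v m))
      = (\<Sum>v\<in>S. \<Sum>F\<in>opposite_faces. (\<mu> F * simplex_degree F m) * (V i v * dependency F v))"
    unfolding mdeg_def sum_distrib_left
    by (intro sum.cong refl) (simp add: simplex_degree_def)
  also have "\<dots> = (\<Sum>F\<in>opposite_faces. (\<mu> F * simplex_degree F m) * (\<Sum>v\<in>S. V i v * dependency F v))"
    by (subst sum.swap) (simp add: sum_distrib_left)
  also have "\<dots> = 0"
    using dependency_relation[OF _ i] by simp
  finally show ?thesis .
qed

definition is_cycle :: "('v set \<Rightarrow> 'k) \<Rightarrow> bool" where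
  "is_cycle \<mu> \<longleftrightarrow> (\<forall>G. G \<subseteq> S \<longrightarrow> Suc (card G) = d \<longrightarrow> (\<Sum>v\<in>S - G. \<mu> (insert v G)) = 0)"

lemma simplex_degree_squarefree:
  assumes F: "F \<in> opposite_faces" and T: "finite T"
  shows "simplex_degree F (mset_set T) =
    (if T \<subseteq> insert apex F then inverse (\<Prod>v\<in>insert apex F - T. dependency F v) else 0)"
proof (cases "T \<subseteq> insert apex F")
  case True
  have fin: "finite (insert apex F)"
    using finite_face[OF F] by simp
  have "(\<Prod>v\<in>insert apex F. dependency F v) = (\<Prod>v\<in>insert apex F - T. dependency F v) * (\<Prod>v\<in>T. dependency F v)"
    by (rule prod.subset_diff[OF True fin])
  moreover have "(\<Prod>v\<in>T. dependency F v) \<noteq> 0"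
    using dependency_nonzero[OF F] True T by (auto simp: subset_iff)
  ultimately show ?thesis
    using True by (simp add: simplex_degree_def prod_unfold_prod_mset[symmetric] divide_inverse)
next
  case False
  then obtain v where "v \<in> T" "v \<notin> insert apex F"
    by auto
  hence "(\<Prod>v\<in>T. dependency F v) = 0"
    using T by (auto simp: dependency_def intro!: prod_zero)
  thus ?thesis
    using False by (simp add: simplex_degree_def prod_unfold_prod_mset[symmetric])
qed

text \<open>If \<open>T\<close> contains the apex, the summands belong to the faces through the ridge \<open>T - {apex}\<close>
  that avoid the apex, and the cycle condition evaluates their sum.\<close>

lemma mdeg_face:
  assumes \<mu>: "is_cycle \<mu>" and T: "T \<subseteq> S" "card T = d"
  shows "mdeg \<mu> (mset_set T) = \<mu> T / permanent V d T"
proof -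
  have fin: "finite T"
    using T finite_S by (auto intro: finite_subset)
  show ?thesis
  proof (cases "apex \<in> T")
    case False
    have T': "T \<in> opposite_faces"
      using T False by (simp add: opposite_faces_def)
    have sub: "T \<subseteq> insert apex F \<longleftrightarrow> F = T" if "F \<in> opposite_faces" for F
      using that T False finite_face[OF that] card_subset_eq[of F T]
      by (auto simp: opposite_faces_def)
    have "mdeg \<mu> (mset_set T) = (\<Sum>F\<in>opposite_faces. if F = T then \<mu> T * simplex_degree T (mset_set T) else 0)"
      unfolding mdeg_def by (intro sum.cong refl) (auto simp: simplex_degree_squarefree fin sub)
    also have "\<dots> = \<mu> T * simplex_degree T (mset_set T)"
      using T' finite_opposite_faces by simp
    also have "insert apex T - T = {apex}"
      using False by auto
    hence "simplex_degree T (mset_set T) = inverse (dependency T apex)"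
      by (simp add: simplex_degree_squarefree[OF T' fin] subset_insertI)
    also have "dependency T apex = permanent V d T"
      using False by (simp add: dependency_def)
    finally show ?thesis
      by (simp add: divide_inverse)
  next
    case True
    define G where "G = T - {apex}"
    have T_eq: "T = insert apex G" and apex_G: "apex \<notin> G" and finG: "finite G" and GS: "G \<subseteq> S"
      using True T fin by (auto simp: G_def)
    have d: "Suc (card G) = d"
      using T T_eq apex_G finG by simp
    define A where "A = S - T"
    have summand: "\<mu> F * simplex_degree F (mset_set T) =
        (if F \<in> (\<lambda>w. insert w G) ` A then \<mu> F * inverse (permanent V d T) else 0)"
      if F: "F \<in> opposite_faces" for F
    proof (cases "F \<in> (\<lambda>w. insert w G) ` A")
      case True
      then obtain w where w: "w \<in> A" "F = insert w G"
        by auto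
      hence "w \<noteq> apex" "w \<notin> G"
        by (auto simp: A_def T_eq)
      hence sets: "insert apex F - T = {w}" "insert apex F - {w} = T" "w \<in> insert apex F" "T \<subseteq> insert apex F"
        using w T_eq apex_G by auto
      hence "simplex_degree F (mset_set T) = inverse (dependency F w)"
        by (simp only: simplex_degree_squarefree[OF F fin] if_True) simp
      also have "dependency F w = permanent V d T"
        using sets by (simp only: dependency_def if_True)
      finally have "simplex_degree F (mset_set T) = inverse (permanent V d T)" .
      thus ?thesis
        using True by simp
    next
      case False
      have "\<not> T \<subseteq> insert apex F"
      proof
        assume "T \<subseteq> insert apex F"
        hence GF: "G \<subseteq> F"
          using apex_G T_eq by auto
        have "card F = d"
          using F by (simp add: opposite_faces_def)
        hence "card (F - G) = 1"
          using card_Diff_subset[OF finG GF] d by linarith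
        then obtain w where w: "F - G = {w}"
          by (auto simp: card_1_singleton_iff)
        have "F = insert w G"
          using w GF by blast
        moreover have "w \<in> A"
          using w F by (auto simp: A_def T_eq opposite_faces_def)
        ultimately show False
          using False by blast
      qed
      thus ?thesis
        using False by (simp add: simplex_degree_squarefree[OF F fin])
    qed
    have sub: "(\<lambda>w. insert w G) ` A \<subseteq> opposite_faces"
      using GS apex_G finG d by (auto simp: A_def T_eq opposite_faces_def)
    have "mdeg \<mu> (mset_set T) = (\<Sum>F\<in>opposite_faces.
        if F \<in> (\<lambda>w. insert w G) ` A then \<mu> F * inverse (permanent V d T) else 0)"
      unfolding mdeg_def by (intro sum.cong refl summand)
    also have "\<dots> = (\<Sum>F\<in>(\<lambda>w. insert w G) ` A. \<mu> F * inverse (permanent V d T))"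
      using sub finite_opposite_faces
      by (simp add: sum.If_cases Int_absorb1)
    also have "\<dots> = (\<Sum>w\<in>A. \<mu> (insert w G)) * inverse (permanent V d T)"
      by (subst sum.reindex) (auto simp: inj_on_def A_def T_eq sum_distrib_right)
    also have "(\<Sum>w\<in>A. \<mu> (insert w G)) = \<mu> T"
    proof -
      have "S - G = insert apex A" "apex \<notin> A" "finite A"
        using T finite_S apex_G by (auto simp: A_def T_eq)
      moreover have "(\<Sum>w\<in>S - G. \<mu> (insert w G)) = 0"
        using \<mu> GS d by (simp add: is_cycle_def)
      ultimately have "\<mu> T + (\<Sum>w\<in>A. \<mu> (insert w G)) = 0"
        by (simp add: T_eq)
      thus ?thesis
        by (metis add_self add_left_cancel)
    qed
    finally show ?thesis
      by (simp add: divide_inverse)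
  qed
qed

text \<open>A monomial that is not squarefree contains some \<open>x\<^sub>v\<close> twice. A linear form vanishing on the
  other columns of its support replaces one of the two factors \<open>x\<^sub>v\<close> by variables outside the
  support. Repeating this leads to squarefree monomials. The assumption \<open>reduce\<close> allows any
  property of monomials that is inherited along linear relations.\<close>

lemma spread_support:
  assumes reduce: "\<And>n c v. set_mset n \<subseteq> S \<Longrightarrow> Suc (size n) = e \<Longrightarrow> v \<in> S \<Longrightarrow>
      (\<Sum>i<d. c i * V i v) = 1 \<Longrightarrow>
      (\<And>w. w \<in> S \<Longrightarrow> w \<noteq> v \<Longrightarrow> (\<Sum>i<d. c i * V i w) \<noteq> 0 \<Longrightarrow> Z (add_mset w n)) \<Longrightarrow>
      Z (add_mset v n)"
    and squarefree: "\<And>T'. T \<subseteq> T' \<Longrightarrow> T' \<subseteq> S \<Longrightarrow> card T' = e \<Longrightarrow> Z (mset_set T')"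
    and large: "\<And>m. set_mset m \<subseteq> S \<Longrightarrow> size m = e \<Longrightarrow> card (set_mset m) > d \<Longrightarrow> Z m"
    and "T \<subseteq> set_mset m" "set_mset m \<subseteq> S" "size m = e"
  shows "Z m"
  using assms(4-6)
proof (induction "card S - card (set_mset m)" arbitrary: m rule: less_induct)
  case less
  show ?case
  proof (cases "card (set_mset m) > d")
    case True
    thus ?thesis
      using large less.prems by blast
  next
    case small: False
    show ?thesis
    proof (cases "\<exists>v. count m v \<ge> 2")
      case False
      have "m = mset_set (set_mset m)"
      proof (rule multiset_eqI)
        fix v
        have "\<not> count m v \<ge> 2"
          using False by blast
        hence "count m v \<le> 1"
          by linarith
        thus "count m v = count (mset_set (set_mset m)) v"
          by (cases "v \<in># m") (auto simp: count_mset_set' not_in_iff order.antisym Suc_le_eq)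
      qed
      moreover from this have "card (set_mset m) = e"
        using less.prems(3) by (metis size_mset_set)
      ultimately show ?thesis
        using squarefree[of "set_mset m"] less.prems by metis
    next
      case True
      then obtain v where v: "count m v \<ge> 2"
        by blast
      define n where "n = m - {#v#}"
      have vm: "v \<in># m"
        using v by (metis count_greater_zero_iff less_le_trans pos2)
      hence m: "m = add_mset v n"
        by (simp add: n_def)
      have "count n v \<ge> 1"
        using v by (simp add: n_def)
      hence vn: "v \<in># n"
        by (metis count_greater_zero_iff less_le_trans zero_less_one)
      have supp: "set_mset m = set_mset n"
        using m vn by auto
      obtain F where F: "set_mset m \<subseteq> F" "F \<subseteq> S" "card F = d"
        using exists_subset_between[of "set_mset m" d S] small card_S less.prems finite_S
        by (metis leI)
      have nz: "permanent V d F \<noteq> 0"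
        using F by (intro nondegenerate) auto
      have "v \<in> F"
        using vm F by auto
      then obtain c where c: "\<And>w. w \<in> F \<Longrightarrow> (\<Sum>i<d. c i * V i w) = (if w = v then 1 else 0)"
        using dual_vector_exists[OF two _ nz] by metis
      show ?thesis
        unfolding m
      proof (rule reduce[where c = c])
        fix w assume w: "w \<in> S" "w \<noteq> v" "(\<Sum>i<d. c i * V i w) \<noteq> 0"
        hence "w \<notin> F"
          using c by auto
        hence supp': "set_mset (add_mset w n) = insert w (set_mset m)" "w \<notin> set_mset m"
          using supp F by auto
        have "card (set_mset m) < card (set_mset (add_mset w n))"
          unfolding supp'(1) using supp'(2) by simp
        moreover have "card (set_mset (add_mset w n)) \<le> card S"
          using supp'(1) w less.prems finite_S by (intro card_mono) auto
        ultimately show "Z (add_mset w n)"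
          using less.prems supp' w m by (intro less.hyps) auto
      qed (use c[OF \<open>v \<in> F\<close>] vm less.prems m in auto)
    qed
  qed
qed

text \<open>Spreading only enlarges the support, so it ends with monomials of sets \<open>F\<close> that contain \<open>T\<close>,
  whose degrees are multiples of \<open>\<mu> F\<close>.\<close>

lemma mdeg_nonface:
  assumes \<mu>: "is_cycle \<mu>" and zero: "\<And>F. T \<subseteq> F \<Longrightarrow> \<mu> F = 0"
    and m: "T \<subseteq> set_mset m" "set_mset m \<subseteq> S" "size m = d"
  shows "mdeg \<mu> m = 0"
proof (rule spread_support[where Z = "\<lambda>m. mdeg \<mu> m = 0", OF _ _ _ m])
  fix n c v
  assume v: "v \<in> S" "(\<Sum>i<d. c i * V i v) = 1"
    and IH: "\<And>w. w \<in> S \<Longrightarrow> w \<noteq> v \<Longrightarrow> (\<Sum>i<d. c i * V i w) \<noteq> 0 \<Longrightarrow> mdeg \<mu> (add_mset w n) = 0"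
  have "(\<Sum>w\<in>S. (\<Sum>i<d. c i * V i w) * mdeg \<mu> (add_mset w n))
      = (\<Sum>i<d. c i * (\<Sum>w\<in>S. V i w * mdeg \<mu> (add_mset w n)))"
    unfolding sum_distrib_right sum_distrib_left by (subst sum.swap) (simp add: mult.assoc)
  also have "\<dots> = 0"
    using mdeg_linear_form by simp
  finally have "(\<Sum>w\<in>S. (\<Sum>i<d. c i * V i w) * mdeg \<mu> (add_mset w n)) = 0" .
  moreover have "(\<Sum>w\<in>S. (\<Sum>i<d. c i * V i w) * mdeg \<mu> (add_mset w n))
      = (\<Sum>w\<in>S. if w = v then mdeg \<mu> (add_mset v n) else 0)"
  proof (rule sum.cong[OF refl])
    fix w assume "w \<in> S"
    thus "(\<Sum>i<d. c i * V i w) * mdeg \<mu> (add_mset w n) = (if w = v then mdeg \<mu> (add_mset v n) else 0)"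
      using v(2) IH[of w] by (cases "(\<Sum>i<d. c i * V i w) = 0") auto
  qed
  ultimately show "mdeg \<mu> (add_mset v n) = 0"
    using v(1) finite_S by simp
next
  fix T' assume T': "T \<subseteq> T'" "T' \<subseteq> S" "card T' = d"
  thus "mdeg \<mu> (mset_set T') = 0"
    using mdeg_face[OF \<mu> T'(2,3)] zero[OF T'(1)] by simp
next
  fix m :: "'v multiset" assume "size m = d" "card (set_mset m) > d"
  moreover have "card (set_mset m) \<le> size m"
    by (metis mset_set_set_mset_msubset size_mset_mono size_mset_set)
  ultimately show "mdeg \<mu> m = 0"
    by simp
qed

lemma size_parity: "even (size m) \<longleftrightarrow> even (card {v. odd (count m v)})"
proof -
  have "even (size m) \<longleftrightarrow> even (card {v \<in> set_mset m. odd (count m v)})"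
    unfolding size_multiset_overloaded_eq by (rule even_sum_iff) simp
  also have "{v \<in> set_mset m. odd (count m v)} = {v. odd (count m v)}"
    by (auto simp: not_in_iff intro: ccontr)
  finally show ?thesis .
qed

text \<open>The identity of the introduction for the boundary of one simplex. This is \<open>parity_sum_eq_prod\<close> for
  the set of vertices with odd exponent in \<open>m\<close>, multiplied by the value of \<open>m\<close> at the dependency and
  divided by \<open>(\<Prod>v. dependency F v)\<^sup>2\<close>.\<close>

lemma simplex_degree_square:
  assumes F: "F \<in> opposite_faces" and m: "size m = d"
  shows "simplex_degree F m = (\<Sum>I\<in>square_choices m.
      (\<Prod>i<d. V i (I i)) * (simplex_degree F (half (m + word d I)))\<^sup>2)"
proof -
  define G where "G = insert apex F"
  define r where "r = dependency F"
  define c where "c = (\<Prod>v\<in>G. r v)"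
  define val where "val = (\<lambda>m. \<Prod>v\<in>#m. r v)"
  define E where "E = {v. odd (count m v)}"
  have G: "finite G" "card G = Suc d" "G \<subseteq> insert apex S"
    using finite_face[OF F] card_face[OF F] F by (auto simp: G_def opposite_faces_def)
  have c: "c \<noteq> 0"
    unfolding c_def r_def using dependency_nonzero[OF F] G(1) by (simp add: G_def)
  have deg: "simplex_degree F m = val m / c" for m
    by (simp add: simplex_degree_def val_def c_def r_def G_def)
  have square: "(simplex_degree F (half (m + word d I)))\<^sup>2 = val m * (\<Prod>i<d. r (I i)) / c\<^sup>2"
    if "even_mset (m + word d I)" for I
  proof -
    have "(val (half (m + word d I)))\<^sup>2 = val (half (m + word d I) + half (m + word d I))"
      by (simp add: val_def power2_eq_square)
    also have "\<dots> = val m * (\<Prod>i<d. r (I i))"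
      unfolding half_add[OF that] by (simp add: val_def word_def multiset.map_comp comp_def prod_unfold_prod_mset)
    finally show ?thesis
      by (simp add: deg power_divide)
  qed
  have "(\<Sum>I\<in>square_choices m.
      (\<Prod>i<d. V i (I i)) * (simplex_degree F (half (m + word d I)))\<^sup>2)
      = (\<Sum>I\<in>square_choices m.
      (\<Prod>i<d. V i (I i) * r (I i)) * (val m / c\<^sup>2))"
    by (intro sum.cong refl) (simp add: square prod.distrib)
  also have "\<dots> = (\<Sum>I\<in>{I \<in> {..<d} \<rightarrow>\<^sub>E G. odd_values d I = E}. (\<Prod>i<d. V i (I i) * r (I i)) * (val m / c\<^sup>2))"
  proof (rule sum.mono_neutral_right)
    show "finite (square_choices m)"
      using finite_S by (simp add: finite_PiE)
    show "{I \<in> {..<d} \<rightarrow>\<^sub>E G. odd_values d I = E} \<subseteq> square_choices m"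
      using G(3) by (auto simp: even_mset_word_iff E_def PiE_iff)
    show "\<forall>I\<in>square_choices m - {I \<in> {..<d} \<rightarrow>\<^sub>E G. odd_values d I = E}.
        (\<Prod>i<d. V i (I i) * r (I i)) * (val m / c\<^sup>2) = 0"
    proof
      fix I assume "I \<in> square_choices m - {I \<in> {..<d} \<rightarrow>\<^sub>E G. odd_values d I = E}"
      hence "I \<in> extensional {..<d}" "I \<notin> {..<d} \<rightarrow>\<^sub>E G"
        by (auto simp: even_mset_word_iff E_def PiE_def)
      then obtain i where i: "i < d" "I i \<notin> G"
        by (auto simp: PiE_def)
      hence "r (I i) = 0"
        by (simp add: r_def dependency_def G_def)
      hence "(\<Prod>i<d. V i (I i) * r (I i)) = 0"
        using i by (intro prod_zero) auto
      thus "(\<Prod>i<d. V i (I i) * r (I i)) * (val m / c\<^sup>2) = 0"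
        by simp
    qed
  qed
  also have "\<dots> = parity_sum (\<lambda>i v. V i v * r v) G d E * (val m / c\<^sup>2)"
    unfolding parity_sum_def by (rule sum_distrib_right[symmetric])
  also have "\<dots> = c * (val m / c\<^sup>2)"
  proof (cases "set_mset m \<subseteq> G")
    case True
    have E: "E \<subseteq> G"
      using True by (auto simp: E_def intro: ccontr dest: not_in_iff[THEN iffD1, OF contra_subsetD])
    have "even (card E) \<longleftrightarrow> even d"
      using size_parity[of m] m by (simp add: E_def)
    moreover have "card (G - E) + card E = Suc d"
      using E G by (metis card_Diff_subset card_mono finite_subset le_add_diff_inverse2)
    ultimately have "odd (card (G - E))"
      by (metis even_Suc even_add)
    hence "parity_sum (\<lambda>i v. V i v * permanent V d (G - {v})) G d E = (\<Prod>v\<in>G. permanent V d (G - {v}))"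
      using G E by (intro parity_sum_eq_prod[OF two]) auto
    moreover have "r v = permanent V d (G - {v})" if "v \<in> G" for v
      using that by (simp add: r_def dependency_def G_def)
    moreover from this have "parity_sum (\<lambda>i v. V i v * r v) G d E
        = parity_sum (\<lambda>i v. V i v * permanent V d (G - {v})) G d E"
      unfolding parity_sum_def by (intro sum.cong refl prod.cong) (auto simp: PiE_iff)
    ultimately show ?thesis
      by (simp add: c_def)
  next
    case False
    then obtain v where v: "v \<in># m" "v \<notin> G"
      by auto
    hence "r v = 0"
      by (simp add: r_def dependency_def G_def)
    hence "val m = 0"
      using v(1) by (auto simp: val_def prod_mset_zero_iff image_iff intro!: bexI[of _ v])
    thus ?thesis
      by simp
  qed
  also have "\<dots> = simplex_degree F m"
    using c by (simp add: deg power2_eq_square)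
  finally show ?thesis ..
qed

lemmas square_sum = square_sum_char_two[OF two]

text \<open>Summation of the identities for the simplices. As squaring is additive, the squared coefficients
  and the squared degrees combine into squares of degrees with respect to \<open>\<mu>\<close>.\<close>

lemma mdeg_square:
  assumes m: "size m = d"
  shows "mdeg (\<lambda>F. (\<mu> F)\<^sup>2) m = (\<Sum>I\<in>square_choices m.
      (\<Prod>i<d. V i (I i)) * (mdeg \<mu> (half (m + word d I)))\<^sup>2)"
proof -
  have "mdeg (\<lambda>F. (\<mu> F)\<^sup>2) m = (\<Sum>F\<in>opposite_faces. \<Sum>I\<in>square_choices m.
      (\<Prod>i<d. V i (I i)) * (\<mu> F * simplex_degree F (half (m + word d I)))\<^sup>2)"
    unfolding mdeg_def
    by (intro sum.cong refl, subst simplex_degree_square[OF _ m])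
      (simp_all add: sum_distrib_left power_mult_distrib mult_ac)
  also have "\<dots> = (\<Sum>I\<in>square_choices m.
      (\<Prod>i<d. V i (I i)) * (\<Sum>F\<in>opposite_faces. (\<mu> F * simplex_degree F (half (m + word d I)))\<^sup>2))"
    by (subst sum.swap) (simp add: sum_distrib_left)
  finally show ?thesis
    by (simp add: mdeg_def square_sum)
qed

end

section \<open>Squares and orthogonality\<close>

definition homogeneous :: "'v set \<Rightarrow> nat \<Rightarrow> ('v multiset \<Rightarrow>\<^sub>0 'k::zero) \<Rightarrow> bool" where
  "homogeneous S k u \<longleftrightarrow> (\<forall>n\<in>monomials u. set_mset n \<subseteq> S \<and> size n = k)"

context column_configuration
begin

text \<open>The degree of the product of \<open>u\<close> and the monomial \<open>M\<close>.\<close>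

definition pairing :: "('v set \<Rightarrow> 'k) \<Rightarrow> ('v multiset \<Rightarrow>\<^sub>0 'k) \<Rightarrow> 'v multiset \<Rightarrow> 'k" where
  "pairing \<mu> u M = (\<Sum>n\<in>monomials u. coef u n * mdeg \<mu> (n + M))"

text \<open>For homogeneous \<open>u\<close> of degree \<open>k\<close>, this says that \<open>u\<close> represents an element of the radical.\<close>

definition orthogonal :: "('v set \<Rightarrow> 'k) \<Rightarrow> nat \<Rightarrow> ('v multiset \<Rightarrow>\<^sub>0 'k) \<Rightarrow> bool" where
  "orthogonal \<mu> k u \<longleftrightarrow> (\<forall>M. set_mset M \<subseteq> S \<longrightarrow> size M + k = d \<longrightarrow> pairing \<mu> u M = 0)"

text \<open>The degree of \<open>u\<^sup>2 P\<close>. The mixed terms of the square cancel in characteristic two.\<close>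

definition square_pairing :: "('v set \<Rightarrow> 'k) \<Rightarrow> ('v multiset \<Rightarrow>\<^sub>0 'k) \<Rightarrow> 'v multiset \<Rightarrow> 'k" where
  "square_pairing \<mu> u P = (\<Sum>n\<in>monomials u. (coef u n)\<^sup>2 * mdeg \<mu> (n + n + P))"

lemma pairing_superset:
  assumes "finite A" "monomials u \<subseteq> A"
  shows "pairing \<mu> u M = (\<Sum>n\<in>A. coef u n * mdeg \<mu> (n + M))"
  unfolding pairing_def using assms
  by (intro sum.mono_neutral_left) (auto simp: in_keys_iff)

lemma pairing_add_scaled:
  assumes "\<And>n. coef u n = coef v n + c * coef w n"
  shows "pairing \<mu> u M = pairing \<mu> v M + c * pairing \<mu> w M"
proof -
  define A where "A = monomials u \<union> monomials v \<union> monomials w"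
  have A: "finite A" "monomials u \<subseteq> A" "monomials v \<subseteq> A" "monomials w \<subseteq> A"
    by (auto simp: A_def)
  show ?thesis
    by (simp add: pairing_superset[OF A(1,2)] pairing_superset[OF A(1,3)] pairing_superset[OF A(1,4)]
        assms distrib_right sum.distrib sum_distrib_left mult.assoc)
qed

lemma sum_symmetric:
  fixes f :: "'b \<Rightarrow> 'b \<Rightarrow> 'k"
  assumes "finite A" "\<And>a b. f a b = f b a"
  shows "(\<Sum>a\<in>A. \<Sum>b\<in>A. f a b) = (\<Sum>a\<in>A. f a a)"
  using assms(1)
proof (induction A rule: finite_induct)
  case (insert a A)
  have "(\<Sum>x\<in>insert a A. \<Sum>y\<in>insert a A. f x y)
      = f a a + (\<Sum>x\<in>A. \<Sum>y\<in>A. f x y) + ((\<Sum>y\<in>A. f a y) + (\<Sum>x\<in>A. f x a))"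
    using insert.hyps by (simp add: sum.distrib algebra_simps)
  also have "(\<Sum>x\<in>A. f x a) = (\<Sum>y\<in>A. f a y)"
    by (intro sum.cong refl assms(2))
  finally show ?case
    using insert by simp
qed simp

lemma square_pairing_eq_sum:
  "square_pairing \<mu> u P = (\<Sum>n\<in>monomials u. coef u n * pairing \<mu> u (n + P))"
proof -
  have "(\<Sum>n\<in>monomials u. coef u n * pairing \<mu> u (n + P))
      = (\<Sum>n\<in>monomials u. \<Sum>n'\<in>monomials u.
          coef u n * coef u n' * mdeg \<mu> (n + n' + P))"
    by (simp add: pairing_def sum_distrib_left mult.assoc add_ac)
  also have "\<dots> = (\<Sum>n\<in>monomials u. coef u n * coef u n * mdeg \<mu> (n + n + P))"
    by (rule sum_symmetric) (simp_all add: mult_ac add_ac)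
  finally show ?thesis
    by (simp add: square_pairing_def power2_eq_square)
qed

text \<open>The radical is an ideal: \<open>u\<^sup>2 P\<close> is the product of \<open>u\<close> and \<open>u P\<close>. That \<open>P\<close> has a degree at all
  is where \<open>2 k \<le> d\<close> enters.\<close>

lemma orthogonal_imp_square_zero:
  assumes "homogeneous S k u" "orthogonal \<mu> k u" "set_mset P \<subseteq> S" "size P + 2 * k = d"
  shows "square_pairing \<mu> u P = 0"
  unfolding square_pairing_eq_sum
proof (rule sum.neutral, rule ballI)
  fix n assume "n \<in> monomials u"
  hence "set_mset (n + P) \<subseteq> S" "size (n + P) + k = d"
    using assms by (auto simp: homogeneous_def)
  thus "coef u n * pairing \<mu> u (n + P) = 0"
    using assms(2) by (simp add: orthogonal_def)
qed

lemma square_pairing_expansion: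
  assumes u: "homogeneous S k u" and P: "size P + 2 * k = d"
  shows "square_pairing (\<lambda>F. (\<mu> F)\<^sup>2) u P =
    (\<Sum>I\<in>square_choices P.
      (\<Prod>i<d. V i (I i)) * (pairing \<mu> u (half (P + word d I)))\<^sup>2)"
proof -
  have "square_pairing (\<lambda>F. (\<mu> F)\<^sup>2) u P =
    (\<Sum>n\<in>monomials u. \<Sum>I\<in>square_choices P.
      (\<Prod>i<d. V i (I i)) * (coef u n * mdeg \<mu> (n + half (P + word d I)))\<^sup>2)"
    unfolding square_pairing_def
  proof (rule sum.cong[OF refl])
    fix n assume "n \<in> monomials u"
    hence size: "size (n + n + P) = d"
      using u P by (simp add: homogeneous_def)
    have "mdeg (\<lambda>F. (\<mu> F)\<^sup>2) (n + n + P)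
        = (\<Sum>I\<in>square_choices P.
            (\<Prod>i<d. V i (I i)) * (mdeg \<mu> (n + half (P + word d I)))\<^sup>2)"
      unfolding mdeg_square[OF size]
    proof (rule sum.cong)
      have even: "even_mset (n + n + P + w) \<longleftrightarrow> even_mset (P + w)" for w
        using even_mset_double_add[of n "P + w"] by (simp only: add.assoc)
      show "square_choices (n + n + P)
          = square_choices P"
        by (simp only: even)
      fix I assume "I \<in> square_choices P"
      hence "half (n + n + P + word d I) = n + half (P + word d I)"
        using half_double_add[of "P + word d I" n] by (simp only: add.assoc mem_Collect_eq)
      thus "(\<Prod>i<d. V i (I i)) * (mdeg \<mu> (half (n + n + P + word d I)))\<^sup>2
          = (\<Prod>i<d. V i (I i)) * (mdeg \<mu> (n + half (P + word d I)))\<^sup>2"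
        by simp
    qed
    thus "(coef u n)\<^sup>2 * mdeg (\<lambda>F. (\<mu> F)\<^sup>2) (n + n + P)
        = (\<Sum>I\<in>square_choices P.
            (\<Prod>i<d. V i (I i)) * (coef u n * mdeg \<mu> (n + half (P + word d I)))\<^sup>2)"
      by (simp add: sum_distrib_left power_mult_distrib mult_ac)
  qed
  also have "\<dots> = (\<Sum>I\<in>square_choices P.
      (\<Prod>i<d. V i (I i)) * (\<Sum>n\<in>monomials u. (coef u n * mdeg \<mu> (n + half (P + word d I)))\<^sup>2))"
    by (subst sum.swap) (simp add: sum_distrib_left)
  finally show ?thesis
    by (simp add: pairing_def square_sum)
qed

end

lemma submultiset_of_size:
  assumes "j \<le> size M"
  obtains P where "P \<subseteq># M" "size P = j"
proof -
  obtain xs where xs: "mset xs = M"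
    using ex_mset by blast
  have "mset (take j xs) + mset (drop j xs) = M"
    using xs by (metis append_take_drop_id mset_append)
  hence "mset (take j xs) \<subseteq># M"
    by (metis mset_subset_eq_add_left)
  moreover have "size (mset (take j xs)) = j"
    using xs assms by auto
  ultimately show thesis
    using that by blast
qed

text \<open>The twist stands for the endomorphism of a rational function field that squares the constants and
  fixes the variables. The last assumption is the independence of the products of entries over the
  subfield of squares.\<close>

locale generic_configuration = column_configuration V d S apex
  for V :: "nat \<Rightarrow> 'v \<Rightarrow> 'k::field" and d :: nat and S :: "'v set" and apex :: 'v +
  fixes twist :: "'k \<Rightarrow> 'k"
  assumes twist_add: "twist (x + y) = twist x + twist y"
    and twist_mult: "twist (x * y) = twist x * twist y"
    and twist_one: "twist 1 = 1"
    and twist_entry: "i < d \<Longrightarrow> v \<in> insert apex S \<Longrightarrow> twist (V i v) = V i v"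
    and square_independent:
      "(\<Sum>I\<in>{..<d} \<rightarrow>\<^sub>E insert apex S. (\<Prod>i<d. V i (I i)) * (w I)\<^sup>2) = 0 \<Longrightarrow>
        I \<in> {..<d} \<rightarrow>\<^sub>E insert apex S \<Longrightarrow> w I = 0"
begin

text \<open>A vanishing sum of squares with independent coefficients has vanishing terms. For a monomial
  \<open>M\<close> of the complementary degree, the square \<open>M + M\<close> splits into some \<open>P\<close> and a word \<open>I\<close> of
  length \<open>d\<close>, so the degree of \<open>u M\<close> is one of the terms.\<close>

lemma square_zero_imp_orthogonal:
  assumes u: "homogeneous S k u" and k: "2 * k \<le> d"
    and zero: "\<And>P. set_mset P \<subseteq> S \<Longrightarrow> size P + 2 * k = d \<Longrightarrow> square_pairing (\<lambda>F. (\<mu> F)\<^sup>2) u P = 0"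
  shows "orthogonal \<mu> k u"
  unfolding orthogonal_def
proof (intro allI impI)
  fix M assume M: "set_mset M \<subseteq> S" "size M + k = d"
  have "d - 2 * k \<le> size M"
    using M(2) by linarith
  then obtain P where P: "P \<subseteq># M" "size P = d - 2 * k"
    by (rule submultiset_of_size)
  have PS: "set_mset P \<subseteq> S" "size P + 2 * k = d"
    using P M(1) k by (auto dest: set_mset_mono)
  have "P \<subseteq># M + M"
    using P(1) by (metis mset_subset_eq_add_left subset_mset.order_trans)
  hence split: "P + (M + M - P) = M + M"
    by simp
  have "size P + size (M + M - P) = size M + size M"
    using arg_cong[OF split, of size] by (simp only: size_union)
  hence "size (M + M - P) = d"
    using PS(2) M(2) by linarith
  then obtain I where I: "word d I = M + M - P" "I \<in> {..<d} \<rightarrow>\<^sub>E set_mset (M + M - P)"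
    by (rule word_exists)
  have "set_mset (M + M - P) \<subseteq> set_mset (M + M)"
    by (rule set_mset_mono) simp
  hence "set_mset (M + M - P) \<subseteq> insert apex S"
    using M(1) by auto
  hence I': "I \<in> {..<d} \<rightarrow>\<^sub>E insert apex S"
    using I(2) by (rule subsetD[OF PiE_mono])
  define w where "w J = (if even_mset (P + word d J) then pairing \<mu> u (half (P + word d J)) else 0)" for J
  have "(\<Sum>J\<in>{..<d} \<rightarrow>\<^sub>E insert apex S. (\<Prod>i<d. V i (J i)) * (w J)\<^sup>2)
      = (\<Sum>J\<in>{..<d} \<rightarrow>\<^sub>E insert apex S. if even_mset (P + word d J)
          then (\<Prod>i<d. V i (J i)) * (pairing \<mu> u (half (P + word d J)))\<^sup>2 else 0)"
    by (intro sum.cong refl) (simp add: w_def)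
  also have "\<dots> = (\<Sum>J\<in>square_choices P.
          (\<Prod>i<d. V i (J i)) * (pairing \<mu> u (half (P + word d J)))\<^sup>2)"
    by (rule sum.inter_filter[symmetric]) (simp add: finite_PiE finite_S)
  also have "\<dots> = 0"
    using zero[OF PS] square_pairing_expansion[OF u PS(2)] by simp
  finally have "w I = 0"
    using I' by (rule square_independent)
  moreover have "P + word d I = M + M"
    using I(1) split by simp
  moreover have "even_mset (M + M)"
    unfolding even_mset_def by blast
  ultimately show "pairing \<mu> u M = 0"
    by (simp add: w_def)
qed

lemma twist_zero [simp]: "twist 0 = 0"
proof -
  have "twist 0 + twist 0 = twist 0 + 0"
    by (simp only: twist_add[symmetric] add_0_right)
  thus ?thesis
    by (simp only: add_left_cancel)
qed

lemma twist_eq_zero_iff [simp]: "twist x = 0 \<longleftrightarrow> x = 0"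
proof
  assume "twist x = 0"
  show "x = 0"
  proof (rule ccontr)
    assume "x \<noteq> 0"
    hence "twist x * twist (inverse x) = 1"
      by (simp flip: twist_mult add: twist_one)
    thus False
      using \<open>twist x = 0\<close> by simp
  qed
qed simp

lemma twist_sum: "twist (\<Sum>a\<in>A. f a) = (\<Sum>a\<in>A. twist (f a))"
  by (induction A rule: infinite_finite_induct) (auto simp: twist_add)

lemma twist_prod: "twist (\<Prod>a\<in>A. f a) = (\<Prod>a\<in>A. twist (f a))"
  by (induction A rule: infinite_finite_induct) (auto simp: twist_mult twist_one)

lemma twist_prod_mset: "twist (\<Prod>a\<in>#A. f a) = (\<Prod>a\<in>#A. twist (f a))"
  by (induction A) (auto simp: twist_mult twist_one)

lemma twist_inverse: "twist (inverse x) = inverse (twist x)"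
proof (cases "x = 0")
  case False
  hence "twist x * twist (inverse x) = 1"
    by (simp flip: twist_mult add: twist_one)
  thus ?thesis
    by (simp add: inverse_unique)
qed simp

lemma twist_dependency:
  assumes "F \<in> opposite_faces"
  shows "twist (dependency F v) = dependency F v"
proof -
  have "twist (permanent V d T) = permanent V d T" if "T \<subseteq> insert apex S" for T
    unfolding permanent_def twist_sum twist_prod
    using that by (intro sum.cong prod.cong refl twist_entry) (auto dest: bijections_mem)
  moreover have "insert apex F - {v} \<subseteq> insert apex S"
    using assms by (auto simp: opposite_faces_def)
  ultimately show ?thesis
    by (simp add: dependency_def)
qed

lemma twist_mdeg: "twist (mdeg \<mu> m) = mdeg (\<lambda>F. twist (\<mu> F)) m"
  unfolding mdeg_def twist_sum
  by (intro sum.cong refl)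
    (simp add: simplex_degree_def twist_mult twist_inverse divide_inverse twist_prod twist_prod_mset twist_dependency)

definition twist_poly :: "('v multiset \<Rightarrow>\<^sub>0 'k) \<Rightarrow> ('v multiset \<Rightarrow>\<^sub>0 'k)" where
  "twist_poly u = Poly_Mapping.map twist u"

lemma lookup_twist_poly [simp]: "coef (twist_poly u) n = twist (coef u n)"
  by (simp add: twist_poly_def Poly_Mapping.map.rep_eq when_def)

lemma keys_twist_poly [simp]: "monomials (twist_poly u) = monomials u"
  by (auto simp: in_keys_iff)

lemma pairing_twist: "pairing (\<lambda>F. twist (\<mu> F)) (twist_poly u) M = twist (pairing \<mu> u M)"
  by (simp add: pairing_def twist_sum twist_mult twist_mdeg)

text \<open>The twist maps the orthogonal space of \<open>\<mu>\<close> to that of the squared cycle, and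
  \<open>square_zero_imp_orthogonal\<close> contains the latter in the former, because the orthogonal space is
  closed under products. So the orthogonal space of \<open>\<mu>\<close> is mapped to itself. Vectors of minimal
  support in such a space are fixed by the twist up to a factor, and they span the space.\<close>

lemma orthogonal_square:
  assumes \<mu>: "\<And>F. twist (\<mu> F) = (\<mu> F)\<^sup>2" and k: "2 * k \<le> d"
    and u: "homogeneous S k u" "orthogonal \<mu> k u"
  shows "orthogonal (\<lambda>F. (\<mu> F)\<^sup>2) k u"
proof -
  let ?\<nu> = "\<lambda>F. (\<mu> F)\<^sup>2"
  have descend: "orthogonal \<mu> k w" if "homogeneous S k w" "orthogonal ?\<nu> k w" for w
    by (rule square_zero_imp_orthogonal[OF that(1) k orthogonal_imp_square_zero[OF that]])
  have twisted: "orthogonal ?\<nu> k (twist_poly w)" if "orthogonal \<mu> k w" for w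
    using that pairing_twist[of \<mu> w] unfolding orthogonal_def by (simp add: \<mu>)
  have twist_homogeneous: "homogeneous S k (twist_poly w)" if "homogeneous S k w" for w
    using that by (simp add: homogeneous_def)
  show ?thesis
    using u
  proof (induction "card (monomials u)" arbitrary: u rule: less_induct)
    case less
    show ?case
    proof (cases "u = 0")
      case True
      thus ?thesis
        by (simp add: orthogonal_def pairing_def)
    next
      case False
      define Y where "Y = {w. w \<noteq> 0 \<and> homogeneous S k w \<and> orthogonal \<mu> k w \<and> monomials w \<subseteq> monomials u}"
      have "u \<in> Y"
        using False less.prems by (simp add: Y_def)
      then obtain w where w: "w \<in> Y" "\<And>w'. w' \<in> Y \<Longrightarrow> card (monomials w) \<le> card (monomials w')"
        using ex_has_least_nat[of "\<lambda>w. w \<in> Y" u "\<lambda>w. card (monomials w)"] by blast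
      have "monomials w \<noteq> {}"
        using w(1) by (simp add: Y_def)
      then obtain j where j: "j \<in> monomials w"
        by blast
      define c where "c = inverse (coef w j)"
      have c: "c \<noteq> 0" "c * coef w j = 1"
        using j by (auto simp: c_def in_keys_iff)
      \<comment> \<open>scaled such that the coefficient at \<open>j\<close> is 1, hence fixed by the twist\<close>
      define w1 where "w1 = Poly_Mapping.map ((*) c) w"
      have w1: "coef w1 n = 0 + c * coef w n" for n
        by (simp add: w1_def Poly_Mapping.map.rep_eq when_def)
      have keys_w1: "monomials w1 = monomials w"
        using c(1) by (auto simp: in_keys_iff w1)
      have hom_w1: "homogeneous S k w1"
        using w(1) by (simp add: Y_def homogeneous_def keys_w1)
      have orth_w1: "orthogonal \<mu> k w1"
        using w(1) pairing_add_scaled[of w1 0 c w \<mu>] w1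
        by (simp add: Y_def orthogonal_def pairing_def)
      have fixed: "twist_poly w1 = w1"
      proof (rule ccontr)
        assume ne: "twist_poly w1 \<noteq> w1"
        define z where "z = twist_poly w1 - w1"
        have lookup_z: "coef z n = coef (twist_poly w1) n + (- 1) * coef w1 n" for n
          by (simp add: z_def lookup_minus)
        have keys_z: "monomials z \<subseteq> monomials w - {j}"
        proof
          fix n assume n: "n \<in> monomials z"
          have "coef w1 n \<noteq> 0"
            using n by (auto simp: in_keys_iff lookup_z)
          moreover have "coef z j = 0"
            using c(2) by (simp add: lookup_z w1 twist_one)
          ultimately show "n \<in> monomials w - {j}"
            using n keys_w1 by (auto simp: in_keys_iff)
        qed
        have "orthogonal \<mu> k z"
          using descend[OF twist_homogeneous[OF hom_w1] twisted[OF orth_w1]] orth_w1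
            pairing_add_scaled[of z "twist_poly w1" "-1" w1 \<mu>, OF lookup_z]
          by (simp add: orthogonal_def)
        moreover have "homogeneous S k z"
          using keys_z w(1) by (auto simp: homogeneous_def Y_def)
        moreover have "z \<noteq> 0"
          using ne by (simp add: z_def)
        ultimately have "z \<in> Y"
          using keys_z w(1) by (auto simp: Y_def)
        hence "card (monomials w) \<le> card (monomials z)"
          by (rule w(2))
        moreover have "card (monomials z) < card (monomials w)"
          using keys_z j by (intro psubset_card_mono) auto
        ultimately show False
          by simp
      qed
      hence orth_\<nu>: "orthogonal ?\<nu> k w1"
        using twisted[OF orth_w1] by simp
      \<comment> \<open>\<open>w1\<close> removes the coefficient of \<open>u\<close> at \<open>j\<close> without enlarging the support\<close>
      define a where "a = coef u j"
      define v where "v = u - Poly_Mapping.map ((*) a) w1"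
      have lookup_v: "coef v n = coef u n + (- a) * coef w1 n" for n
        by (simp add: v_def lookup_minus Poly_Mapping.map.rep_eq when_def)
      have keys_wu: "monomials w1 \<subseteq> monomials u"
        using keys_w1 w(1) by (simp add: Y_def)
      have keys_v: "monomials v \<subseteq> monomials u - {j}"
      proof
        fix n assume n: "n \<in> monomials v"
        hence "n \<in> monomials u \<or> n \<in> monomials w1"
          by (auto simp: in_keys_iff lookup_v)
        moreover have "coef v j = 0"
          using c(2) by (simp add: lookup_v w1 a_def)
        ultimately show "n \<in> monomials u - {j}"
          using n keys_wu by (auto simp: in_keys_iff)
      qed
      have "card (monomials v) < card (monomials u)"
        using keys_v j keys_wu keys_w1 by (intro psubset_card_mono) auto
      moreover have "homogeneous S k v"
        using keys_v less.prems(1) by (auto simp: homogeneous_def)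
      moreover have "orthogonal \<mu> k v"
        using less.prems(2) orth_w1 pairing_add_scaled[of v u "-a" w1 \<mu>, OF lookup_v]
        by (simp add: orthogonal_def)
      ultimately have "orthogonal ?\<nu> k v"
        by (rule less.hyps)
      moreover have "coef u n = coef v n + a * coef w1 n" for n
        by (simp add: lookup_v)
      ultimately show ?thesis
        using orth_\<nu> pairing_add_scaled[of u v a w1 ?\<nu>] by (simp add: orthogonal_def)
    qed
  qed
qed

theorem square_zero_imp_orthogonal_square:
  assumes "\<And>F. twist (\<mu> F) = (\<mu> F)\<^sup>2" "2 * k \<le> d" "homogeneous S k u"
    and "\<And>P. set_mset P \<subseteq> S \<Longrightarrow> size P + 2 * k = d \<Longrightarrow> square_pairing (\<lambda>F. (\<mu> F)\<^sup>2) u P = 0"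
  shows "orthogonal (\<lambda>F. (\<mu> F)\<^sup>2) k u"
  by (rule orthogonal_square[OF assms(1-3) square_zero_imp_orthogonal[OF assms(3,2,4)]])

end

section \<open>Generic matrices over rational function fields\<close>

lemma poly_mapping_sum_single:
  "p = (\<Sum>n\<in>monomials p. monomial n (coef p n))"
proof (rule poly_mapping_eqI)
  fix k
  have "(\<Sum>n\<in>monomials p. coef (monomial n (coef p n)) k)
      = (\<Sum>n\<in>monomials p. if n = k then coef p k else 0)"
    by (intro sum.cong) (auto simp: lookup_single when_def)
  thus "coef p k = coef (\<Sum>n\<in>monomials p. monomial n (coef p n)) k"
    by (simp add: lookup_sum in_keys_iff)
qed

lemma poly_mapping_square:
  fixes p :: "'m::comm_monoid_add \<Rightarrow>\<^sub>0 'a::comm_ring_1"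
  assumes two: "(1::'a) + 1 = 0"
  shows "p\<^sup>2 = (\<Sum>n\<in>monomials p. monomial (n + n) ((coef p n)\<^sup>2))"
proof -
  have "(1::'m \<Rightarrow>\<^sub>0 'a) + 1 = monomial 0 (1 + 1)"
    by (simp only: single_add single_one)
  hence two': "(1::'m \<Rightarrow>\<^sub>0 'a) + 1 = 0"
    by (simp only: two single_zero)
  have "p\<^sup>2 = (\<Sum>n\<in>monomials p. (monomial n (coef p n))\<^sup>2)"
    by (subst poly_mapping_sum_single[of p]) (rule square_sum_char_two[OF two'])
  thus ?thesis
    by (simp add: power2_eq_square mult_single)
qed

text \<open>In characteristic two a square involves only even exponents. So the summands involve exponents in
  the distinct residue classes of the \<open>e I\<close> modulo two and cannot cancel.\<close>

lemma poly_square_independent: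
  fixes w :: "'i \<Rightarrow> ((nat \<Rightarrow>\<^sub>0 nat) \<Rightarrow>\<^sub>0 'a::field)" and e :: "'i \<Rightarrow> nat \<Rightarrow>\<^sub>0 nat"
  assumes two: "(1::'a) + 1 = 0" and B: "finite B"
    and e: "\<And>I x. I \<in> B \<Longrightarrow> coef (e I) x \<le> 1" and inj: "inj_on e B"
    and zero: "(\<Sum>I\<in>B. monomial (e I) 1 * (w I)\<^sup>2) = 0" and I: "I \<in> B"
  shows "w I = 0"
proof (rule poly_mapping_eqI)
  fix n
  have unique: "J = I \<and> m = n" if J: "J \<in> B" and eq: "e J + (m + m) = e I + (n + n)" for J m
  proof -
    have *: "coef (e J) x + 2 * coef m x = coef (e I) x + 2 * coef n x" for x
      using arg_cong[OF eq, of "\<lambda>p. coef p x"] by (simp add: lookup_add)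
    have le: "coef (e J) x \<le> 1" "coef (e I) x \<le> 1" for x
      using e J I by auto
    have **: "coef (e J) x = coef (e I) x \<and> coef m x = coef n x" for x
      using *[of x] le[of x] by presburger
    hence "e J = e I" "m = n"
      by (auto intro: poly_mapping_eqI)
    thus ?thesis
      using inj J I by (auto dest: inj_onD)
  qed
  have "0 = coef (\<Sum>J\<in>B. monomial (e J) 1 * (w J)\<^sup>2) (e I + (n + n))"
    by (simp add: zero)
  also have "\<dots> = (\<Sum>J\<in>B. \<Sum>m\<in>monomials (w J).
      coef (monomial (e J + (m + m)) ((coef (w J) m)\<^sup>2)) (e I + (n + n)))"
    by (simp add: lookup_sum poly_mapping_square[OF two] sum_distrib_left mult_single)
  also have "\<dots> = (\<Sum>J\<in>B. \<Sum>m\<in>monomials (w J). if J = I \<and> m = n then (coef (w I) n)\<^sup>2 else 0)"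
    using unique by (intro sum.cong refl) (auto simp: lookup_single when_def)
  also have "\<dots> = (\<Sum>J\<in>B. if J = I then (coef (w I) n)\<^sup>2 else 0)"
    by (intro sum.cong refl) (auto simp: in_keys_iff)
  also have "\<dots> = (coef (w I) n)\<^sup>2"
    using I B by simp
  finally show "coef (w I) n = coef 0 n"
    by simp
qed

lemma common_denominator:
  fixes w :: "'i \<Rightarrow> 'r::idom fract"
  assumes "finite B"
  obtains p q where "q \<noteq> 0" "\<And>I. I \<in> B \<Longrightarrow> w I = Fract (p I) q"
proof -
  have "\<exists>p q. q \<noteq> 0 \<and> (\<forall>I\<in>B. w I = Fract (p I) q)"
    using assms
  proof (induction B rule: finite_induct)
    case empty
    show ?case
      by (intro exI[of _ "\<lambda>_. 0"] exI[of _ 1]) simp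
  next
    case (insert J B)
    then obtain p q where pq: "q \<noteq> 0" "\<forall>I\<in>B. w I = Fract (p I) q"
      by blast
    obtain a b where ab: "w J = Fract a b" "b \<noteq> 0"
      by (cases "w J") auto
    define p' where "p' = (\<lambda>I. if I = J then a * q else p I * b)"
    have "w I = Fract (p' I) (q * b)" if "I \<in> insert J B" for I
    proof (cases "I = J")
      case True
      thus ?thesis
        using ab pq(1) by (simp add: p'_def eq_fract)
    next
      case False
      thus ?thesis
        using ab pq that by (simp add: p'_def eq_fract)
    qed
    thus ?case
      using pq(1) ab(2) by (intro exI[of _ p'] exI[of _ "q * b"]) auto
  qed
  thus thesis
    using that by blast
qed

definition fract_map :: "('r::idom \<Rightarrow> 'r) \<Rightarrow> 'r fract \<Rightarrow> 'r fract" where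
  "fract_map f x = (THE y. \<exists>p q. q \<noteq> 0 \<and> x = Fract p q \<and> y = Fract (f p) (f q))"

lemma fract_map_Fract:
  fixes f :: "'r::idom \<Rightarrow> 'r"
  assumes mult: "\<And>p q. f (p * q) = f p * f q" and nz: "\<And>p. p \<noteq> 0 \<Longrightarrow> f p \<noteq> 0" and q: "q \<noteq> 0"
  shows "fract_map f (Fract p q) = Fract (f p) (f q)"
  unfolding fract_map_def
proof (rule the_equality)
  show "\<exists>p' q'. q' \<noteq> 0 \<and> Fract p q = Fract p' q' \<and> Fract (f p) (f q) = Fract (f p') (f q')"
    using q by blast
  fix y assume "\<exists>p' q'. q' \<noteq> 0 \<and> Fract p q = Fract p' q' \<and> y = Fract (f p') (f q')"
  then obtain p' q' where *: "q' \<noteq> 0" "Fract p q = Fract p' q'" "y = Fract (f p') (f q')"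
    by blast
  have "p * q' = p' * q"
    using * q by (simp add: eq_fract)
  hence "f p * f q' = f p' * f q"
    by (simp only: mult[symmetric])
  thus "y = Fract (f p) (f q)"
    using * q nz by (simp add: eq_fract)
qed

definition frobenius_coeffs :: "('m \<Rightarrow>\<^sub>0 'a::comm_ring_1) \<Rightarrow> ('m \<Rightarrow>\<^sub>0 'a)" where
  "frobenius_coeffs p = Poly_Mapping.map (\<lambda>c. c\<^sup>2) p"

lemma lookup_frobenius_coeffs: "coef (frobenius_coeffs p) n = (coef p n)\<^sup>2"
  by (simp add: frobenius_coeffs_def Poly_Mapping.map.rep_eq when_def)

lemma frobenius_coeffs_single: "frobenius_coeffs (monomial n c) = monomial n (c\<^sup>2)"
  by (intro poly_mapping_eqI) (simp add: lookup_frobenius_coeffs lookup_single when_def)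

lemma frobenius_coeffs_add:
  fixes p :: "'m \<Rightarrow>\<^sub>0 'a::comm_ring_1"
  assumes two: "(1::'a) + 1 = 0"
  shows "frobenius_coeffs (p + q) = frobenius_coeffs p + frobenius_coeffs q"
proof (rule poly_mapping_eqI)
  have "(a + b)\<^sup>2 = a\<^sup>2 + b\<^sup>2" for a b :: 'a
    using square_sum_char_two[OF two, of "\<lambda>x. if x then a else b" UNIV] by (simp add: UNIV_bool add.commute)
  thus "coef (frobenius_coeffs (p + q)) k = coef (frobenius_coeffs p + frobenius_coeffs q) k" for k
    by (simp add: lookup_frobenius_coeffs lookup_add)
qed

lemma frobenius_coeffs_sum:
  fixes f :: "'b \<Rightarrow> 'm \<Rightarrow>\<^sub>0 'a::comm_ring_1"
  assumes two: "(1::'a) + 1 = 0"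
  shows "frobenius_coeffs (\<Sum>x\<in>B. f x) = (\<Sum>x\<in>B. frobenius_coeffs (f x))"
proof -
  have "frobenius_coeffs 0 = (0 :: 'm \<Rightarrow>\<^sub>0 'a)"
    by (intro poly_mapping_eqI) (simp add: lookup_frobenius_coeffs)
  thus ?thesis
    by (induction B rule: infinite_finite_induct) (auto simp: frobenius_coeffs_add[OF two])
qed

lemma frobenius_coeffs_mult:
  fixes p :: "'m::comm_monoid_add \<Rightarrow>\<^sub>0 'a::comm_ring_1"
  assumes two: "(1::'a) + 1 = 0"
  shows "frobenius_coeffs (p * q) = frobenius_coeffs p * frobenius_coeffs q"
proof -
  have "p * q = (\<Sum>m\<in>monomials p. \<Sum>n\<in>monomials q.
      monomial (m + n) (coef p m * coef q n))"
    by (subst poly_mapping_sum_single[of p], subst poly_mapping_sum_single[of q])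
      (simp add: sum_product mult_single)
  hence "frobenius_coeffs (p * q) = (\<Sum>m\<in>monomials p. \<Sum>n\<in>monomials q.
      frobenius_coeffs (monomial m (coef p m)) * frobenius_coeffs (monomial n (coef q n)))"
    by (simp add: frobenius_coeffs_sum[OF two] frobenius_coeffs_single mult_single power_mult_distrib)
  also have "\<dots> = frobenius_coeffs (\<Sum>m\<in>monomials p. monomial m (coef p m))
      * frobenius_coeffs (\<Sum>n\<in>monomials q. monomial n (coef q n))"
    by (simp add: frobenius_coeffs_sum[OF two] sum_product)
  finally show ?thesis
    by (simp only: poly_mapping_sum_single[symmetric])
qed

lemma frobenius_coeffs_nonzero: "p \<noteq> 0 \<Longrightarrow> frobenius_coeffs p \<noteq> (0 :: 'm \<Rightarrow>\<^sub>0 'a::field)"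
  by (auto simp: poly_mapping_eq_iff fun_eq_iff lookup_frobenius_coeffs)

definition ext_const :: "'a::field \<Rightarrow> 'a ext_carrier" where
  "ext_const c = Fract (monomial 0 c) 1"

definition ext_var :: "nat \<Rightarrow> 'a::field ext_carrier" where
  "ext_var j = Fract (monomial (monomial j 1) 1) 1"

definition ext_twist :: "'a::field ext_carrier \<Rightarrow> 'a ext_carrier" where
  "ext_twist = fract_map frobenius_coeffs"

lemma ext_const_add: "ext_const (a + b) = ext_const a + ext_const b"
  by (simp add: ext_const_def single_add)

lemma ext_const_mult: "ext_const (a * b) = ext_const a * ext_const b"
  by (simp add: ext_const_def mult_single)

lemma ext_const_one: "ext_const 1 = 1"
  by (simp add: ext_const_def One_fract_def)

lemma ext_const_zero [simp]: "ext_const 0 = 0"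
  by (simp add: ext_const_def Zero_fract_def)

lemma ext_const_eq_zero_iff [simp]:
  fixes a :: "'a::field"
  shows "ext_const a = 0 \<longleftrightarrow> a = 0"
proof -
  have "monomial 0 a = (0 :: (nat \<Rightarrow>\<^sub>0 nat) \<Rightarrow>\<^sub>0 'a) \<longleftrightarrow> a = 0"
    using inj_eq[OF inj_single, of "0 :: nat \<Rightarrow>\<^sub>0 nat" a 0] by (simp only: single_zero)
  thus ?thesis
    by (simp add: ext_const_def Zero_fract_def eq_fract)
qed

lemma ext_const_sum: "ext_const (\<Sum>x\<in>B. f x) = (\<Sum>x\<in>B. ext_const (f x))"
  by (induction B rule: infinite_finite_induct) (auto simp: ext_const_add)

lemma ext_char_two:
  assumes "(1::'a::field) + 1 = 0"
  shows "(1::'a ext_carrier) + 1 = 0"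
  using ext_const_add[of 1 "1::'a"] assms by (simp add: ext_const_one)

lemma ext_twist_Fract:
  fixes p :: "(nat \<Rightarrow>\<^sub>0 nat) \<Rightarrow>\<^sub>0 'a::field"
  assumes "(1::'a) + 1 = 0" "q \<noteq> 0"
  shows "ext_twist (Fract p q) = Fract (frobenius_coeffs p) (frobenius_coeffs q)"
  unfolding ext_twist_def using assms
  by (intro fract_map_Fract) (auto simp: frobenius_coeffs_mult frobenius_coeffs_nonzero)

definition generic_matrix :: "(nat \<times> 'v \<Rightarrow> nat) \<Rightarrow> nat \<Rightarrow> 'v \<Rightarrow> 'a::field ext_carrier" where
  "generic_matrix idx i v = ext_var (idx (i, v))"

lemma prod_ext_var:
  fixes n :: nat
  shows "(\<Prod>i<n. ext_var (f i)) = Fract (monomial (\<Sum>i<n. monomial (f i) 1) 1) 1"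
proof (induction n)
  case 0
  show ?case
    by (simp add: One_fract_def)
next
  case (Suc n)
  thus ?case
    by (simp add: ext_var_def mult_single)
qed

text \<open>After multiplication by the square of a common denominator this is a statement about polynomials.
  The exponents of the products of entries are zero or one, and they determine the choice \<open>I\<close>.\<close>

lemma generic_matrix_independent:
  fixes w :: "(nat \<Rightarrow> 'v) \<Rightarrow> 'a::field ext_carrier"
  assumes two: "(1::'a) + 1 = 0" and T: "finite T" and idx: "inj_on idx ({..<d} \<times> T)"
    and zero: "(\<Sum>I\<in>{..<d} \<rightarrow>\<^sub>E T. (\<Prod>i<d. generic_matrix idx i (I i)) * (w I)\<^sup>2) = 0"
    and I: "I \<in> {..<d} \<rightarrow>\<^sub>E T"
  shows "w I = 0"
proof -
  let ?B = "{..<d} \<rightarrow>\<^sub>E T"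
  have fin: "finite ?B"
    using T by (simp add: finite_PiE)
  define e where "e J = (\<Sum>i<d. monomial (idx (i, J i)) (1::nat))" for J
  have lookup_e: "coef (e J) x = card {i. i < d \<and> idx (i, J i) = x}" for J x
    by (simp add: e_def lookup_sum lookup_single when_def sum.If_cases Int_def conj_commute)
  have e_le: "coef (e J) x \<le> 1" if J: "J \<in> ?B" for J x
  proof -
    have "i = j" if "i < d" "j < d" "idx (i, J i) = idx (j, J j)" for i j
      using inj_onD[OF idx that(3)] that J by auto
    hence "card {i. i < d \<and> idx (i, J i) = x} \<le> Suc 0"
      by (subst card_le_Suc0_iff_eq) auto
    thus ?thesis
      by (simp add: lookup_e)
  qed
  have inj: "inj_on e ?B"
  proof (rule inj_onI)
    fix J J' assume J: "J \<in> ?B" and J': "J' \<in> ?B" and eq: "e J = e J'"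
    have "J i = J' i" if i: "i < d" for i
    proof -
      have "i \<in> {j. j < d \<and> idx (j, J j) = idx (i, J i)}"
        using i by simp
      hence "card {j. j < d \<and> idx (j, J j) = idx (i, J i)} \<noteq> 0"
        by (subst card_eq_0_iff) auto
      hence "card {j. j < d \<and> idx (j, J' j) = idx (i, J i)} \<noteq> 0"
        using eq by (simp flip: lookup_e)
      hence "{j. j < d \<and> idx (j, J' j) = idx (i, J i)} \<noteq> {}"
        by (metis card.empty)
      then obtain j where j: "j < d" "idx (j, J' j) = idx (i, J i)"
        by auto
      hence "(j, J' j) = (i, J i)"
        using i J J' by (intro inj_onD[OF idx]) auto
      thus ?thesis
        by auto
    qed
    thus "J = J'"
      using J J' by (intro PiE_ext) auto
  qed
  obtain p q where pq: "q \<noteq> 0" "\<And>I. I \<in> ?B \<Longrightarrow> w I = Fract (p I) q"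
    using common_denominator[OF fin, of w] by blast
  have sum_Fract: "(\<Sum>J\<in>C. Fract (f J) r) = Fract (\<Sum>J\<in>C. f J) r"
    if "r \<noteq> 0" for C :: "(nat \<Rightarrow> 'v) set" and f and r :: "(nat \<Rightarrow>\<^sub>0 nat) \<Rightarrow>\<^sub>0 'a"
    using that
  proof (induction C rule: infinite_finite_induct)
    case (insert J C)
    thus ?case
      by (simp add: eq_fract algebra_simps)
  qed (simp_all add: Zero_fract_def eq_fract)
  have "(\<Sum>I\<in>?B. (\<Prod>i<d. generic_matrix idx i (I i)) * (w I)\<^sup>2)
      = (\<Sum>I\<in>?B. Fract (monomial (e I) 1 * (p I)\<^sup>2) (q\<^sup>2))"
    by (intro sum.cong refl) (simp add: generic_matrix_def prod_ext_var e_def pq(2) power2_eq_square)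
  also have "\<dots> = Fract (\<Sum>I\<in>?B. monomial (e I) 1 * (p I)\<^sup>2) (q\<^sup>2)"
    using pq(1) by (intro sum_Fract) simp
  finally have numerator: "(\<Sum>I\<in>?B. monomial (e I) 1 * (p I)\<^sup>2) = 0"
    using zero pq(1) by (simp add: Zero_fract_def eq_fract)
  have "p I = 0"
    by (rule poly_square_independent[OF two fin _ inj numerator I]) (rule e_le)
  thus ?thesis
    using pq I by (simp add: Zero_fract_def eq_fract)
qed

text \<open>The minors do not vanish because they are sums of distinct products \<open>\<Prod>i<d. V i (I i)\<close>, which are
  linearly independent.\<close>

lemma generic_matrix_configuration:
  fixes S :: "'v set"
  assumes two: "(1::'a::field) + 1 = 0" and S: "finite S" "d \<le> card S" "d > 0 \<Longrightarrow> apex \<in> S"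
    and idx: "inj_on idx ({..<d} \<times> insert apex S)"
  shows "generic_configuration (generic_matrix idx :: nat \<Rightarrow> 'v \<Rightarrow> 'a ext_carrier) d S apex ext_twist"
proof
  let ?V = "generic_matrix idx :: nat \<Rightarrow> 'v \<Rightarrow> 'a ext_carrier"
  have fin: "finite (insert apex S)"
    using S by simp
  show independent: "w I = 0"
    if "(\<Sum>I\<in>{..<d} \<rightarrow>\<^sub>E insert apex S. (\<Prod>i<d. ?V i (I i)) * (w I)\<^sup>2) = 0" "I \<in> {..<d} \<rightarrow>\<^sub>E insert apex S"
    for w I
    using generic_matrix_independent[OF two fin idx that] .
  show "permanent ?V d F \<noteq> 0" if F: "F \<subseteq> insert apex S" "card F = d" for F
  proof
    assume zero: "permanent ?V d F = 0"
    have "finite F"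
      using F fin by (auto intro: finite_subset)
    then obtain h where h: "bij_betw h {..<d} F"
      using F(2) by (metis bij_betw_iff_card finite_lessThan card_lessThan)
    have I: "restrict h {..<d} \<in> bijections d F"
      using h by (auto simp: bijections_def bij_betw_def inj_on_def)
    define w where "w J = (if J \<in> bijections d F then 1 else 0 :: 'a ext_carrier)" for J
    have sub: "bijections d F \<subseteq> {..<d} \<rightarrow>\<^sub>E insert apex S"
      using F(1) by (auto simp: bijections_def PiE_def)
    have "(\<Sum>J\<in>{..<d} \<rightarrow>\<^sub>E insert apex S. (\<Prod>i<d. ?V i (J i)) * (w J)\<^sup>2) = permanent ?V d F"
      unfolding permanent_def using fin sub
      by (intro sum.mono_neutral_cong_right) (auto simp: w_def finite_PiE)
    hence "w (restrict h {..<d}) = 0"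
      unfolding zero by (rule independent) (rule subsetD[OF sub I])
    thus False
      using I by (simp add: w_def)
  qed
  show "(1::'a ext_carrier) + 1 = 0"
    by (rule ext_char_two[OF two])
  show "ext_twist (x + y) = ext_twist x + ext_twist y" for x y :: "'a ext_carrier"
  proof -
    obtain a b where x: "x = Fract a b" "b \<noteq> 0"
      by (cases x) auto
    obtain a' b' where y: "y = Fract a' b'" "b' \<noteq> 0"
      by (cases y) auto
    show ?thesis
      using x y by (simp add: ext_twist_Fract[OF two] frobenius_coeffs_nonzero frobenius_coeffs_add[OF two] frobenius_coeffs_mult[OF two])
  qed
  show "ext_twist (x * y) = ext_twist x * ext_twist y" for x y :: "'a ext_carrier"
  proof -
    obtain a b where x: "x = Fract a b" "b \<noteq> 0"
      by (cases x) auto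
    obtain a' b' where y: "y = Fract a' b'" "b' \<noteq> 0"
      by (cases y) auto
    show ?thesis
      using x y by (simp add: ext_twist_Fract[OF two] frobenius_coeffs_mult[OF two])
  qed
  have one: "frobenius_coeffs (1 :: (nat \<Rightarrow>\<^sub>0 nat) \<Rightarrow>\<^sub>0 'a) = 1"
    using frobenius_coeffs_single[of 0 "1::'a"] by simp
  show "ext_twist (1 :: 'a ext_carrier) = 1"
    by (simp add: One_fract_def ext_twist_Fract[OF two] one)
  show "ext_twist (?V i v) = ?V i v" for i v
    by (simp add: generic_matrix_def ext_var_def ext_twist_Fract[OF two] one frobenius_coeffs_single)
qed (use S in auto)

lemma ext_twist_const:
  assumes two: "(1::'a::field) + 1 = 0"
  shows "ext_twist (ext_const (c::'a)) = (ext_const c)\<^sup>2"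
proof -
  have one: "frobenius_coeffs (1 :: (nat \<Rightarrow>\<^sub>0 nat) \<Rightarrow>\<^sub>0 'a) = 1"
    using frobenius_coeffs_single[of 0 "1::'a"] by simp
  show ?thesis
    by (simp add: ext_const_def ext_twist_Fract[OF two] one frobenius_coeffs_single power2_eq_square mult_single)
qed

section \<open>Polynomial rings as rings of finitely supported functions\<close>

abbreviation type_ring :: "'k::field ring" where
  "type_ring \<equiv> ring_of_type_algebra"

lemma type_ring_simps [simp]:
  "carrier (type_ring :: 'k::field ring) = UNIV"
  "x \<otimes>\<^bsub>type_ring\<^esub> y = (x::'k) * y"
  "\<one>\<^bsub>type_ring\<^esub> = (1::'k)"
  "\<zero>\<^bsub>type_ring\<^esub> = (0::'k)"
  "x \<oplus>\<^bsub>type_ring\<^esub> y = x + y"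
  by (simp_all add: ring_of_type_algebra_def)

lemma type_ring_uminus [simp]: "\<ominus>\<^bsub>type_ring\<^esub> (x::'k::field) = - x"
proof -
  interpret ring "type_ring :: 'k ring"
    by (rule ring_from_type_algebra)
  show ?thesis
    by (rule minus_equality) simp_all
qed

lemma type_ring_inv [simp]:
  assumes "x \<noteq> 0"
  shows "inv\<^bsub>type_ring\<^esub> (x::'k::field) = inverse x"
proof -
  interpret cring "type_ring :: 'k ring"
    by (rule cring_from_type_algebra)
  show ?thesis
    using assms by (intro comm_inv_char) simp_all
qed

lemma type_ring_pow [simp]: "x [^]\<^bsub>type_ring\<^esub> (n::nat) = (x::'k::field) ^ n"
proof -
  interpret monoid "type_ring :: 'k ring"
    by (rule ring.axioms(2)[OF ring_from_type_algebra])
  show ?thesis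
    by (induction n) (simp_all add: mult.commute)
qed

lemma type_ring_finsum [simp]:
  "finsum (type_ring :: 'k::field ring) f A = sum f A"
proof -
  interpret ring "type_ring :: 'k ring"
    by (rule ring_from_type_algebra)
  show ?thesis
    by (induction A rule: infinite_finite_induct) (simp_all add: finsum_infinite)
qed

lemma type_ring_finprod [simp]:
  "finprod (type_ring :: 'k::field ring) f A = prod f A"
proof -
  interpret cring "type_ring :: 'k ring"
    by (rule cring_from_type_algebra)
  show ?thesis
    by (induction A rule: infinite_finite_induct) (simp_all add: finprod_infinite)
qed

lemma indexed_const_eq: "ring.indexed_const type_ring c = coef (monomial {#} c)"
  by (auto simp: ring.indexed_const_def[OF ring_from_type_algebra] fun_eq_iff lookup_single when_def)

lemma indexed_padd_eq:
  "ring.indexed_padd type_ring (coef p) (coef q) = coef (p + q)"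
  by (auto simp: ring.indexed_padd_def[OF ring_from_type_algebra] fun_eq_iff lookup_add)

lemma lookup_times_monomial:
  fixes p :: "'v multiset \<Rightarrow>\<^sub>0 'k::field"
  shows "coef (monomial a c * p) m
    = (if a \<subseteq># m then c * coef p (m - a) else 0)"
proof -
  have "coef (monomial a c * p) m
      = coef (\<Sum>n\<in>monomials p. monomial (a + n) (c * coef p n)) m"
    by (subst poly_mapping_sum_single[of p]) (simp add: sum_distrib_left mult_single)
  also have "\<dots> = (\<Sum>n\<in>monomials p. if n = m - a \<and> a \<subseteq># m then c * coef p (m - a) else 0)"
    unfolding lookup_sum by (intro sum.cong refl) (auto simp: lookup_single when_def)
  also have "\<dots> = (if a \<subseteq># m then c * coef p (m - a) else 0)"
    by (auto simp: in_keys_iff)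
  finally show ?thesis .
qed

lemma indexed_pmult_eq:
  "ring.indexed_pmult type_ring (coef p) v = coef (monomial {#v#} 1 * p)"
  by (auto simp: ring.indexed_pmult_def[OF ring_from_type_algebra] fun_eq_iff lookup_times_monomial)

lemma indexed_var_eq: "ring.indexed_var type_ring v = coef (monomial {#v#} 1)"
  by (simp add: ring.indexed_var_def[OF ring_from_type_algebra] indexed_const_eq indexed_pmult_eq mult_single)

definition supported :: "'v set \<Rightarrow> ('v multiset \<Rightarrow>\<^sub>0 'k::zero) \<Rightarrow> bool" where
  "supported S p \<longleftrightarrow> (\<forall>n\<in>monomials p. set_mset n \<subseteq> S)"

lemma supported_0 [simp]: "supported S 0"
  by (simp add: supported_def)

lemma supported_single: "set_mset n \<subseteq> S \<Longrightarrow> supported S (monomial n c)"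
  by (simp add: supported_def)

lemma supported_1 [simp]: "supported S 1"
  by (simp add: supported_def)

lemma supported_add: "supported S p \<Longrightarrow> supported S q \<Longrightarrow> supported S (p + q)"
  using keys_add[of p q] by (auto simp: supported_def)

lemma supported_uminus: "supported S p \<Longrightarrow> supported S (- p :: 'v multiset \<Rightarrow>\<^sub>0 'k::field)"
  by (auto simp: supported_def in_keys_iff)

lemma supported_mult: "supported S p \<Longrightarrow> supported S q \<Longrightarrow> supported S (p * q :: 'v multiset \<Rightarrow>\<^sub>0 'k::field)"
  using keys_mult[of p q] by (fastforce simp: supported_def)

lemma supported_sum: "(\<And>x. x \<in> A \<Longrightarrow> supported S (f x)) \<Longrightarrow> supported S (\<Sum>x\<in>A. f x)"
  by (induction A rule: infinite_finite_induct) (auto intro: supported_add)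

lemma carrier_mpoly_ring: "carrier (mpoly_ring type_ring S) = coef ` {p :: 'v multiset \<Rightarrow>\<^sub>0 'k::field. supported S p}"
proof (intro equalityI subsetI)
  interpret ring "type_ring :: 'k ring"
    by (rule ring_from_type_algebra)
  fix P assume "P \<in> carrier (mpoly_ring (type_ring :: 'k ring) S)"
  hence "P \<in> indexed_pset S UNIV"
    by (simp add: mpoly_ring_def)
  thus "P \<in> coef ` {p. supported S p}"
  proof induction
    case (indexed_const c)
    show ?case
      unfolding indexed_const_eq by (intro imageI CollectI supported_single) simp
  next
    case (indexed_padd P Q)
    then obtain p q where "P = coef p" "Q = coef q" "supported S p" "supported S q"
      by auto
    thus ?case
      by (simp only: indexed_padd_eq) (intro imageI CollectI supported_add)
  next
    case (indexed_pmult P v)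
    then obtain p where "P = coef p" "supported S p"
      by auto
    thus ?case
      using indexed_pmult by (simp only: indexed_pmult_eq) (intro imageI CollectI supported_mult supported_single, auto)
  qed
next
  interpret ring "type_ring :: 'k ring"
    by (rule ring_from_type_algebra)
  have mono: "coef (monomial n (c::'k)) \<in> indexed_pset S UNIV" if "set_mset n \<subseteq> S" for n c
    using that
  proof (induction n)
    case empty
    show ?case
      unfolding indexed_const_eq[symmetric] by (rule indexed_pset.indexed_const) simp
  next
    case (add v n)
    hence "indexed_pmult (coef (monomial n c)) v \<in> indexed_pset S UNIV"
      by (intro indexed_pset.indexed_pmult) auto
    thus ?case
      by (simp add: indexed_pmult_eq mult_single)
  qed
  fix P assume "P \<in> coef ` {p :: 'v multiset \<Rightarrow>\<^sub>0 'k. supported S p}"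
  then obtain p :: "'v multiset \<Rightarrow>\<^sub>0 'k" where p: "P = coef p" "supported S p"
    by auto
  have "coef (\<Sum>n\<in>A. monomial n (coef p n)) \<in> indexed_pset S UNIV"
    if "finite A" "A \<subseteq> monomials p" for A
    using that
  proof (induction A rule: finite_induct)
    case empty
    show ?case
      using mono[of "{#}" 0] by (simp only: sum.empty single_zero set_mset_empty empty_subsetI)
  next
    case (insert n A)
    hence "indexed_padd (coef (monomial n (coef p n)))
        (coef (\<Sum>n\<in>A. monomial n (coef p n))) \<in> indexed_pset S UNIV"
      using p(2) by (intro indexed_pset.indexed_padd mono) (auto simp: supported_def)
    thus ?case
      using insert.hyps by (simp add: indexed_padd_eq)
  qed
  from this[of "monomials p"] show "P \<in> carrier (mpoly_ring (type_ring :: 'k ring) S)"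
    by (simp add: p mpoly_ring_def flip: poly_mapping_sum_single)
qed

lemma finite_submultisets: "finite {a. a \<subseteq># (m::'v multiset)}"
proof (induction m)
  case (add v m)
  have "{a. a \<subseteq># add_mset v m} \<subseteq> {a. a \<subseteq># m} \<union> add_mset v ` {a. a \<subseteq># m}"
  proof
    fix a assume a: "a \<in> {a. a \<subseteq># add_mset v m}"
    show "a \<in> {a. a \<subseteq># m} \<union> add_mset v ` {a. a \<subseteq># m}"
    proof (cases "v \<in># a")
      case True
      then obtain b where "a = add_mset v b"
        by (metis insert_DiffM)
      thus ?thesis
        using a by auto
    next
      case False
      have "count a w \<le> count m w" for w
      proof (cases "w = v")
        case True
        thus ?thesis
          using False by (simp add: not_in_iff)
      next
        case False
        have "count a w \<le> count (add_mset v m) w"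
          using a by (intro mset_subset_eq_count) simp
        thus ?thesis
          using False by simp
      qed
      hence "a \<subseteq># m"
        by (rule mset_subset_eqI)
      thus ?thesis
        by simp
    qed
  qed
  thus ?case
    using add by (auto intro: finite_subset)
qed simp

lemma mpoly_ring_lookup [simp]:
  fixes p q :: "'v multiset \<Rightarrow>\<^sub>0 'k::field"
  shows "coef p \<otimes>\<^bsub>mpoly_ring type_ring S\<^esub> coef q = coef (p * q)"
    and "coef p \<oplus>\<^bsub>mpoly_ring type_ring S\<^esub> coef q = coef (p + q)"
    and "\<one>\<^bsub>mpoly_ring type_ring S\<^esub> = coef (1 :: 'v multiset \<Rightarrow>\<^sub>0 'k)"
    and "\<zero>\<^bsub>mpoly_ring type_ring S\<^esub> = coef (0 :: 'v multiset \<Rightarrow>\<^sub>0 'k)"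
proof -
  show "coef p \<otimes>\<^bsub>mpoly_ring type_ring S\<^esub> coef q = coef (p * q)"
  proof
    fix m
    have "coef (p * q) m = coef (\<Sum>a\<in>monomials p. monomial a (coef p a) * q) m"
      by (subst poly_mapping_sum_single[of p]) (simp add: sum_distrib_right)
    also have "\<dots> = (\<Sum>a\<in>monomials p. if a \<subseteq># m then coef p a * coef q (m - a) else 0)"
      by (simp add: lookup_sum lookup_times_monomial)
    also have "\<dots> = (\<Sum>a\<in>{a \<in> monomials p. a \<subseteq># m}. coef p a * coef q (m - a))"
      by (rule sum.inter_filter[symmetric]) simp
    also have "\<dots> = (\<Sum>a\<in>{a. a \<subseteq># m}. coef p a * coef q (m - a))"
      using finite_submultisets[of m] by (intro sum.mono_neutral_left) (auto simp: in_keys_iff)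
    finally show "(coef p \<otimes>\<^bsub>mpoly_ring type_ring S\<^esub> coef q) m = coef (p * q) m"
      by (simp add: mpoly_ring_def)
  qed
qed (simp_all add: mpoly_ring_def indexed_padd_eq indexed_const_eq)

lemma lookup_in_mpoly_ring [simp]:
  "coef p \<in> carrier (mpoly_ring type_ring S) \<longleftrightarrow> supported S (p :: 'v multiset \<Rightarrow>\<^sub>0 'k::field)"
  by (auto simp: carrier_mpoly_ring image_iff)

lemma mpoly_ringE:
  assumes "P \<in> carrier (mpoly_ring (type_ring :: 'k::field ring) S)"
  obtains p where "P = coef p" "supported S p"
  using assms by (auto simp: carrier_mpoly_ring)

text \<open>The axioms are inherited from the ring of finitely supported functions.\<close>

lemma cring_mpoly_ring: "cring (mpoly_ring (type_ring :: 'k::field ring) S)"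
proof (rule cringI)
  let ?M = "mpoly_ring (type_ring :: 'k ring) S"
  show "abelian_group ?M"
  proof (rule abelian_groupI)
    fix P Q assume "P \<in> carrier ?M" "Q \<in> carrier ?M"
    thus "P \<oplus>\<^bsub>?M\<^esub> Q \<in> carrier ?M" "P \<oplus>\<^bsub>?M\<^esub> Q = Q \<oplus>\<^bsub>?M\<^esub> P"
      by (auto elim!: mpoly_ringE simp: supported_add add.commute)
  next
    fix P Q T assume "P \<in> carrier ?M" "Q \<in> carrier ?M" "T \<in> carrier ?M"
    thus "P \<oplus>\<^bsub>?M\<^esub> Q \<oplus>\<^bsub>?M\<^esub> T = P \<oplus>\<^bsub>?M\<^esub> (Q \<oplus>\<^bsub>?M\<^esub> T)"
      by (auto elim!: mpoly_ringE simp: add.assoc)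
  next
    fix P assume P: "P \<in> carrier ?M"
    then obtain p where p: "P = coef p" "supported S p"
      by (rule mpoly_ringE)
    show "\<zero>\<^bsub>?M\<^esub> \<oplus>\<^bsub>?M\<^esub> P = P"
      by (simp add: p)
    show "\<exists>Q\<in>carrier ?M. Q \<oplus>\<^bsub>?M\<^esub> P = \<zero>\<^bsub>?M\<^esub>"
      using p by (intro bexI[of _ "coef (- p)"]) (simp_all add: supported_uminus)
  qed simp
  show "comm_monoid ?M"
  proof (rule comm_monoidI)
    fix P Q assume "P \<in> carrier ?M" "Q \<in> carrier ?M"
    thus "P \<otimes>\<^bsub>?M\<^esub> Q \<in> carrier ?M" "P \<otimes>\<^bsub>?M\<^esub> Q = Q \<otimes>\<^bsub>?M\<^esub> P"
      by (auto elim!: mpoly_ringE simp: supported_mult mult.commute)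
  next
    fix P Q T assume "P \<in> carrier ?M" "Q \<in> carrier ?M" "T \<in> carrier ?M"
    thus "P \<otimes>\<^bsub>?M\<^esub> Q \<otimes>\<^bsub>?M\<^esub> T = P \<otimes>\<^bsub>?M\<^esub> (Q \<otimes>\<^bsub>?M\<^esub> T)"
      by (auto elim!: mpoly_ringE simp: mult.assoc)
  next
    fix P assume "P \<in> carrier ?M"
    thus "\<one>\<^bsub>?M\<^esub> \<otimes>\<^bsub>?M\<^esub> P = P"
      by (auto elim!: mpoly_ringE)
  qed simp
  fix P Q T assume "P \<in> carrier ?M" "Q \<in> carrier ?M" "T \<in> carrier ?M"
  thus "(P \<oplus>\<^bsub>?M\<^esub> Q) \<otimes>\<^bsub>?M\<^esub> T = P \<otimes>\<^bsub>?M\<^esub> T \<oplus>\<^bsub>?M\<^esub> Q \<otimes>\<^bsub>?M\<^esub> T"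
    by (auto elim!: mpoly_ringE simp: distrib_right)
qed

lemma squarefree_monomial_eq:
  assumes "finite F" "F \<subseteq> S"
  shows "squarefree_monomial (type_ring :: 'k::field ring) S F = coef (monomial (mset_set F) 1)"
  unfolding squarefree_monomial_def indexed_var_eq using assms
proof (induction F rule: finite_induct)
  interpret cring "mpoly_ring (type_ring :: 'k ring) S"
    by (rule cring_mpoly_ring)
  case empty
  show ?case
    by simp
next
  interpret cring "mpoly_ring (type_ring :: 'k ring) S"
    by (rule cring_mpoly_ring)
  let ?x = "\<lambda>v. coef (monomial {#v#} (1::'k))"
  case (insert v F)
  hence "finprod (mpoly_ring (type_ring :: 'k ring) S) ?x (insert v F)
      = ?x v \<otimes>\<^bsub>mpoly_ring type_ring S\<^esub> finprod (mpoly_ring (type_ring :: 'k ring) S) ?x F"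
    by (intro finprod_insert) (auto simp: supported_single)
  thus ?case
    using insert by (simp add: mult_single)
qed

section \<open>Artinian reductions as quotients of polynomial rings\<close>

locale face_algebra =
  fixes \<Delta> :: "'v::linorder set set" and d :: nat and V :: "nat \<Rightarrow> 'v \<Rightarrow> 'k::field"
  assumes complex: "simplicial_complex \<Delta>"
begin

abbreviation vs where
  "vs \<equiv> vertices \<Delta>"

abbreviation PR where
  "PR \<equiv> mpoly_ring (type_ring :: 'k ring) vs"

abbreviation FR where
  "FR \<equiv> face_ring (type_ring :: 'k ring) \<Delta>"

abbreviation AR where
  "AR \<equiv> art_ring (type_ring :: 'k ring) \<Delta> d V"

abbreviation fcls where
  "fcls \<equiv> face_class (type_ring :: 'k ring) \<Delta>"

abbreviation PI where
  "PI \<equiv> parameter_ideal (type_ring :: 'k ring) \<Delta> d V"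

abbreviation graded_piece where
  "graded_piece \<equiv> art_piece (type_ring :: 'k ring) \<Delta> d V"

definition cls :: "('v multiset \<Rightarrow>\<^sub>0 'k) \<Rightarrow> ('v multiset \<Rightarrow> 'k) set set" where
  "cls p = art_class type_ring \<Delta> d V (coef p)"

lemma finite_vertices: "finite vs"
proof -
  have "finite \<Delta>" "\<And>F. F \<in> \<Delta> \<Longrightarrow> finite F"
    using complex by (auto simp: simplicial_complex_def)
  moreover have "vs \<subseteq> \<Union>\<Delta>"
    by (auto simp: vertices_def)
  ultimately show ?thesis
    by (auto intro: finite_subset)
qed

lemma face_subset: "F \<in> \<Delta> \<Longrightarrow> F \<subseteq> vs"
  using complex by (auto simp: simplicial_complex_def vertices_def)

lemma face_down: "F \<in> \<Delta> \<Longrightarrow> G \<subseteq> F \<Longrightarrow> G \<in> \<Delta>"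
  using complex by (auto simp: simplicial_complex_def)

sublocale M: cring PR
  by (rule cring_mpoly_ring)

definition nonface_monomials :: "('v multiset \<Rightarrow> 'k) set" where
  "nonface_monomials = {squarefree_monomial type_ring vs F | F. F \<subseteq> vs \<and> F \<notin> \<Delta>}"

lemma squarefree_monomial_vertices:
  assumes "F \<subseteq> vs"
  shows "squarefree_monomial type_ring vs F = coef (monomial (mset_set F) (1::'k))"
    and "supported vs (monomial (mset_set F) (1::'k))"
proof -
  have "finite F"
    using assms finite_vertices by (rule finite_subset)
  thus "squarefree_monomial type_ring vs F = coef (monomial (mset_set F) (1::'k))"
    and "supported vs (monomial (mset_set F) (1::'k))"
    using assms by (simp_all add: squarefree_monomial_eq supported_single)
qed

lemma nonface_monomials_carrier: "nonface_monomials \<subseteq> carrier PR"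
  unfolding nonface_monomials_def using squarefree_monomial_vertices by auto

lemma face_ideal_eq: "face_ideal type_ring \<Delta> = genideal PR nonface_monomials"
  by (simp add: face_ideal_def nonface_monomials_def)

sublocale I: ideal "face_ideal (type_ring :: 'k ring) \<Delta>" PR
  unfolding face_ideal_eq by (rule M.genideal_ideal[OF nonface_monomials_carrier])

sublocale FR: cring FR
  unfolding face_ring_def by (rule I.quotient_is_cring[OF M.is_cring])

lemma face_class_hom: "ring_hom_cring PR FR fcls"
  using I.rcos_ring_hom_cring[OF M.is_cring] by (simp add: face_ring_def face_class_def[abs_def])

sublocale face: ring_hom_cring PR FR "fcls"
  by (rule face_class_hom)

definition lform :: "('v \<Rightarrow> 'k) \<Rightarrow> 'v multiset \<Rightarrow>\<^sub>0 'k" where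
  "lform c = (\<Sum>v\<in>vs. monomial {#v#} (c v))"

lemma supported_lform: "supported vs (lform c)"
  unfolding lform_def by (intro supported_sum supported_single) auto

lemma finsum_M:
  assumes "finite B" "\<And>b. b \<in> B \<Longrightarrow> supported vs (f b)"
  shows "finsum PR (\<lambda>b. coef (f b)) B = coef (sum f B)"
  using assms
proof (induction B rule: finite_induct)
  case (insert b B)
  hence "finsum PR (\<lambda>b. coef (f b)) (insert b B)
      = coef (f b) \<oplus>\<^bsub>PR\<^esub> finsum PR (\<lambda>b. coef (f b)) B"
    by (intro M.finsum_insert) auto
  thus ?case
    using insert by simp
qed simp

lemma linear_form_eq: "linear_form type_ring \<Delta> c = fcls (coef (lform c))"
proof -
  let ?p = "\<lambda>v. monomial {#v#} (c v)"
  have supp: "supported vs (?p v)" if "v \<in> vs" for v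
    using that by (intro supported_single) auto
  have "linear_form type_ring \<Delta> c = finsum FR (\<lambda>v. fcls (coef (?p v))) vs"
    unfolding linear_form_def
  proof (rule FR.finsum_cong')
    fix v assume v: "v \<in> vs"
    have "fcls (coef (monomial {#} (c v)))
        \<otimes>\<^bsub>FR\<^esub> fcls (coef (monomial {#v#} 1))
      = fcls (coef (monomial {#} (c v)) \<otimes>\<^bsub>PR\<^esub> coef (monomial {#v#} 1))"
      using v by (intro face.hom_mult[symmetric]) (simp_all add: supported_single)
    thus "fcls (ring.indexed_const type_ring (c v)) \<otimes>\<^bsub>FR\<^esub>
        fcls (ring.indexed_var type_ring v) = fcls (coef (?p v))"
      by (simp add: indexed_const_eq indexed_var_eq mult_single)
  qed (use supp in auto)
  also have "\<dots> = fcls (finsum PR (\<lambda>v. coef (?p v)) vs)"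
    using face.hom_finsum[of "\<lambda>v. coef (?p v)" "vs"] supp by (simp add: comp_def Pi_iff)
  also have "finsum PR (\<lambda>v. coef (?p v)) vs = coef (lform c)"
    unfolding lform_def by (rule finsum_M[OF finite_vertices supp])
  finally show ?thesis .
qed

lemma linear_forms_carrier: "{linear_form type_ring \<Delta> (V i) | i. i < d} \<subseteq> carrier FR"
  using supported_lform by (auto simp: linear_form_eq)

sublocale J: ideal "PI" FR
  unfolding parameter_ideal_def by (rule FR.genideal_ideal[OF linear_forms_carrier])

sublocale A: cring AR
  unfolding art_ring_def by (rule J.quotient_is_cring[OF FR.is_cring])

lemma art_class_hom: "ring_hom_cring PR AR (art_class (type_ring :: 'k ring) \<Delta> d V)"
proof -
  have "(\<lambda>x. PI +>\<^bsub>FR\<^esub> x) \<circ> fcls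
      \<in> ring_hom PR AR"
    unfolding art_ring_def by (rule ring_hom_trans[OF face.homh J.rcos_ring_hom])
  hence "art_class (type_ring :: 'k ring) \<Delta> d V \<in> ring_hom PR AR"
    by (simp add: art_class_def[abs_def] comp_def)
  thus ?thesis
    by (intro ring_hom_cringI ring_hom_ringI2 M.is_cring A.is_cring M.ring_axioms A.ring_axioms)
qed

sublocale art: ring_hom_cring PR AR "art_class (type_ring :: 'k ring) \<Delta> d V"
  by (rule art_class_hom)

lemma cls_closed [simp]: "supported vs p \<Longrightarrow> cls p \<in> carrier AR"
  by (simp add: cls_def)

lemma cls_add: "supported vs p \<Longrightarrow> supported vs q \<Longrightarrow> cls (p + q) = cls p \<oplus>\<^bsub>AR\<^esub> cls q"
  using art.hom_add[of "coef p" "coef q"] by (simp add: cls_def)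

lemma cls_mult: "supported vs p \<Longrightarrow> supported vs q \<Longrightarrow> cls (p * q) = cls p \<otimes>\<^bsub>AR\<^esub> cls q"
  using art.hom_mult[of "coef p" "coef q"] by (simp add: cls_def)

lemma cls_0 [simp]: "cls 0 = \<zero>\<^bsub>AR\<^esub>"
  using art.hom_zero by (simp add: cls_def)

lemma cls_1 [simp]: "cls 1 = \<one>\<^bsub>AR\<^esub>"
  using art.hom_one by (simp add: cls_def)

lemma cls_uminus: "supported vs p \<Longrightarrow> cls (- p) = \<ominus>\<^bsub>AR\<^esub> cls p"
  using cls_add[of "- p" p] by (intro A.minus_equality[symmetric]) (simp_all add: supported_uminus)

lemma cls_sum:
  assumes "finite B" "\<And>b. b \<in> B \<Longrightarrow> supported vs (f b)"
  shows "cls (sum f B) = finsum AR (\<lambda>b. cls (f b)) B"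
  using assms
proof (induction B rule: finite_induct)
  case (insert b B)
  hence "finsum AR (\<lambda>b. cls (f b)) (insert b B) = cls (f b) \<oplus>\<^bsub>AR\<^esub> finsum AR (\<lambda>b. cls (f b)) B"
    by (intro A.finsum_insert) auto
  thus ?case
    using insert by (simp add: cls_add supported_sum)
qed simp

lemma art_const_eq: "art_const type_ring \<Delta> d V c = cls (monomial {#} c)"
  by (simp add: art_const_def cls_def indexed_const_eq)

lemma carrier_art_ring: "carrier AR = cls ` {p. supported vs p}"
proof (intro equalityI subsetI)
  fix a assume "a \<in> carrier AR"
  then obtain y where y: "y \<in> carrier FR" "a = PI +>\<^bsub>FR\<^esub> y"
    by (auto simp: art_ring_def FactRing_def A_RCOSETS_def' )
  from y(1) obtain x where x: "x \<in> carrier PR" "y = face_ideal type_ring \<Delta> +>\<^bsub>PR\<^esub> x"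
    by (auto simp: face_ring_def FactRing_def A_RCOSETS_def' )
  from x(1) obtain p where p: "x = coef p" "supported vs p"
    by (rule mpoly_ringE)
  have "a = cls p"
    using x(2) y(2) p(1) by (simp add: cls_def art_class_def face_class_def)
  thus "a \<in> cls ` {p. supported vs p}"
    using p(2) by blast
qed auto

lemma cls_nonface:
  assumes "F \<subseteq> vs" "F \<notin> \<Delta>"
  shows "cls (monomial (mset_set F) 1) = \<zero>\<^bsub>AR\<^esub>"
proof -
  let ?x = "coef (monomial (mset_set F) (1::'k))"
  have "?x \<in> nonface_monomials"
    unfolding nonface_monomials_def squarefree_monomial_vertices(1)[OF assms(1), symmetric] using assms by blast
  hence "?x \<in> face_ideal type_ring \<Delta>"
    unfolding face_ideal_eq using M.genideal_self[OF nonface_monomials_carrier] by blast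
  hence "fcls ?x = \<zero>\<^bsub>FR\<^esub>"
    using M.a_rcos_zero[OF I.is_ideal] by (simp add: face_class_def face_ring_def FactRing_def)
  moreover have "\<zero>\<^bsub>FR\<^esub> \<in> PI"
    by (rule J.zero_closed)
  ultimately show ?thesis
    using FR.a_rcos_zero[OF J.is_ideal] by (simp add: cls_def art_class_def art_ring_def FactRing_def)
qed

lemma cls_nonface_monomial:
  assumes "set_mset n \<subseteq> vs" "set_mset n \<notin> \<Delta>"
  shows "cls (monomial n c) = \<zero>\<^bsub>AR\<^esub>"
proof -
  have "mset_set (set_mset n) \<subseteq># n"
    by (rule mset_set_set_mset_msubset)
  then obtain m where m: "n = mset_set (set_mset n) + m"
    by (metis subset_mset.add_diff_inverse)
  have "set_mset m \<subseteq> set_mset n"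
    using m by (metis set_mset_union Un_upper2)
  hence supp: "supported vs (monomial m c)"
    using assms by (intro supported_single) auto
  have "cls (monomial (mset_set (set_mset n)) 1 * monomial m c) = \<zero>\<^bsub>AR\<^esub>"
    using cls_mult[OF squarefree_monomial_vertices(2)[OF assms(1)] supp] cls_nonface[OF assms] supp by simp
  thus ?thesis
    by (simp add: mult_single flip: m)
qed

lemma cls_lform:
  assumes "i < d"
  shows "cls (lform (V i)) = \<zero>\<^bsub>AR\<^esub>"
proof -
  have "fcls (coef (lform (V i))) \<in> PI"
    unfolding parameter_ideal_def using assms FR.genideal_self[OF linear_forms_carrier]
    by (auto simp: linear_form_eq)
  thus ?thesis
    using FR.a_rcos_zero[OF J.is_ideal] by (simp add: cls_def art_class_def art_ring_def FactRing_def)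
qed

text \<open>The kernel of \<open>cls\<close> is the smallest ideal that contains the monomials of the nonfaces and the
  linear forms: the preimage of the ideal generated in the face ring consists of sums of an element
  of any such ideal \<open>Z\<close> and an element of the face ideal.\<close>

lemma cls_zero_imp:
  fixes Z :: "('v multiset \<Rightarrow>\<^sub>0 'k) set"
  assumes Z: "\<And>p. p \<in> Z \<Longrightarrow> supported vs p" "0 \<in> Z"
      "\<And>p q. p \<in> Z \<Longrightarrow> q \<in> Z \<Longrightarrow> p + q \<in> Z"
      "\<And>p q. p \<in> Z \<Longrightarrow> supported vs q \<Longrightarrow> q * p \<in> Z"
    and nonface: "\<And>F. F \<subseteq> vs \<Longrightarrow> F \<notin> \<Delta> \<Longrightarrow> monomial (mset_set F) 1 \<in> Z"
    and lform: "\<And>i. i < d \<Longrightarrow> lform (V i) \<in> Z"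
    and p: "supported vs p" "cls p = \<zero>\<^bsub>AR\<^esub>"
  shows "p \<in> Z"
proof -
  let ?Z = "coef ` Z"
  have uminus: "- q \<in> Z" if "q \<in> Z" for q
    using Z(4)[OF that, of "- 1"] by (simp add: supported_uminus)
  have ideal_Z: "ideal ?Z PR"
  proof (rule idealI[OF M.ring_axioms])
    show "subgroup ?Z (add_monoid PR)"
    proof (rule M.add.subgroupI)
      show "?Z \<subseteq> carrier PR"
        using Z(1) by auto
      show "?Z \<noteq> {}"
        using Z(2) by auto
      fix a assume "a \<in> ?Z"
      then obtain q where q: "a = coef q" "q \<in> Z"
        by auto
      have "\<ominus>\<^bsub>PR\<^esub> a = coef (- q)"
        using q Z(1) by (intro M.minus_equality) (simp_all add: supported_uminus)
      thus "\<ominus>\<^bsub>PR\<^esub> a \<in> ?Z"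
        using uminus[OF q(2)] by simp
      fix b assume "b \<in> ?Z"
      thus "a \<oplus>\<^bsub>PR\<^esub> b \<in> ?Z"
        using q Z(3) by auto
    qed
    fix a x assume a: "a \<in> ?Z" and x: "x \<in> carrier PR"
    obtain q where q: "a = coef q" "q \<in> Z"
      using a by auto
    obtain r where r: "x = coef r" "supported vs r"
      using x by (rule mpoly_ringE)
    show "x \<otimes>\<^bsub>PR\<^esub> a \<in> ?Z"
      using q r Z(4) by auto
    thus "a \<otimes>\<^bsub>PR\<^esub> x \<in> ?Z"
      using q r by (simp add: mult.commute)
  qed
  have sub_I: "face_ideal type_ring \<Delta> \<subseteq> ?Z"
    unfolding face_ideal_eq
  proof (rule M.genideal_minimal[OF ideal_Z])
    show "nonface_monomials \<subseteq> ?Z"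
      using nonface squarefree_monomial_vertices(1) by (auto simp: nonface_monomials_def)
  qed
  let ?Y = "fcls ` ?Z"
  have "ideal ?Y FR"
    using M.ring_ideal_imp_quot_ideal[OF I.is_ideal ideal_Z] by (simp add: face_class_def[abs_def] face_ring_def)
  hence sub_J: "PI \<subseteq> ?Y"
    unfolding parameter_ideal_def
    by (rule FR.genideal_minimal) (auto simp: linear_form_eq lform)
  let ?x = "coef p"
  have x: "?x \<in> carrier PR"
    using p(1) by simp
  have "PI +>\<^bsub>FR\<^esub> fcls ?x = PI"
    using p(2) by (simp add: cls_def art_class_def art_ring_def FactRing_def)
  hence "fcls ?x \<in> PI"
    by (rule J.rcos_const_imp_mem[rotated]) (rule face.hom_closed[OF x])
  then obtain q where q: "q \<in> Z" "fcls ?x = fcls (coef q)"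
    using sub_J by auto
  have qc: "coef q \<in> carrier PR"
    using q Z(1) by simp
  have "?x \<ominus>\<^bsub>PR\<^esub> coef q \<in> face_ideal type_ring \<Delta>"
    using q(2) M.quotient_eq_iff_same_a_r_cos[OF I.is_ideal x qc] by (simp add: face_class_def)
  then obtain r where r: "r \<in> Z" "?x \<ominus>\<^bsub>PR\<^esub> coef q = coef r"
    using sub_I by auto
  have "?x = (?x \<ominus>\<^bsub>PR\<^esub> coef q) \<oplus>\<^bsub>PR\<^esub> coef q"
    using x qc by (simp only: M.minus_eq M.a_assoc M.l_neg M.r_zero M.a_inv_closed)
  also have "\<dots> = coef (r + q)"
    by (simp only: r(2) mpoly_ring_lookup)
  finally have "p = r + q"
    by (simp only: poly_mapping_eq_iff)
  thus ?thesis
    using Z(3) r(1) q(1) by simp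
qed

lemma homogeneous_supported: "homogeneous vs n p \<Longrightarrow> supported vs p"
  by (auto simp: homogeneous_def supported_def)

lemma art_piece_eq: "graded_piece n = cls ` {p. homogeneous vs n p}"
proof -
  have "homogeneous_polys (type_ring :: 'k ring) vs n = coef ` {p. homogeneous vs n p}"
  proof (intro equalityI subsetI)
    fix P :: "'v multiset \<Rightarrow> 'k" assume P: "P \<in> homogeneous_polys type_ring vs n"
    hence "P \<in> carrier PR"
      by (simp add: homogeneous_polys_def)
    then obtain p where "P = coef p" "supported vs p"
      by (rule mpoly_ringE)
    thus "P \<in> coef ` {p. homogeneous vs n p}"
      using P by (intro image_eqI[of _ _ p]) (auto simp: homogeneous_def homogeneous_polys_def in_keys_iff supported_def)
  qed (auto simp: homogeneous_polys_def supported_def homogeneous_def in_keys_iff)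
  thus ?thesis
    by (simp add: art_piece_def image_image cls_def)
qed

end

section \<open>The degree map and the Gorensteinification\<close>

definition linear_extension :: "('m \<Rightarrow> 'k) \<Rightarrow> ('m \<Rightarrow>\<^sub>0 'k::field) \<Rightarrow> 'k" where
  "linear_extension g p = (\<Sum>n\<in>monomials p. coef p n * g n)"

lemma linear_extension_superset:
  assumes "finite B" "monomials p \<subseteq> B"
  shows "linear_extension g p = (\<Sum>n\<in>B. coef p n * g n)"
  unfolding linear_extension_def using assms
  by (intro sum.mono_neutral_left) (auto simp: in_keys_iff)

lemma linear_extension_0 [simp]: "linear_extension g 0 = 0"
  by (simp add: linear_extension_def)

lemma linear_extension_add: "linear_extension g (p + q) = linear_extension g p + linear_extension g q"
proof -
  define B where "B = monomials p \<union> monomials q"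
  have B: "finite B" "monomials p \<subseteq> B" "monomials q \<subseteq> B" "monomials (p + q) \<subseteq> B"
    using keys_add[of p q] by (auto simp: B_def)
  show ?thesis
    by (simp add: linear_extension_superset[OF B(1,2)] linear_extension_superset[OF B(1,3)]
        linear_extension_superset[OF B(1,4)] lookup_add distrib_right sum.distrib)
qed

lemma linear_extension_sum: "linear_extension g (\<Sum>x\<in>B. f x) = (\<Sum>x\<in>B. linear_extension g (f x))"
  by (induction B rule: infinite_finite_induct) (auto simp: linear_extension_add)

lemma linear_extension_uminus: "linear_extension g (- p) = - linear_extension g p"
  using linear_extension_add[of g p "- p"] by (simp add: minus_unique)

lemma linear_extension_single: "linear_extension g (monomial n c) = c * g n"
  by (cases "c = 0") (simp_all add: linear_extension_def)

lemma linear_extension_times_single: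
  fixes p :: "'m::comm_monoid_add \<Rightarrow>\<^sub>0 'k::field"
  shows "linear_extension g (monomial m c * p) = c * linear_extension (\<lambda>n. g (m + n)) p"
proof -
  have "monomial m c * p = (\<Sum>n\<in>monomials p. monomial (m + n) (c * coef p n))"
    by (subst poly_mapping_sum_single[of p]) (simp add: sum_distrib_left mult_single)
  thus ?thesis
    by (simp add: linear_extension_sum linear_extension_single linear_extension_def[of "\<lambda>n. g (m + n)"]
        sum_distrib_left mult.assoc)
qed

lemma homogeneous_0: "homogeneous S k 0"
  by (simp add: homogeneous_def)

lemma homogeneous_add: "homogeneous S k p \<Longrightarrow> homogeneous S k q \<Longrightarrow> homogeneous S k (p + q)"
  using keys_add[of p q] by (auto simp: homogeneous_def)

lemma homogeneous_sum: "(\<And>x. x \<in> B \<Longrightarrow> homogeneous S k (f x)) \<Longrightarrow> homogeneous S k (\<Sum>x\<in>B. f x)"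
  by (induction B rule: infinite_finite_induct) (auto intro: homogeneous_add homogeneous_0)

lemma homogeneous_single: "set_mset n \<subseteq> S \<Longrightarrow> size n = k \<Longrightarrow> homogeneous S k (monomial n c)"
  by (simp add: homogeneous_def)

lemma homogeneous_mult:
  fixes p :: "'v multiset \<Rightarrow>\<^sub>0 'k::field"
  shows "homogeneous S k p \<Longrightarrow> homogeneous S l q \<Longrightarrow> homogeneous S (k + l) (p * q)"
  using keys_mult[of p q] by (fastforce simp: homogeneous_def)

text \<open>Enumerating the columns turns permutations into bijections, and signs do not matter.\<close>

lemma minor_det_eq_permanent:
  fixes V :: "nat \<Rightarrow> 'v::linorder \<Rightarrow> 'k::field"
  assumes two: "(1::'k) + 1 = 0" and F: "finite F" "card F = d"
  shows "minor_det type_ring V F = permanent V d F"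
proof -
  define xs where "xs = sorted_list_of_set F"
  define h where "h \<sigma> = restrict (\<lambda>i. xs ! \<sigma> i) {..<d}" for \<sigma> :: "nat \<Rightarrow> nat"
  have xs: "distinct xs" "set xs = F" "length xs = d"
    using F by (simp_all add: xs_def)
  have nth_bij: "bij_betw (\<lambda>i. xs ! i) {..<d} F"
    using bij_betw_nth[OF xs(1), of "{..<d}" F] xs by simp
  have perm_lt: "\<sigma> i < d" if "\<sigma> permutes {..<d}" "i < d" for \<sigma> i
    using permutes_in_image[OF that(1), of i] that(2) by simp
  have "bij_betw h {\<sigma>. \<sigma> permutes {..<d}} (bijections d F)"
    unfolding bij_betw_def
  proof (intro conjI equalityI subsetI)
    show "inj_on h {\<sigma>. \<sigma> permutes {..<d}}"
    proof (rule inj_onI, rule ext)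
      fix \<sigma> \<tau> i assume *: "\<sigma> \<in> {\<sigma>. \<sigma> permutes {..<d}}" "\<tau> \<in> {\<sigma>. \<sigma> permutes {..<d}}" "h \<sigma> = h \<tau>"
      show "\<sigma> i = \<tau> i"
      proof (cases "i < d")
        case True
        have "h \<sigma> i = h \<tau> i"
          by (simp only: *(3))
        hence "xs ! \<sigma> i = xs ! \<tau> i"
          using True by (simp add: h_def)
        thus ?thesis
          using perm_lt[of \<sigma> i] perm_lt[of \<tau> i] * True xs by (simp add: nth_eq_iff_index_eq)
      next
        case False
        thus ?thesis
          using * permutes_not_in[of \<sigma> "{..<d}" i] permutes_not_in[of \<tau> "{..<d}" i] by simp
      qed
    qed
    show "I \<in> bijections d F" if I: "I \<in> h ` {\<sigma>. \<sigma> permutes {..<d}}" for I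
    proof -
      obtain \<sigma> where \<sigma>: "\<sigma> permutes {..<d}" "I = h \<sigma>"
        using I by auto
      have "bij_betw (\<lambda>i. xs ! \<sigma> i) {..<d} F"
        using bij_betw_trans[OF permutes_imp_bij[OF \<sigma>(1)] nth_bij] by (simp add: comp_def)
      hence "bij_betw I {..<d} F"
        using bij_betw_cong[of "{..<d}" I "\<lambda>i. xs ! \<sigma> i" F] by (simp add: \<sigma>(2) h_def)
      thus ?thesis
        by (auto simp: bijections_def \<sigma>(2) h_def dest: bij_betwE)
    qed
    show "I \<in> h ` {\<sigma>. \<sigma> permutes {..<d}}" if I: "I \<in> bijections d F" for I
    proof -
      define \<sigma> where "\<sigma> i = (if i < d then inv_into {..<d} (\<lambda>i. xs ! i) (I i) else i)" for i
      have "bij_betw (inv_into {..<d} (\<lambda>i. xs ! i) \<circ> I) {..<d} {..<d}"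
        using I bij_betw_inv_into[OF nth_bij] by (intro bij_betw_trans) (auto simp: bijections_def)
      hence "bij_betw \<sigma> {..<d} {..<d}"
        using bij_betw_cong[of "{..<d}" \<sigma> "inv_into {..<d} (\<lambda>i. xs ! i) \<circ> I" "{..<d}"] by (simp add: \<sigma>_def)
      hence perm: "\<sigma> permutes {..<d}"
        by (rule bij_imp_permutes) (simp add: \<sigma>_def)
      have "h \<sigma> = I"
      proof
        fix i
        show "h \<sigma> i = I i"
        proof (cases "i < d")
          case True
          hence "I i \<in> (\<lambda>i. xs ! i) ` {..<d}"
            using bijections_mem[OF I True] nth_bij by (simp add: bij_betw_def)
          hence "xs ! inv_into {..<d} (\<lambda>i. xs ! i) (I i) = I i"
            by (rule f_inv_into_f)
          thus ?thesis
            using True by (simp add: h_def \<sigma>_def)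
        next
          case False
          thus ?thesis
            using I by (simp add: h_def bijections_def PiE_def extensional_def)
        qed
      qed
      thus ?thesis
        using perm by blast
    qed
  qed
  hence "permanent V d F = (\<Sum>\<sigma>\<in>{\<sigma>. \<sigma> permutes {..<d}}. \<Prod>i<d. V i (h \<sigma> i))"
    unfolding permanent_def by (rule sum.reindex_bij_betw[symmetric])
  also have "\<dots> = minor_det type_ring V F"
    unfolding minor_det_def F(2)
    by (simp add: char_two_minus[OF two] h_def xs_def cong: if_cong)
  finally show ?thesis ..
qed

locale cycle_algebra =
  column_configuration V d "vertices \<Delta>" apex + face_algebra \<Delta> d V
  for \<Delta> :: "'v::linorder set set" and d :: nat and V :: "nat \<Rightarrow> 'v \<Rightarrow> 'k::field" and apex :: 'v +
  fixes \<mu> :: "'v set \<Rightarrow> 'k"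
  assumes cycle: "is_cycle \<mu>"
    and outside: "F \<notin> \<Delta> \<Longrightarrow> \<mu> F = 0"
    and face_card: "F \<in> \<Delta> \<Longrightarrow> card F \<le> d"
    and nontrivial: "\<exists>F. card F = d \<and> \<mu> F \<noteq> 0"
begin

abbreviation DEG where
  "DEG \<equiv> degree_map (type_ring :: 'k ring) \<Delta> d V \<mu>"

text \<open>The degree map on polynomials, extended by zero to the monomials of other degrees.\<close>

definition pdeg :: "('v multiset \<Rightarrow>\<^sub>0 'k) \<Rightarrow> 'k" where
  "pdeg = linear_extension (\<lambda>n. if size n = d then mdeg \<mu> n else 0)"

lemma deg_times_single:
  "pdeg (monomial m c * p)
    = c * linear_extension (\<lambda>n. if size m + size n = d then mdeg \<mu> (m + n) else 0) p"
  by (simp add: pdeg_def linear_extension_times_single)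

lemma deg_add: "pdeg (p + q) = pdeg p + pdeg q"
  by (simp add: pdeg_def linear_extension_add)

lemma deg_uminus: "pdeg (- p) = - pdeg p"
  by (simp add: pdeg_def linear_extension_uminus)

lemma deg_sum: "pdeg (\<Sum>x\<in>B. f x) = (\<Sum>x\<in>B. pdeg (f x))"
  by (simp add: pdeg_def linear_extension_sum)

lemma deg_0 [simp]: "pdeg 0 = 0"
  by (simp add: pdeg_def)

lemma deg_scale: "pdeg (monomial {#} c * p) = c * pdeg p"
  by (simp add: pdeg_def linear_extension_times_single cong: if_cong)

lemma deg_nonface:
  assumes F: "F \<subseteq> vs" "F \<notin> \<Delta>" and q: "supported vs q"
  shows "pdeg (monomial (mset_set F) c * q) = 0"
proof -
  have fin: "finite F"
    using F(1) finite_vertices by (rule finite_subset)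
  have "mdeg \<mu> (mset_set F + n) = 0" if n: "n \<in> monomials q" "size (mset_set F) + size n = d" for n
  proof (rule mdeg_nonface[OF cycle])
    show "\<mu> G = 0" if "F \<subseteq> G" for G
      using F(2) face_down[OF _ that] outside by blast
    show "set_mset (mset_set F + n) \<subseteq> vs"
      using F(1) n(1) q fin by (auto simp: supported_def)
  qed (use fin n in auto)
  thus ?thesis
    unfolding deg_times_single linear_extension_def by (auto intro!: sum.neutral)
qed

lemma deg_lform:
  assumes i: "i < d"
  shows "pdeg (lform (V i) * q) = 0"
proof -
  have "pdeg (lform (V i) * q) = (\<Sum>v\<in>vs. \<Sum>n\<in>monomials q.
      coef q n * (if Suc (size n) = d then V i v * mdeg \<mu> (add_mset v n) else 0))"
    by (simp add: lform_def sum_distrib_right deg_sum deg_times_single linear_extension_def sum_distrib_left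
        mult.left_commute if_distrib[of "\<lambda>x. _ * x"] cong: if_cong)
  also have "\<dots> = (\<Sum>n\<in>monomials q. coef q n *
      (if Suc (size n) = d then (\<Sum>v\<in>vs. V i v * mdeg \<mu> (add_mset v n)) else 0))"
    by (subst sum.swap) (auto simp: sum_distrib_left intro!: sum.cong)
  also have "\<dots> = 0"
    by (simp add: mdeg_linear_form[OF i] cong: if_cong)
  finally show ?thesis .
qed

text \<open>The polynomials all of whose multiples have degree zero form an ideal. It contains the monomials of
  the nonfaces and the linear forms, hence the kernel of \<open>cls\<close>.\<close>

lemma cls_zero_imp_deg:
  assumes p: "supported vs p" "cls p = \<zero>\<^bsub>AR\<^esub>" and q: "supported vs q"
  shows "pdeg (p * q) = 0"
proof -
  define Z where "Z = {p. supported vs p \<and> (\<forall>q. supported vs q \<longrightarrow> pdeg (p * q) = 0)}"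
  have "p \<in> Z"
  proof (rule cls_zero_imp[OF _ _ _ _ _ _ p])
    show "supported vs p" if "p \<in> Z" for p
      using that by (simp add: Z_def)
    show "0 \<in> Z"
      by (simp add: Z_def)
    show "p + q \<in> Z" if "p \<in> Z" "q \<in> Z" for p q
      using that by (simp add: Z_def supported_add distrib_right deg_add)
    show "q * p \<in> Z" if "p \<in> Z" "supported vs q" for p q
    proof -
      have "pdeg (q * p * r) = 0" if r: "supported vs r" for r
      proof -
        have "pdeg (p * (q * r)) = 0"
          using \<open>p \<in> Z\<close> supported_mult[OF \<open>supported vs q\<close> r] by (simp add: Z_def)
        thus ?thesis
          by (simp only: mult.assoc mult.left_commute)
      qed
      thus ?thesis
        using that by (simp add: Z_def supported_mult)
    qed
    show "monomial (mset_set F) 1 \<in> Z" if "F \<subseteq> vs" "F \<notin> \<Delta>" for F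
      using that squarefree_monomial_vertices(2)[OF that(1)] deg_nonface[OF that] by (simp add: Z_def)
    show "lform (V i) \<in> Z" if "i < d" for i
      using deg_lform[OF that] supported_lform by (simp add: Z_def)
  qed
  thus ?thesis
    using q by (simp add: Z_def)
qed

lemma cls_eq_imp_deg:
  assumes p: "supported vs p" "supported vs p'" "cls p = cls p'"
    and q: "supported vs q"
  shows "pdeg (p * q) = pdeg (p' * q)"
proof -
  have "cls (p + - p') = cls p \<oplus>\<^bsub>AR\<^esub> (\<ominus>\<^bsub>AR\<^esub> cls p')"
    by (simp only: cls_add[OF p(1) supported_uminus[OF p(2)]] cls_uminus[OF p(2)])
  also have "\<dots> = \<zero>\<^bsub>AR\<^esub>"
    using p by (simp add: A.r_neg)
  finally have "pdeg ((p + - p') * q) = 0"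
    by (rule cls_zero_imp_deg[OF supported_add[OF p(1) supported_uminus[OF p(2)]] _ q])
  moreover have "(p + - p') * q = p * q + - (p' * q)"
    by (simp add: left_diff_distrib)
  ultimately show ?thesis
    by (simp only: deg_add deg_uminus) simp
qed

lemma deg_face:
  assumes "F \<in> \<Delta>" "card F = d"
  shows "pdeg (monomial (mset_set F) 1) = \<mu> F / permanent V d F"
  using mdeg_face[OF cycle face_subset[OF assms(1)] assms(2)] assms(2)
  by (simp add: pdeg_def linear_extension_single)

lemma art_const_times:
  assumes "supported vs p"
  shows "art_const type_ring \<Delta> d V c \<otimes>\<^bsub>AR\<^esub> cls p = cls (monomial {#} c * p)"
  using assms by (simp add: art_const_eq cls_mult supported_single)

text \<open>The difference \<open>h\<close> of two degree maps is linear and vanishes on the monomials of faces and on the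
  kernel. Spreading supports shows that it vanishes on all monomials.\<close>

lemma is_degree_map_unique:
  assumes f: "is_degree_map type_ring \<Delta> d V \<mu> f" and g: "is_degree_map type_ring \<Delta> d V \<mu> g"
    and p: "homogeneous vs d p"
  shows "f (cls p) = g (cls p)"
proof -
  define h where "h p = f (cls p) - g (cls p)" for p
  have piece: "cls p \<in> graded_piece d" if "homogeneous vs d p" for p
    using that by (auto simp: art_piece_eq)
  have h_add: "h (p + q) = h p + h q"
    if "homogeneous vs d p" "homogeneous vs d q" for p q
    using f g piece[OF that(1)] piece[OF that(2)] that
    by (simp add: h_def is_degree_map_def cls_add homogeneous_supported)
  have h_scale: "h (monomial {#} c * p) = c * h p" if "homogeneous vs d p" for p c
  proof -
    have "k (cls (monomial {#} c * p)) = c * k (cls p)" if k: "is_degree_map type_ring \<Delta> d V \<mu> k" for k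
    proof -
      have "k (art_const type_ring \<Delta> d V c \<otimes>\<^bsub>AR\<^esub> cls p) = c * k (cls p)"
        using k piece[OF \<open>homogeneous vs d p\<close>] by (simp add: is_degree_map_def)
      thus ?thesis
        using \<open>homogeneous vs d p\<close> by (simp add: art_const_times homogeneous_supported)
    qed
    thus ?thesis
      using f g by (simp add: h_def right_diff_distrib)
  qed
  have h_0: "h 0 = 0"
    using h_scale[of 0 0] by (simp add: homogeneous_0)
  have h_sum: "h (\<Sum>x\<in>B. q x) = (\<Sum>x\<in>B. h (q x))"
    if "\<And>x. x \<in> B \<Longrightarrow> homogeneous vs d (q x)" for q and B :: "'z set"
    using that
    by (induction B rule: infinite_finite_induct) (auto simp: h_0 h_add homogeneous_sum)
  have h_cls: "h p = 0" if "cls p = \<zero>\<^bsub>AR\<^esub>" for p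
    using h_0 that by (simp add: h_def)
  have monomial: "h (monomial n 1) = 0" if n: "set_mset n \<subseteq> vs" "size n = d" for n
  proof (rule spread_support[where Z = "\<lambda>n. h (monomial n 1) = 0" and T = "{}", OF _ _ _ _ n])
    fix n c v
    assume n: "set_mset n \<subseteq> vs" "Suc (size n) = d" and v: "v \<in> vs" "(\<Sum>i<d. c i * V i v) = 1"
      and IH: "\<And>w. w \<in> vs \<Longrightarrow> w \<noteq> v \<Longrightarrow> (\<Sum>i<d. c i * V i w) \<noteq> 0 \<Longrightarrow> h (monomial (add_mset w n) 1) = 0"
    have "h (lform (V i) * monomial n (c i)) = 0" if "i < d" for i
      using n cls_lform[OF that] by (intro h_cls) (simp add: cls_mult supported_lform supported_single)
    hence "0 = (\<Sum>i<d. h (lform (V i) * monomial n (c i)))"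
      by simp
    also have "\<dots> = (\<Sum>i<d. \<Sum>w\<in>vs. h (monomial {#} (c i * V i w) * monomial (add_mset w n) 1))"
      unfolding lform_def sum_distrib_right
      by (intro sum.cong refl, subst h_sum) (use n in \<open>auto simp: mult_single mult.commute intro!: homogeneous_single\<close>)
    also have "\<dots> = (\<Sum>i<d. \<Sum>w\<in>vs. c i * V i w * h (monomial (add_mset w n) 1))"
      using n by (intro sum.cong refl h_scale homogeneous_single) auto
    also have "\<dots> = (\<Sum>w\<in>vs. (\<Sum>i<d. c i * V i w) * h (monomial (add_mset w n) 1))"
      by (subst sum.swap) (simp add: sum_distrib_right)
    also have "\<dots> = (\<Sum>w\<in>vs. if w = v then h (monomial (add_mset v n) 1) else 0)"
    proof (rule sum.cong[OF refl])
      fix w assume "w \<in> vs"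
      thus "(\<Sum>i<d. c i * V i w) * h (monomial (add_mset w n) 1)
          = (if w = v then h (monomial (add_mset v n) 1) else 0)"
        using v(2) IH[of w] by (cases "(\<Sum>i<d. c i * V i w) = 0") auto
    qed
    also have "\<dots> = h (monomial (add_mset v n) 1)"
      using v(1) finite_vertices by simp
    finally show "h (monomial (add_mset v n) 1) = 0" ..
  next
    fix T' assume T': "T' \<subseteq> vs" "card T' = d"
    show "h (monomial (mset_set T') 1) = 0"
    proof (cases "T' \<in> \<Delta>")
      case True
      have "k (cls (monomial (mset_set T') 1)) = \<mu> T' \<otimes>\<^bsub>type_ring\<^esub> inv\<^bsub>type_ring\<^esub> (minor_det type_ring V T')"
        if "is_degree_map type_ring \<Delta> d V \<mu> k" for k
        unfolding cls_def squarefree_monomial_vertices(1)[OF T'(1), symmetric]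
        using that True T'(2) unfolding is_degree_map_def by blast
      from this[OF f] this[OF g] show ?thesis
        by (simp add: h_def)
    next
      case False
      thus ?thesis
        using T' by (intro h_cls cls_nonface)
    qed
  next
    fix m :: "'v multiset" assume "size m = d" "card (set_mset m) > d"
    moreover have "card (set_mset m) \<le> size m"
      by (metis mset_set_set_mset_msubset size_mset_mono size_mset_set)
    ultimately show "h (monomial m 1) = 0"
      by simp
  qed simp
  have "h p = h (\<Sum>n\<in>monomials p. monomial {#} (coef p n) * monomial n 1)"
    by (subst poly_mapping_sum_single[of p]) (simp add: mult_single)
  also have "\<dots> = (\<Sum>n\<in>monomials p. h (monomial {#} (coef p n) * monomial n 1))"
    using p by (intro h_sum) (auto simp: mult_single homogeneous_def)
  also have "\<dots> = 0"
  proof (rule sum.neutral, rule ballI)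
    fix n assume "n \<in> monomials p"
    hence n: "set_mset n \<subseteq> vs" "size n = d"
      using p by (auto simp: homogeneous_def)
    show "h (monomial {#} (coef p n) * monomial n 1) = 0"
      using h_scale[OF homogeneous_single[OF n]] monomial[OF n] by simp
  qed
  finally show ?thesis
    by (simp add: h_def)
qed

lemma degree_map_cls:
  assumes p: "homogeneous vs d p"
  shows "DEG (cls p) = pdeg p"
proof -
  define f where "f = restrict (\<lambda>a. pdeg (SOME p. homogeneous vs d p \<and> cls p = a)) (graded_piece d)"
  have f_cls: "f (cls p) = pdeg p" if p: "homogeneous vs d p" for p
  proof -
    define q where "q = (SOME q. homogeneous vs d q \<and> cls q = cls p)"
    have q: "homogeneous vs d q \<and> cls q = cls p"
      unfolding q_def by (rule someI[of _ p]) (simp add: p)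
    have "pdeg (q * 1) = pdeg (p * 1)"
      using p q by (intro cls_eq_imp_deg) (auto simp: homogeneous_supported)
    moreover have "cls p \<in> graded_piece d"
      using p by (auto simp: art_piece_eq)
    ultimately show ?thesis
      by (simp add: f_def q_def)
  qed
  have pieceE: "\<exists>p. homogeneous vs d p \<and> a = cls p" if "a \<in> graded_piece d" for a
    using that by (auto simp: art_piece_eq)
  have f: "is_degree_map type_ring \<Delta> d V \<mu> f"
    unfolding is_degree_map_def
  proof (intro conjI ballI impI)
    show "f \<in> graded_piece d \<rightarrow>\<^sub>E carrier type_ring"
      by (simp add: f_def)
    show "f (a \<oplus>\<^bsub>AR\<^esub> b) = f a \<oplus>\<^bsub>type_ring\<^esub> f b"
      if a: "a \<in> graded_piece d" and b: "b \<in> graded_piece d" for a b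
    proof -
      obtain p q where p: "homogeneous vs d p" "a = cls p"
        and q: "homogeneous vs d q" "b = cls q"
        using pieceE[OF a] pieceE[OF b] by blast
      have "a \<oplus>\<^bsub>AR\<^esub> b = cls (p + q)"
        using p q by (simp add: cls_add homogeneous_supported)
      thus ?thesis
        using p q by (simp add: f_cls homogeneous_add deg_add)
    qed
    show "f (art_const type_ring \<Delta> d V c \<otimes>\<^bsub>AR\<^esub> a) = c \<otimes>\<^bsub>type_ring\<^esub> f a"
      if a: "a \<in> graded_piece d" for a c
    proof -
      obtain p where p: "homogeneous vs d p" "a = cls p"
        using pieceE[OF a] by blast
      have "homogeneous vs (0 + d) (monomial {#} c * p)"
        using p by (intro homogeneous_mult homogeneous_single) auto
      thus ?thesis
        using p by (simp add: art_const_times homogeneous_supported f_cls deg_scale)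
    qed
    show "f (art_class type_ring \<Delta> d V (squarefree_monomial type_ring vs F))
        = \<mu> F \<otimes>\<^bsub>type_ring\<^esub> inv\<^bsub>type_ring\<^esub> (minor_det type_ring V F)"
      if F: "F \<in> \<Delta>" "card F = d" for F
    proof -
      note FS = face_subset[OF F(1)]
      have fin: "finite F"
        using FS finite_vertices by (rule finite_subset)
      have "homogeneous vs d (monomial (mset_set F) (1::'k))"
        using FS fin F(2) by (intro homogeneous_single) auto
      hence "f (cls (monomial (mset_set F) 1)) = \<mu> F / permanent V d F"
        by (simp add: f_cls deg_face[OF F])
      moreover have "permanent V d F \<noteq> 0"
        using FS F(2) by (intro nondegenerate) auto
      ultimately show ?thesis
        by (simp add: squarefree_monomial_vertices(1)[OF FS] cls_def minor_det_eq_permanent[OF two fin F(2)] divide_inverse)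
    qed
  qed
  have "DEG = f"
    unfolding degree_map_def
  proof (rule the_equality)
    show "is_degree_map type_ring \<Delta> d V \<mu> f"
      by (rule f)
    fix g assume g: "is_degree_map type_ring \<Delta> d V \<mu> g"
    show "g = f"
    proof
      fix a
      show "g a = f a"
      proof (cases "a \<in> graded_piece d")
        case True
        thus ?thesis
          using pieceE is_degree_map_unique[OF g f] by blast
      next
        case False
        thus ?thesis
          using f g by (auto simp: is_degree_map_def PiE_def extensional_def)
      qed
    qed
  qed
  thus ?thesis
    using f_cls[OF p] by simp
qed

end

context cycle_algebra
begin

definition annihilator :: "('v multiset \<Rightarrow>\<^sub>0 'k) \<Rightarrow> bool" where
  "annihilator p \<longleftrightarrow> (\<forall>q. supported vs q \<longrightarrow> pdeg (p * q) = 0)"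

lemma deg_times_monomial:
  assumes p: "homogeneous vs n p"
  shows "pdeg (p * monomial M c) = (if size M + n = d then c * pairing \<mu> p M else 0)"
proof -
  have "pdeg (p * monomial M c)
      = c * linear_extension (\<lambda>m. if size M + size m = d then mdeg \<mu> (M + m) else 0) p"
    using deg_times_single[of M c p] by (simp only: mult.commute)
  also have "linear_extension (\<lambda>m. if size M + size m = d then mdeg \<mu> (M + m) else 0) p
      = (if size M + n = d then pairing \<mu> p M else 0)"
    using p by (auto simp: linear_extension_def pairing_def homogeneous_def add.commute intro!: sum.cong sum.neutral)
  finally show ?thesis
    by simp
qed

lemma orthogonal_iff_annihilator:
  assumes p: "homogeneous vs n p"
  shows "orthogonal \<mu> n p \<longleftrightarrow> annihilator p"
proof
  assume orth: "orthogonal \<mu> n p"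
  show "annihilator p"
    unfolding annihilator_def
  proof (intro allI impI)
    fix q :: "'v multiset \<Rightarrow>\<^sub>0 'k" assume q: "supported vs q"
    have "p * q = (\<Sum>m\<in>monomials q. p * monomial m (coef q m))"
      by (subst poly_mapping_sum_single[of q]) (simp add: sum_distrib_left)
    hence "pdeg (p * q) = (\<Sum>m\<in>monomials q. pdeg (p * monomial m (coef q m)))"
      by (simp add: deg_sum)
    also have "\<dots> = 0"
      using orth q by (intro sum.neutral) (auto simp: deg_times_monomial[OF p] orthogonal_def supported_def)
    finally show "pdeg (p * q) = 0" .
  qed
next
  assume ann: "annihilator p"
  show "orthogonal \<mu> n p"
    unfolding orthogonal_def
  proof (intro allI impI)
    fix M assume M: "set_mset M \<subseteq> vs" "size M + n = d"
    have "pdeg (p * monomial M 1) = 0"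
      using ann M(1) by (simp add: annihilator_def supported_single)
    thus "pairing \<mu> p M = 0"
      using M(2) by (simp add: deg_times_monomial[OF p])
  qed
qed

definition annihilator_classes :: "('v multiset \<Rightarrow> 'k) set set set" where
  "annihilator_classes = {cls p | p. supported vs p \<and> annihilator p}"

lemma cls_in_radical_iff:
  assumes "supported vs p"
  shows "cls p \<in> annihilator_classes \<longleftrightarrow> annihilator p"
proof
  assume "cls p \<in> annihilator_classes"
  then obtain q where q: "cls p = cls q" "supported vs q" "annihilator q"
    by (auto simp: annihilator_classes_def)
  show "annihilator p"
    using cls_eq_imp_deg[OF assms q(2,1)] q(3) by (simp add: annihilator_def)
qed (use assms in \<open>auto simp: annihilator_classes_def\<close>)

lemma radical_piece_iff:
  assumes p: "homogeneous vs n p"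
  shows "cls p \<in> radical_piece type_ring \<Delta> d V \<mu> n \<longleftrightarrow> annihilator p"
proof
  assume rad: "cls p \<in> radical_piece type_ring \<Delta> d V \<mu> n"
  have "orthogonal \<mu> n p"
    unfolding orthogonal_def
  proof (intro allI impI)
    fix M assume M: "set_mset M \<subseteq> vs" "size M + n = d"
    let ?q = "monomial M (1::'k)"
    have q: "homogeneous vs (size M) ?q"
      using M(1) by (intro homogeneous_single) auto
    have nM: "n + size M = d"
      using M(2) by simp
    have "cls ?q \<in> graded_piece (size M)"
      using q by (auto simp: art_piece_eq)
    hence "DEG (cls p \<otimes>\<^bsub>AR\<^esub> cls ?q) = 0"
      using rad nM by (simp add: radical_piece_def)
    hence "DEG (cls (p * ?q)) = 0"
      using p q by (simp add: cls_mult homogeneous_supported)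
    hence "pdeg (p * ?q) = 0"
      using degree_map_cls homogeneous_mult[OF p q] nM by simp
    thus "pairing \<mu> p M = 0"
      using M(2) by (simp add: deg_times_monomial[OF p])
  qed
  thus "annihilator p"
    by (simp add: orthogonal_iff_annihilator[OF p])
next
  assume ann: "annihilator p"
  have "DEG (cls p \<otimes>\<^bsub>AR\<^esub> b) = 0"
    if j: "n + j = d" and b: "b \<in> graded_piece j" for j b
  proof -
    obtain q where q: "homogeneous vs j q" "b = cls q"
      using b by (auto simp: art_piece_eq)
    have "homogeneous vs d (p * q)"
      using homogeneous_mult[OF p q(1)] j by simp
    hence "DEG (cls (p * q)) = pdeg (p * q)"
      by (rule degree_map_cls)
    thus ?thesis
      using ann p q by (simp add: annihilator_def cls_mult homogeneous_supported)
  qed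
  moreover have "cls p \<in> graded_piece n"
    using p by (auto simp: art_piece_eq)
  ultimately show "cls p \<in> radical_piece type_ring \<Delta> d V \<mu> n"
    by (simp add: radical_piece_def)
qed

definition component :: "nat \<Rightarrow> ('v multiset \<Rightarrow>\<^sub>0 'k) \<Rightarrow> ('v multiset \<Rightarrow>\<^sub>0 'k)" where
  "component n p = (\<Sum>m\<in>{m \<in> monomials p. size m = n}. monomial m (coef p m))"

lemma component_homogeneous:
  assumes "supported vs p"
  shows "homogeneous vs n (component n p)"
  unfolding component_def using assms
  by (intro homogeneous_sum homogeneous_single) (auto simp: supported_def)

lemma component_times_monomial:
  assumes "size M + n = d"
  shows "pdeg (component n p * monomial M 1) = pdeg (p * monomial M 1)"
proof -
  have "pdeg (p * monomial M 1)
      = (\<Sum>m\<in>monomials p. pdeg (monomial (m + M) (coef p m)))"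
    by (subst poly_mapping_sum_single[of p]) (simp add: sum_distrib_right mult_single deg_sum)
  also have "\<dots> = (\<Sum>m\<in>{m \<in> monomials p. size m = n}. pdeg (monomial (m + M) (coef p m)))"
    using assms by (intro sum.mono_neutral_right) (auto simp: pdeg_def linear_extension_single)
  also have "\<dots> = pdeg (component n p * monomial M 1)"
    by (simp add: component_def sum_distrib_right mult_single deg_sum)
  finally show ?thesis ..
qed

lemma annihilator_component:
  assumes p: "supported vs p" "annihilator p"
  shows "annihilator (component n p)"
proof -
  note hom = component_homogeneous[OF p(1), of n]
  have "orthogonal \<mu> n (component n p)"
    unfolding orthogonal_def
  proof (intro allI impI)
    fix M assume M: "set_mset M \<subseteq> vs" "size M + n = d"
    have "pdeg (component n p * monomial M 1) = 0"
      using p(2) M(1) by (simp add: component_times_monomial[OF M(2)] annihilator_def supported_single)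
    thus "pairing \<mu> (component n p) M = 0"
      using M(2) by (simp add: deg_times_monomial[OF hom])
  qed
  thus ?thesis
    by (simp add: orthogonal_iff_annihilator[OF hom])
qed

lemma sum_components:
  assumes "\<And>m. m \<in> monomials p \<Longrightarrow> size m \<le> N"
  shows "(\<Sum>n\<le>N. component n p) = p"
proof -
  have "(\<Sum>n\<le>N. component n p) = (\<Sum>m\<in>monomials p. monomial m (coef p m))"
    unfolding component_def by (rule sum.group) (use assms in auto)
  thus ?thesis
    by (simp flip: poly_mapping_sum_single)
qed

text \<open>The annihilator of a homogeneous functional contains the homogeneous components of its elements. In
  this description the radical is visibly an ideal.\<close>

lemma radical_ideal_eq: "radical_ideal type_ring \<Delta> d V \<mu> = annihilator_classes"
proof (intro equalityI subsetI)
  fix x assume "x \<in> radical_ideal type_ring \<Delta> d V \<mu>"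
  then obtain a N where a: "x = finsum AR a {..N}" "\<And>n. a n \<in> radical_piece type_ring \<Delta> d V \<mu> n"
    by (auto simp: radical_ideal_def)
  have "\<exists>p. homogeneous vs n p \<and> a n = cls p" for n
    using a(2)[of n] by (auto simp: radical_piece_def art_piece_eq)
  then obtain P where P: "\<And>n. homogeneous vs n (P n)" "\<And>n. a n = cls (P n)"
    by metis
  have supp: "supported vs (P n)" for n
    using P(1) by (rule homogeneous_supported)
  have "annihilator (P n)" for n
    using a(2)[of n] radical_piece_iff[OF P(1)] by (simp add: P(2))
  hence "annihilator (\<Sum>n\<le>N. P n)"
    by (simp add: annihilator_def sum_distrib_right deg_sum)
  moreover have "x = cls (\<Sum>n\<le>N. P n)"
    unfolding a(1) using supp by (subst cls_sum) (simp_all add: P(2)[abs_def])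
  moreover have "supported vs (\<Sum>n\<le>N. P n)"
    using supp by (intro supported_sum)
  ultimately show "x \<in> annihilator_classes"
    by (auto simp: annihilator_classes_def)
next
  fix x assume "x \<in> annihilator_classes"
  then obtain p where p: "x = cls p" "supported vs p" "annihilator p"
    by (auto simp: annihilator_classes_def)
  define N where "N = (\<Sum>m\<in>monomials p. size m)"
  have N: "size m \<le> N" if "m \<in> monomials p" for m
    unfolding N_def using that by (intro member_le_sum) auto
  define a where "a n = cls (component n p)" for n
  have "a n \<in> radical_piece type_ring \<Delta> d V \<mu> n" for n
    unfolding a_def using radical_piece_iff[OF component_homogeneous[OF p(2)]] annihilator_component[OF p(2,3)] by simp
  moreover have "x = finsum AR a {..N}"
  proof -
    have "x = cls (\<Sum>n\<le>N. component n p)"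
      using sum_components[of p N] N p(1) by simp
    also have "\<dots> = finsum AR (\<lambda>n. cls (component n p)) {..N}"
      using component_homogeneous[OF p(2)] by (intro cls_sum) (auto intro: homogeneous_supported)
    finally show ?thesis
      by (simp add: a_def[abs_def])
  qed
  ultimately show "x \<in> radical_ideal type_ring \<Delta> d V \<mu>"
    unfolding radical_ideal_def by blast
qed

lemma ideal_radical: "ideal annihilator_classes AR"
proof (rule idealI[OF A.ring_axioms])
  have closed: "a \<in> carrier AR" if "a \<in> annihilator_classes" for a
    using that by (auto simp: annihilator_classes_def)
  show "subgroup annihilator_classes (add_monoid AR)"
  proof (rule A.add.subgroupI)
    show "annihilator_classes \<subseteq> carrier AR"
      using closed by blast
    have "cls 0 \<in> annihilator_classes"
      by (subst cls_in_radical_iff) (simp_all add: annihilator_def)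
    thus "annihilator_classes \<noteq> {}"
      by blast
    fix a assume "a \<in> annihilator_classes"
    then obtain p where p: "a = cls p" "supported vs p" "annihilator p"
      by (auto simp: annihilator_classes_def)
    have "cls (- p) \<in> annihilator_classes"
      using p by (subst cls_in_radical_iff) (simp_all add: supported_uminus annihilator_def deg_uminus)
    thus "\<ominus>\<^bsub>AR\<^esub> a \<in> annihilator_classes"
      using p by (simp add: cls_uminus)
    fix b assume "b \<in> annihilator_classes"
    then obtain q where q: "b = cls q" "supported vs q" "annihilator q"
      by (auto simp: annihilator_classes_def)
    have "cls (p + q) \<in> annihilator_classes"
      using p q by (subst cls_in_radical_iff) (simp_all add: supported_add annihilator_def distrib_right deg_add)
    thus "a \<oplus>\<^bsub>AR\<^esub> b \<in> annihilator_classes"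
      using p q by (simp add: cls_add)
  qed
  fix a x assume "a \<in> annihilator_classes" and x: "x \<in> carrier AR"
  then obtain p where p: "a = cls p" "supported vs p" "annihilator p"
    by (auto simp: annihilator_classes_def)
  obtain q where q: "x = cls q" "supported vs q"
    using x by (auto simp: carrier_art_ring)
  have "pdeg (q * p * r) = 0" if r: "supported vs r" for r
  proof -
    have "pdeg (p * (q * r)) = 0"
      using p(3) supported_mult[OF q(2) r] by (simp add: annihilator_def)
    thus ?thesis
      by (simp only: mult.assoc mult.left_commute)
  qed
  hence "cls (q * p) \<in> annihilator_classes"
    using p q by (subst cls_in_radical_iff) (simp_all add: supported_mult annihilator_def)
  thus "x \<otimes>\<^bsub>AR\<^esub> a \<in> annihilator_classes"
    using p q by (simp add: cls_mult)
  thus "a \<otimes>\<^bsub>AR\<^esub> x \<in> annihilator_classes"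
    using x closed[OF \<open>a \<in> annihilator_classes\<close>] by (simp add: A.m_comm)
qed

lemma deg_square:
  assumes p: "homogeneous vs n p" and P: "size P + 2 * n = d"
  shows "pdeg (p * p * monomial P 1) = square_pairing \<mu> p P"
proof -
  have "p * p = (\<Sum>m\<in>monomials p. monomial (m + m) ((coef p m)\<^sup>2))"
    using poly_mapping_square[OF two, of p] by (simp add: power2_eq_square)
  hence "pdeg (p * p * monomial P 1)
      = (\<Sum>m\<in>monomials p. pdeg (monomial (m + m + P) ((coef p m)\<^sup>2)))"
    by (simp add: sum_distrib_right mult_single deg_sum)
  also have "\<dots> = square_pairing \<mu> p P"
    unfolding square_pairing_def using p P
    by (intro sum.cong refl) (auto simp: pdeg_def linear_extension_single homogeneous_def)
  finally show ?thesis .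
qed

text \<open>Anisotropy in terms of representing polynomials: \<open>u\<^sup>2 = 0\<close> says that all \<open>u\<^sup>2 P\<close> have degree zero,
  and \<open>u = 0\<close> says that \<open>u\<close> is orthogonal to all monomials of the complementary degree.\<close>

lemma anisotropicI:
  assumes key: "\<And>n p. 2 * n \<le> d \<Longrightarrow> homogeneous vs n p \<Longrightarrow>
      (\<And>P. set_mset P \<subseteq> vs \<Longrightarrow> size P + 2 * n = d \<Longrightarrow> square_pairing \<mu> p P = 0) \<Longrightarrow>
      orthogonal \<mu> n p"
  shows "anisotropic type_ring \<Delta> d V \<mu>"
  unfolding anisotropic_def
proof (intro allI impI ballI notI)
  interpret rad: ideal annihilator_classes AR
    by (rule ideal_radical)
  let ?G = "gorenstein_ring (type_ring :: 'k ring) \<Delta> d V \<mu>"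
  have G: "?G = AR Quot annihilator_classes"
    by (simp add: gorenstein_ring_def radical_ideal_eq)
  interpret G: ring ?G
    unfolding G by (rule rad.quotient_is_ring)
  interpret h: ring_hom_ring AR ?G "\<lambda>a. annihilator_classes +>\<^bsub>AR\<^esub> a"
    unfolding G by (rule rad.rcos_ring_hom_ring)
  fix n u
  assume n: "2 * n \<le> d" and u: "u \<in> gorenstein_piece type_ring \<Delta> d V \<mu> n"
    and nonzero: "u \<noteq> \<zero>\<^bsub>?G\<^esub>" and square: "u [^]\<^bsub>?G\<^esub> (2::nat) = \<zero>\<^bsub>?G\<^esub>"
  obtain p where p: "u = annihilator_classes +>\<^bsub>AR\<^esub> cls p" "homogeneous vs n p"
    using u by (auto simp: gorenstein_piece_def art_piece_eq radical_ideal_eq)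
  note supp = homogeneous_supported[OF p(2)]
  have zero: "\<zero>\<^bsub>?G\<^esub> = annihilator_classes"
    unfolding G FactRing_def by simp
  have pp: "cls p \<otimes>\<^bsub>AR\<^esub> cls p = cls (p * p)"
    by (rule cls_mult[OF supp supp, symmetric])
  have "u [^]\<^bsub>?G\<^esub> (2::nat) = u \<otimes>\<^bsub>?G\<^esub> u"
    using h.hom_closed[OF cls_closed[OF supp]] by (simp add: numeral_2_eq_2 p(1))
  also have "\<dots> = annihilator_classes +>\<^bsub>AR\<^esub> cls (p * p)"
    unfolding p(1) pp[symmetric] by (rule h.hom_mult[symmetric]) (use supp in simp_all)
  finally have "annihilator_classes +>\<^bsub>AR\<^esub> cls (p * p) = annihilator_classes"
    using square zero by simp
  hence "cls (p * p) \<in> annihilator_classes"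
    by (rule rad.rcos_const_imp_mem[rotated]) (intro cls_closed supported_mult supp)
  hence ann: "annihilator (p * p)"
    by (simp add: cls_in_radical_iff supported_mult supp)
  have "square_pairing \<mu> p P = 0" if P: "set_mset P \<subseteq> vs" "size P + 2 * n = d" for P
    using ann P(1) deg_square[OF p(2) P(2)] by (simp add: annihilator_def supported_single)
  hence "orthogonal \<mu> n p"
    by (rule key[OF n p(2)])
  hence "cls p \<in> annihilator_classes"
    by (simp add: orthogonal_iff_annihilator[OF p(2)] cls_in_radical_iff[OF supp])
  hence "u = annihilator_classes"
    unfolding p(1) by (rule A.a_rcos_zero[OF ideal_radical])
  thus False
    using nonzero zero by simp
qed

lemma art_ring_nontrivial: "\<one>\<^bsub>AR\<^esub> \<noteq> \<zero>\<^bsub>AR\<^esub>"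
proof
  assume "\<one>\<^bsub>AR\<^esub> = \<zero>\<^bsub>AR\<^esub>"
  hence zero: "cls 1 = \<zero>\<^bsub>AR\<^esub>"
    by simp
  obtain F where F: "card F = d" "\<mu> F \<noteq> 0"
    using nontrivial by blast
  have F_face: "F \<in> \<Delta>"
    using F(2) outside by blast
  note FS = face_subset[OF F_face]
  have "pdeg (1 * monomial (mset_set F) 1) = 0"
    by (rule cls_zero_imp_deg[OF supported_1 zero squarefree_monomial_vertices(2)[OF FS]])
  moreover have "permanent V d F \<noteq> 0"
    using FS F(1) by (intro nondegenerate) auto
  ultimately show False
    using deg_face[OF F_face F(1)] F(2) by simp
qed

text \<open>There are no faces with more than \<open>d\<close> vertices, so all monomials at which spreading ends are zero.\<close>

lemma cls_large:
  assumes n: "set_mset n \<subseteq> vs" "size n > d"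
  shows "cls (monomial n 1) = \<zero>\<^bsub>AR\<^esub>"
proof (rule spread_support[where Z = "\<lambda>n. cls (monomial n 1) = \<zero>\<^bsub>AR\<^esub>" and T = "{}", OF _ _ _ _ n(1) refl])
  have nonface: "cls (monomial m 1) = \<zero>\<^bsub>AR\<^esub>"
    if "set_mset m \<subseteq> vs" "card (set_mset m) > d" for m
    using that face_card[of "set_mset m"] by (intro cls_nonface_monomial) auto
  show "cls (monomial m 1) = \<zero>\<^bsub>AR\<^esub>"
    if "set_mset m \<subseteq> vs" "card (set_mset m) > d" for m
    using that by (rule nonface)
  show "cls (monomial (mset_set T) 1) = \<zero>\<^bsub>AR\<^esub>"
    if T: "T \<subseteq> vs" "card T = size n" for T
  proof -
    have "finite T"
      using T(1) finite_vertices by (rule finite_subset)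
    thus ?thesis
      using T n(2) by (intro nonface) auto
  qed
  fix m c v
  assume m: "set_mset m \<subseteq> vs" and v: "v \<in> vs" "(\<Sum>i<d. c i * V i v) = 1"
    and IH: "\<And>w. w \<in> vs \<Longrightarrow> w \<noteq> v \<Longrightarrow> (\<Sum>i<d. c i * V i w) \<noteq> 0 \<Longrightarrow>
      cls (monomial (add_mset w m) 1) = \<zero>\<^bsub>AR\<^esub>"
  define l where "l w = (\<Sum>i<d. c i * V i w)" for w
  define r where "r = (\<Sum>w\<in>vs - {v}. monomial {#} (l w) * monomial (add_mset w m) 1)"
  have supp_w: "supported vs (monomial (add_mset w m) (1::'k))" if "w \<in> vs" for w
    using that m by (intro supported_single) auto
  have "(\<Sum>i<d. lform (V i) * monomial m (c i))
      = (\<Sum>i<d. \<Sum>w\<in>vs. monomial (add_mset w m) (c i * V i w))"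
    unfolding lform_def sum_distrib_right
    by (intro sum.cong refl) (simp add: mult_single mult.commute[of "V _ _"])
  also have "\<dots> = (\<Sum>w\<in>vs. monomial (add_mset w m) (l w))"
  proof (subst sum.swap, intro sum.cong refl)
    have "monomial k (\<Sum>i\<in>B. g i) = (\<Sum>i\<in>B. monomial k (g i))" for k :: "'v multiset" and g :: "nat \<Rightarrow> 'k" and B
      by (induction B rule: infinite_finite_induct) (auto simp: single_add)
    thus "(\<Sum>i<d. monomial (add_mset w m) (c i * V i w)) = monomial (add_mset w m) (l w)" for w
      by (simp add: l_def)
  qed
  also have "\<dots> = monomial (add_mset v m) 1 + r"
    using v finite_vertices by (simp add: r_def mult_single sum.remove l_def)
  finally have eq: "(\<Sum>i<d. lform (V i) * monomial m (c i)) = monomial (add_mset v m) 1 + r" .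
  have "cls (\<Sum>i<d. lform (V i) * monomial m (c i)) = finsum AR (\<lambda>i. cls (lform (V i) * monomial m (c i))) {..<d}"
    using m by (intro cls_sum) (auto intro!: supported_mult supported_lform supported_single)
  also have "\<dots> = \<zero>\<^bsub>AR\<^esub>"
    using m by (intro A.add.finprod_one_eqI) (simp add: cls_mult supported_lform supported_single cls_lform)
  finally have "cls (monomial (add_mset v m) 1 + r) = \<zero>\<^bsub>AR\<^esub>"
    unfolding eq .
  moreover have "cls r = \<zero>\<^bsub>AR\<^esub>"
  proof -
    have "cls r = finsum AR (\<lambda>w. cls (monomial {#} (l w) * monomial (add_mset w m) 1)) (vs - {v})"
      unfolding r_def using finite_vertices m
      by (intro cls_sum) (auto intro!: supported_mult supp_w supported_single)
    also have "\<dots> = \<zero>\<^bsub>AR\<^esub>"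
    proof (rule A.add.finprod_one_eqI)
      fix w assume w: "w \<in> vs - {v}"
      show "cls (monomial {#} (l w) * monomial (add_mset w m) 1) = \<zero>\<^bsub>AR\<^esub>"
      proof (cases "l w = 0")
        case False
        hence "cls (monomial (add_mset w m) 1) = \<zero>\<^bsub>AR\<^esub>"
          using IH[of w] w by (simp add: l_def)
        thus ?thesis
          using w m by (simp add: cls_mult supported_single)
      qed simp
    qed
    finally show ?thesis .
  qed
  moreover have "supported vs r"
    unfolding r_def using m by (intro supported_sum supported_mult supported_single) auto
  ultimately show "cls (monomial (add_mset v m) 1) = \<zero>\<^bsub>AR\<^esub>"
    using cls_add[OF supp_w[OF v(1)], of r] supp_w[OF v(1)] by simp
qed simp

text \<open>The monomials of degree at most \<open>d\<close> span the Artinian reduction because all others vanish.\<close>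

lemma linear_sop: "linear_sop type_ring \<Delta> d V"
proof -
  let ?c = "art_const (type_ring :: 'k ring) \<Delta> d V"
  have const: "ring_hom_ring type_ring AR ?c"
  proof (rule ring_hom_ringI2[OF ring_from_type_algebra A.ring_axioms])
    show "?c \<in> ring_hom type_ring AR"
    proof (rule ring_hom_memI)
      fix x y :: 'k
      show "?c x \<in> carrier AR"
        by (simp add: art_const_eq supported_single)
      show "?c (x \<otimes>\<^bsub>type_ring\<^esub> y) = ?c x \<otimes>\<^bsub>AR\<^esub> ?c y"
        by (simp add: art_const_eq supported_single mult_single flip: cls_mult)
      show "?c (x \<oplus>\<^bsub>type_ring\<^esub> y) = ?c x \<oplus>\<^bsub>AR\<^esub> ?c y"
        by (simp add: art_const_eq supported_single single_add flip: cls_add)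
    qed (simp add: art_const_eq flip: cls_1)
  qed
  have subfield: "subfield (?c ` carrier type_ring) AR"
    using ring_hom_ring.img_is_subfield(2)[OF const field.carrier_is_subfield[OF field_from_type_algebra] art_ring_nontrivial] .
  define B where "B = {n. set_mset n \<subseteq> vs \<and> size n \<le> d}"
  have "finite (mset ` {xs. set xs \<subseteq> vs \<and> length xs \<le> d})"
    using finite_vertices by (intro finite_imageI finite_lists_length_le)
  moreover have "B \<subseteq> mset ` {xs. set xs \<subseteq> vs \<and> length xs \<le> d}"
  proof
    fix n assume n: "n \<in> B"
    obtain xs where "mset xs = n"
      using ex_mset by blast
    thus "n \<in> mset ` {xs. set xs \<subseteq> vs \<and> length xs \<le> d}"
      using n by (intro image_eqI[of _ _ xs]) (auto simp: B_def)
  qed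
  ultimately have "finite B"
    by (rule finite_subset[rotated])
  then obtain ns where ns: "set ns = B"
    using finite_list by blast
  define Us where "Us = map (\<lambda>n. cls (monomial n 1)) ns"
  have Us: "set Us \<subseteq> carrier AR"
    using ns by (auto simp: Us_def B_def intro!: cls_closed supported_single)
  have mono: "cls (monomial n x) \<in> A.Span (?c ` carrier type_ring) Us" if n: "set_mset n \<subseteq> vs" for n x
  proof -
    have "cls (monomial n x) = ?c x \<otimes>\<^bsub>AR\<^esub> cls (monomial n 1)"
      using n by (simp add: art_const_times supported_single mult_single)
    also have "\<dots> \<in> A.Span (?c ` carrier type_ring) Us"
    proof (rule A.Span_smult_closed[OF subfield Us])
      show "cls (monomial n 1) \<in> A.Span (?c ` carrier type_ring) Us"
      proof (cases "size n \<le> d")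
        case True
        hence "cls (monomial n 1) \<in> set Us"
          using n ns by (auto simp: Us_def B_def)
        thus ?thesis
          using A.Span_base_incl[OF subfield Us] by blast
      next
        case False
        thus ?thesis
          using cls_large[OF n] A.Span_subgroup_props(2)[OF subfield Us] by simp
      qed
    qed simp
    finally show ?thesis .
  qed
  have "carrier AR = A.Span (?c ` carrier type_ring) Us"
  proof (intro equalityI subsetI)
    fix a assume "a \<in> carrier AR"
    then obtain p where p: "a = cls p" "supported vs p"
      by (auto simp: carrier_art_ring)
    have "cls (\<Sum>n\<in>C. monomial n (coef p n)) \<in> A.Span (?c ` carrier type_ring) Us"
      if "finite C" "C \<subseteq> monomials p" for C
      using that
    proof (induction C rule: finite_induct)
      case empty
      show ?case
        using A.Span_subgroup_props(2)[OF subfield Us] by simp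
    next
      case (insert n C)
      have keys: "set_mset m \<subseteq> vs" if "m \<in> insert n C" for m
        using that insert.prems p(2) by (auto simp: supported_def)
      have "cls (monomial n (coef p n) + (\<Sum>n\<in>C. monomial n (coef p n)))
          = cls (monomial n (coef p n)) \<oplus>\<^bsub>AR\<^esub> cls (\<Sum>n\<in>C. monomial n (coef p n))"
        using keys by (intro cls_add supported_sum supported_single) auto
      thus ?case
        using insert mono[of n] keys[of n] A.Span_subgroup_props(3)[OF subfield Us] by simp
    qed
    from this[of "monomials p"] show "a \<in> A.Span (?c ` carrier type_ring) Us"
      by (simp add: p(1) flip: poly_mapping_sum_single)
  next
    fix a assume "a \<in> A.Span (?c ` carrier type_ring) Us"
    thus "a \<in> carrier AR"
      using A.Span_subgroup_props(1)[OF subfield Us] by blast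
  qed
  hence "A.finite_dimension (?c ` carrier type_ring) (carrier AR)"
    using A.Span_finite_dimension[OF subfield Us] by simp
  thus ?thesis
    by (simp add: linear_sop_def)
qed

end

section \<open>Anisotropy\<close>

lemma cycle_support_complex:
  assumes "simplicial_complex \<Delta>" "simplicial_cycle type_ring \<Delta> d (\<mu> :: 'v::linorder set \<Rightarrow> 'a::field)"
  shows "simplicial_complex (cycle_support type_ring \<mu>)"
    and "G \<in> cycle_support type_ring \<mu> \<Longrightarrow> card G \<le> d"
    and "\<exists>F\<in>cycle_support type_ring \<mu>. card F = d \<and> \<mu> F \<noteq> 0"
    and "F \<notin> cycle_support type_ring \<mu> \<Longrightarrow> \<mu> F = 0"
proof -
  have facet: "F \<in> \<Delta> \<and> card F = d" if "\<mu> F \<noteq> 0" for F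
    using assms(2) that by (auto simp: simplicial_cycle_def chains_def split: if_splits)
  have nonzero: "\<exists>F. \<mu> F \<noteq> 0"
    using assms(2) by (simp add: simplicial_cycle_def)
  have sub: "cycle_support type_ring \<mu> \<subseteq> \<Delta>"
    using assms(1) facet by (auto simp: cycle_support_def simplicial_complex_def)
  have finite: "finite \<Delta>" "\<And>F. F \<in> \<Delta> \<Longrightarrow> finite F"
    using assms(1) by (auto simp: simplicial_complex_def)
  show "simplicial_complex (cycle_support type_ring \<mu>)"
    unfolding simplicial_complex_def
  proof (intro conjI ballI allI impI)
    show "finite (cycle_support type_ring \<mu>)"
      by (rule finite_subset[OF sub finite(1)])
    show "{} \<in> cycle_support type_ring \<mu>"
      using nonzero by (simp add: cycle_support_def)
    show "finite F" if "F \<in> cycle_support type_ring \<mu>" for F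
      using that sub finite(2) by blast
    show "G \<in> cycle_support type_ring \<mu>" if "F \<in> cycle_support type_ring \<mu>" "G \<subseteq> F" for F G
      using that unfolding cycle_support_def by blast
  qed
  show "card G \<le> d" if G: "G \<in> cycle_support type_ring \<mu>"
  proof -
    obtain F where F: "\<mu> F \<noteq> 0" "G \<subseteq> F"
      using G by (auto simp: cycle_support_def)
    hence "finite F" "card F = d"
      using facet finite(2) by auto
    thus ?thesis
      using F(2) card_mono by blast
  qed
  show "\<exists>F\<in>cycle_support type_ring \<mu>. card F = d \<and> \<mu> F \<noteq> 0"
    using nonzero facet by (auto simp: cycle_support_def)
  show "\<mu> F = 0" if "F \<notin> cycle_support type_ring \<mu>"
    using that by (auto simp: cycle_support_def)
qed

text \<open>The cycle condition without signs and with the sum extended to all vertices of the support. At a set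
  that is not a face of the complex all summands are zero.\<close>

lemma cycle_ridge_sum:
  fixes \<mu> :: "'v::linorder set \<Rightarrow> 'a::field"
  assumes two: "(1::'a) + 1 = 0"
    and complex: "simplicial_complex \<Delta>" and cycle: "simplicial_cycle type_ring \<Delta> d \<mu>"
    and G: "Suc (card G) = d"
  shows "(\<Sum>v\<in>vertices (cycle_support type_ring \<mu>) - G. \<mu> (insert v G)) = 0"
proof -
  let ?S = "vertices (cycle_support type_ring \<mu>)"
  let ?B = "{v. v \<notin> G \<and> insert v G \<in> \<Delta>}"
  have facet: "F \<in> \<Delta>" if "\<mu> F \<noteq> 0" for F
    using cycle that by (auto simp: simplicial_cycle_def chains_def split: if_splits)
  have finite_S: "finite ?S"
    by (rule face_algebra.finite_vertices) (simp add: face_algebra_def cycle_support_complex(1)[OF complex cycle])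
  have finite_B: "finite ?B"
  proof (rule finite_subset)
    show "?B \<subseteq> vertices \<Delta>"
      using complex by (auto simp: simplicial_complex_def vertices_def)
    show "finite (vertices \<Delta>)"
      by (rule face_algebra.finite_vertices) (simp add: face_algebra_def complex)
  qed
  have "(\<Sum>v\<in>?S - G. \<mu> (insert v G)) = (\<Sum>v\<in>?B. \<mu> (insert v G))"
  proof (rule sum.mono_neutral_cong[OF finite_B])
    show "\<mu> (insert v G) = 0" if "v \<in> ?B - (?S - G)" for v
      using that by (auto simp: vertices_def cycle_support_def)
    show "\<mu> (insert v G) = 0" if "v \<in> (?S - G) - ?B" for v
      using that facet by auto
  qed (use finite_S in auto)
  also have "\<dots> = 0"
  proof (cases "G \<in> \<Delta>")
    case True
    hence "boundary type_ring \<Delta> \<mu> G = 0"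
      using cycle G by (simp add: simplicial_cycle_def)
    thus ?thesis
      by (simp add: boundary_def char_two_minus[OF two])
  next
    case False
    hence "?B = {}"
      using complex by (auto simp: simplicial_complex_def)
    thus ?thesis
      by (simp only: sum.empty)
  qed
  finally show ?thesis .
qed

theorem theorem3:
  fixes \<Delta> :: "'v::linorder set set"
    and \<mu> :: "'v set \<Rightarrow> 'a::field"
    and d :: nat
  defines "k \<equiv> (ring_of_type_algebra :: 'a ring)"
  assumes "CHAR('a) = 2"
    and "simplicial_complex \<Delta>"
    and "max_face_card \<Delta> = d"
    and "simplicial_cycle k \<Delta> d \<mu>"
  shows "\<exists>(k' :: 'a ext_carrier ring) \<iota> V.
           field k' \<and> \<iota> \<in> ring_hom k k' \<and>
           linear_sop k' (cycle_support k \<mu>) d V \<and>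
           anisotropic k' (cycle_support k \<mu>) d V (\<iota> \<circ> \<mu>)"
proof -
  have "of_nat 2 = (0::'a)"
    using of_nat_CHAR[where 'a = 'a] assms(2) by simp
  hence char_two: "(1::'a) + 1 = 0"
    by simp
  have complex: "simplicial_complex \<Delta>" and cycle: "simplicial_cycle type_ring \<Delta> d \<mu>"
    using assms by (simp_all add: k_def)
  define D where "D = cycle_support type_ring \<mu>"
  define S where "S = vertices D"
  note support = cycle_support_complex[OF complex cycle, folded D_def]
  have D: "face_algebra D"
    by (rule face_algebra.intro) (rule support(1))
  have finite_S: "finite S"
    unfolding S_def by (rule face_algebra.finite_vertices[OF D])
  obtain F where F: "F \<in> D" "card F = d" "\<mu> F \<noteq> 0"
    using support(3) by blast
  have FS: "F \<subseteq> S"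
    unfolding S_def by (rule face_algebra.face_subset[OF D F(1)])
  hence card_S: "d \<le> card S"
    using F(2) card_mono[OF finite_S] by blast
  obtain apex where apex: "d > 0 \<Longrightarrow> apex \<in> S"
    using FS F(2) by (metis card.empty less_irrefl subsetD ex_in_conv)
  obtain idx :: "nat \<times> 'v \<Rightarrow> nat" where idx: "inj_on idx ({..<d} \<times> insert apex S)"
    using finite_imp_inj_to_nat_seg[of "{..<d} \<times> insert apex S"] finite_S by auto
  define V :: "nat \<Rightarrow> 'v \<Rightarrow> 'a ext_carrier" where "V = generic_matrix idx"
  \<comment> \<open>the Frobenius embedding, which squares the coefficients of the cycle\<close>
  define \<iota> :: "'a \<Rightarrow> 'a ext_carrier" where "\<iota> c = (ext_const c)\<^sup>2" for c
  have square_add: "(x + y)\<^sup>2 = x\<^sup>2 + y\<^sup>2" for x y :: "'a ext_carrier"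
    using square_sum_char_two[OF ext_char_two[OF char_two], of "\<lambda>b. if b then x else y" UNIV]
    by (simp add: UNIV_bool add.commute)
  have \<iota>_hom: "\<iota> \<in> ring_hom k type_ring"
    unfolding k_def \<iota>_def
    by (rule ring_hom_memI) (simp_all add: ext_const_add ext_const_mult ext_const_one square_add power_mult_distrib)
  interpret generic: generic_configuration V d S apex ext_twist
    unfolding V_def by (rule generic_matrix_configuration[OF char_two finite_S card_S apex idx])
  have \<iota>_sum: "(\<Sum>x\<in>B. \<iota> (f x)) = \<iota> (\<Sum>x\<in>B. f x)" for f :: "'v \<Rightarrow> 'a" and B
    by (simp add: \<iota>_def ext_const_sum generic.square_sum)
  interpret cycle_algebra D d V apex "\<iota> \<circ> \<mu>"
  proof (intro cycle_algebra.intro cycle_algebra_axioms.intro)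
    show "column_configuration V d (vertices D) apex"
      using generic.column_configuration_axioms by (simp add: S_def)
    show "face_algebra D"
      by (rule D)
    show "column_configuration.is_cycle d (vertices D) (\<iota> \<circ> \<mu>)"
      using cycle_ridge_sum[OF char_two complex cycle] generic.is_cycle_def[of "\<iota> \<circ> \<mu>"]
      by (simp add: \<iota>_sum S_def D_def) (simp add: \<iota>_def)
    show "(\<iota> \<circ> \<mu>) G = 0" if "G \<notin> D" for G
      using support(4)[OF that] by (simp add: \<iota>_def)
    show "card G \<le> d" if "G \<in> D" for G
      by (rule support(2)[OF that])
    show "\<exists>F. card F = d \<and> (\<iota> \<circ> \<mu>) F \<noteq> 0"
      using F by (auto simp: \<iota>_def)
  qed
  have "anisotropic type_ring D d V (\<iota> \<circ> \<mu>)"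
  proof (rule anisotropicI)
    fix n p
    assume n: "2 * n \<le> d" and p: "homogeneous (vertices D) n p"
      and zero: "\<And>P. set_mset P \<subseteq> vertices D \<Longrightarrow> size P + 2 * n = d \<Longrightarrow> square_pairing (\<iota> \<circ> \<mu>) p P = 0"
    have \<nu>: "\<iota> \<circ> \<mu> = (\<lambda>F. (ext_const (\<mu> F))\<^sup>2)"
      by (simp add: fun_eq_iff \<iota>_def)
    have "ext_twist (ext_const (\<mu> F)) = (ext_const (\<mu> F))\<^sup>2" for F
      by (rule ext_twist_const[OF char_two])
    from generic.square_zero_imp_orthogonal_square[of "\<lambda>F. ext_const (\<mu> F)", OF this n]
    show "orthogonal (\<iota> \<circ> \<mu>) n p"
      using p zero unfolding \<nu> S_def by blast
  qed
  moreover have "field (type_ring :: 'a ext_carrier ring)"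
    by (rule field_from_type_algebra)
  ultimately show ?thesis
    using \<iota>_hom linear_sop unfolding D_def k_def by blast
qed

end
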